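(* Let $T,N\in\mathbb N$, let $\ell_1,\dots,\ell_T>0$, and let $\boldsymbol\pi_{T,D}=\pi_T^{\otimes D}$ be as in the context. Assume that the density $\pi_T$ is twice continuously differentiable and that for all $s,t\in[T]$ the function $\partial_s\partial_t\log\pi_T$ is Lipschitz-continuous and bounded and $\pi_T(|\partial_t\log\pi_T|^4)<\infty$. Let $\tilde d^{N}_{T,D,\mathbf x_{1:T}}$ be the total variation distance between the law of the index vector $K_{1:T}$ generated by one RW-EHMM update started from $\mathbf x_{1:T}\in(\mathbb R^D)^T$ and the law of $K_{1:T}$ under the limiting law $\widetilde{\mathbb P}^N_T$ defined in the context. Then there exists a family of Borel sets $\mathbf F_{T,D}\subseteq(\mathbb R^D)^T$, $D\ge1$, with $\lim_{D\to\infty}\boldsymbol\pi_{T,D}(\mathbf F_{T,D})=1$ and $$\lim_{D\to\infty}\ \sup_{\mathbf x_{1:T}\in\mathbf F_{T,D}}\tilde d^{N}_{T,D,\mathbf x_{1:T}}=0 .$$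
   Context: Notation: $[n]=\{1,\dots,n\}$, $[n]_0=\{0,\dots,n\}$; $\partial_t$ is the derivative with respect to $x_t$; $\pi_T(\varphi)=\int\varphi\,\pi_T$; $\mathbf 1_N$ is the all-ones vector and $I_N$ the identity. Quantities with time index $0$ are ignored. Model. $M_1$ is a probability measure on $\mathbb R$ with Lebesgue density $m_1$; for $t\ge2$, $M_t$ is a Markov kernel on $\mathbb R$ with transition density $m_t(x,y)$; $G_t:\mathbb R\to(0,\infty)$ is measurable. $\pi_T$ is the probability measure (and its density) on $\mathbb R^T$ given by $\pi_T(x_{1:T})\propto m_1(x_1)G_1(x_1)\prod_{t=2}^T m_t(x_{t-1},x_t)G_t(x_t)$. For $D\in\mathbb N$, $\mathbf x_t=(x_{t,1},\dots,x_{t,D})\in\mathbb R^D$, the target is $\boldsymbol\pi_{T,D}(\mathbf x_{1:T})=\prod_{d=1}^D\pi_T(x_{1,d},\dots,x_{T,d})$ on $(\mathbb R^D)^T$. Let $\Sigma=\tfrac12(I_N+\mathbf 1_N\mathbf 1_N^{\mathsf T})$. One RW-EHMM update from $\mathbf x_{1:T}$: set $\mathbf Z_t^0=\mathbf x_t$; independently for all $t\in[T]$, $d\in[D]$ sample $U_{t,d}^{1:N}\sim \mathrm N(0,\Sigma)$ and set $Z_{t,d}^n=x_{t,d}+\sqrt{\ell_t/D}\,U_{t,d}^n$, $\mathbf Z_t^n=(Z_{t,1}^n,\dots,Z_{t,D}^n)$ for $n\in[N]$. Then sample $K_{1:T}=k_{1:T}\in[N]_0^T$ with probability $\boldsymbol\pi_{T,D}(\mathbf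 Z_1^{k_1},\dots,\mathbf Z_T^{k_T})\big/\sum_{l_{1:T}\in[N]_0^T}\boldsymbol\pi_{T,D}(\mathbf Z_1^{l_1},\dots,\mathbf Z_T^{l_T})$. The new state is $(\mathbf Z_1^{K_1},\dots,\mathbf Z_T^{K_T})$. Limiting law $\widetilde{\mathbb P}^N_T$. Let $\mathcal I_{t|T}=\pi_T([\partial_t\log\pi_T]^2)=-\pi_T(\partial_t^2\log\pi_T)$. Sample independently for $t\in[T]$ vectors $V_t=(V_t^1,\dots,V_t^N)\sim \mathrm N(-\tfrac12\ell_t\mathcal I_{t|T}\mathbf 1_N,\ \ell_t\mathcal I_{t|T}\Sigma)$, and given these sample $K_1,\dots,K_T$ conditionally independently with $K_t=k\in[N]_0$ having probability $\Psi^k(\{V_t^m\}_{m=1}^N)$, where $\Psi^k(\{h^m\}_{m=1}^N)=e^{h^k}/(1+\sum_{m=1}^N e^{h^m})$ with $h^0:=0$. *)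

theory Defs
  imports "HOL-Probability.Probability"
begin

text \<open>
  A point of \<open>\<real>\<^sup>T\<close> is a function \<open>x :: nat \<Rightarrow> real\<close> of which only the coordinates
  \<open>{1..T}\<close> matter; a point of \<open>(\<real>\<^sup>D)\<^sup>T\<close> is a function \<open>x :: nat \<Rightarrow> nat \<Rightarrow> real\<close>, where
  \<open>x t d\<close> is the \<open>d\<close>-th component at time \<open>t\<close>.  The set \<open>[N]\<close> of proposal labels is a finite
  type \<open>'n\<close> with \<open>N = CARD('n)\<close>, and \<open>[N]\<^sub>0\<close> is \<open>'n option\<close>, where \<open>None\<close> is the label 0 of the
  current state.
\<close>

section \<open>The target distribution\<close>

definition fk_model ::
  "nat \<Rightarrow> (real \<Rightarrow> real) \<Rightarrow> (nat \<Rightarrow> real \<Rightarrow> real \<Rightarrow> real) \<Rightarrow> (nat \<Rightarrow> real \<Rightarrow> real) \<Rightarrow> bool" where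
  "fk_model T m1 m G \<longleftrightarrow>
     m1 \<in> borel_measurable borel \<and> (\<forall>y. 0 \<le> m1 y) \<and> prob_space (density lborel (\<lambda>y. ennreal (m1 y))) \<and>
     (\<forall>t\<in>{2..T}. (\<lambda>(x, y). m t x y) \<in> borel_measurable (borel \<Otimes>\<^sub>M borel) \<and>
        (\<forall>x y. 0 \<le> m t x y) \<and> (\<forall>x. prob_space (density lborel (\<lambda>y. ennreal (m t x y))))) \<and>
     (\<forall>t\<in>{1..T}. G t \<in> borel_measurable borel \<and> (\<forall>x. 0 < G t x))"

definition fk_unnorm ::
  "nat \<Rightarrow> (real \<Rightarrow> real) \<Rightarrow> (nat \<Rightarrow> real \<Rightarrow> real \<Rightarrow> real) \<Rightarrow> (nat \<Rightarrow> real \<Rightarrow> real) \<Rightarrow>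
   (nat \<Rightarrow> real) \<Rightarrow> real" where
  "fk_unnorm T m1 m G x =
     m1 (x 1) * G 1 (x 1) * (\<Prod>t=2..T. m t (x (t - 1)) (x t) * G t (x t))"

definition fk_density ::
  "nat \<Rightarrow> (real \<Rightarrow> real) \<Rightarrow> (nat \<Rightarrow> real \<Rightarrow> real \<Rightarrow> real) \<Rightarrow> (nat \<Rightarrow> real \<Rightarrow> real) \<Rightarrow>
   (nat \<Rightarrow> real) \<Rightarrow> real" where
  "fk_density T m1 m G x =
     fk_unnorm T m1 m G x / (\<integral>z. fk_unnorm T m1 m G z \<partial>(\<Pi>\<^sub>M t\<in>{1..T}. lborel))"

definition path_law :: "nat \<Rightarrow> ((nat \<Rightarrow> real) \<Rightarrow> real) \<Rightarrow> (nat \<Rightarrow> real) measure" where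
  "path_law T p = density (\<Pi>\<^sub>M t\<in>{1..T}. lborel) (\<lambda>x. ennreal (p x))"

definition target_density ::
  "((nat \<Rightarrow> real) \<Rightarrow> real) \<Rightarrow> nat \<Rightarrow> (nat \<Rightarrow> nat \<Rightarrow> real) \<Rightarrow> real" where
  "target_density p D x = (\<Prod>d=1..D. p (\<lambda>t. x t d))"

definition target_law ::
  "nat \<Rightarrow> ((nat \<Rightarrow> real) \<Rightarrow> real) \<Rightarrow> nat \<Rightarrow> (nat \<Rightarrow> nat \<Rightarrow> real) measure" where
  "target_law T p D =
     density (\<Pi>\<^sub>M t\<in>{1..T}. \<Pi>\<^sub>M d\<in>{1..D}. lborel)
       (\<lambda>x. ennreal (target_density p D x))"

section \<open>Regularity of functions on \<open>\<real>\<^sup>T\<close>\<close>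

definition partial :: "nat \<Rightarrow> ((nat \<Rightarrow> real) \<Rightarrow> real) \<Rightarrow> (nat \<Rightarrow> real) \<Rightarrow> real" where
  "partial t f x = deriv (\<lambda>u. f (x(t := u))) (x t)"

definition has_partials :: "nat \<Rightarrow> ((nat \<Rightarrow> real) \<Rightarrow> real) \<Rightarrow> bool" where
  "has_partials T f \<longleftrightarrow> (\<forall>t\<in>{1..T}. \<forall>x. (\<lambda>u. f (x(t := u))) differentiable at (x t))"

text \<open>
  Continuity below refers to the product topology on \<open>nat \<Rightarrow> real\<close>.  For a function that depends
  only on the coordinates in \<open>{1..T}\<close> this is the usual continuity on \<open>\<real>\<^sup>T\<close>.
\<close>

definition twice_cont_diff :: "nat \<Rightarrow> ((nat \<Rightarrow> real) \<Rightarrow> real) \<Rightarrow> bool" where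
  "twice_cont_diff T f \<longleftrightarrow>
     has_partials T f \<and> (\<forall>t\<in>{1..T}. has_partials T (partial t f)) \<and>
     continuous_on UNIV f \<and> (\<forall>t\<in>{1..T}. continuous_on UNIV (partial t f)) \<and>
     (\<forall>s\<in>{1..T}. \<forall>t\<in>{1..T}. continuous_on UNIV (partial s (partial t f)))"

definition euclid_lipschitz :: "nat \<Rightarrow> ((nat \<Rightarrow> real) \<Rightarrow> real) \<Rightarrow> bool" where
  "euclid_lipschitz T f \<longleftrightarrow>
     (\<exists>L. \<forall>x y. \<bar>f x - f y\<bar> \<le> L * L2_set (\<lambda>t. x t - y t) {1..T})"

definition log_density :: "((nat \<Rightarrow> real) \<Rightarrow> real) \<Rightarrow> (nat \<Rightarrow> real) \<Rightarrow> real" where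
  "log_density p x = ln (p x)"

section \<open>Gaussian laws and total variation\<close>

text \<open>
  \<open>N(\<mu>, S)\<close> through its density; only meaningful for symmetric positive definite \<open>S\<close>.
\<close>

definition mv_normal :: "real^'n \<Rightarrow> real^'n^'n \<Rightarrow> (real^'n) measure" where
  "mv_normal \<mu> S = density lborel (\<lambda>v.
     ennreal (exp (- ((v - \<mu>) \<bullet> (matrix_inv S *v (v - \<mu>))) / 2)
              / sqrt ((2 * pi) ^ CARD('n) * det S)))"

definition Sigma_cov :: "real^'n^'n" where
  "Sigma_cov = (1/2) *\<^sub>R (mat 1 + (\<chi> i j. 1))"

text \<open>Both measures are assumed to be probability measures on the same \<open>\<sigma>\<close>-algebra.\<close>

definition tv_dist :: "'a measure \<Rightarrow> 'a measure \<Rightarrow> real" where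
  "tv_dist P Q = (SUP A\<in>sets P. \<bar>measure P A - measure Q A\<bar>)"

section \<open>The law of the index vector in one RW-EHMM update\<close>

text \<open>\<open>U (t, d) $ n\<close> is the Gaussian increment \<open>U\<^sub>t\<^sub>,\<^sub>d\<^sup>n\<close>.\<close>

definition proposal ::
  "(nat \<Rightarrow> real) \<Rightarrow> nat \<Rightarrow> (nat \<Rightarrow> nat \<Rightarrow> real) \<Rightarrow> (nat \<times> nat \<Rightarrow> real^'n) \<Rightarrow>
   nat \<Rightarrow> 'n option \<Rightarrow> nat \<Rightarrow> real" where
  "proposal l D x U t k d =
     (case k of None \<Rightarrow> x t d | Some n \<Rightarrow> x t d + sqrt (l t / real D) * U (t, d) $ n)"

definition index_vectors :: "nat \<Rightarrow> (nat \<Rightarrow> 'n option) set" where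
  "index_vectors T = (\<Pi>\<^sub>E t\<in>{1..T}. UNIV)"

definition ehmm_weight ::
  "((nat \<Rightarrow> real) \<Rightarrow> real) \<Rightarrow> (nat \<Rightarrow> real) \<Rightarrow> nat \<Rightarrow> (nat \<Rightarrow> nat \<Rightarrow> real) \<Rightarrow>
   (nat \<times> nat \<Rightarrow> real^'n) \<Rightarrow> (nat \<Rightarrow> 'n option) \<Rightarrow> real" where
  "ehmm_weight p l D x U k = target_density p D (\<lambda>t. proposal l D x U t (k t))"

definition ehmm_selection ::
  "nat \<Rightarrow> ((nat \<Rightarrow> real) \<Rightarrow> real) \<Rightarrow> (nat \<Rightarrow> real) \<Rightarrow> nat \<Rightarrow> (nat \<Rightarrow> nat \<Rightarrow> real) \<Rightarrow>
   (nat \<times> nat \<Rightarrow> real^'n) \<Rightarrow> (nat \<Rightarrow> 'n option) measure" where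
  "ehmm_selection T p l D x U =
     point_measure (index_vectors T)
       (\<lambda>k. ennreal (ehmm_weight p l D x U k
                     / (\<Sum>j\<in>index_vectors T. ehmm_weight p l D x U j)))"

definition ehmm_index_law ::
  "nat \<Rightarrow> ((nat \<Rightarrow> real) \<Rightarrow> real) \<Rightarrow> (nat \<Rightarrow> real) \<Rightarrow> nat \<Rightarrow> (nat \<Rightarrow> nat \<Rightarrow> real) \<Rightarrow>
   (nat \<Rightarrow> ('n::finite) option) measure" where
  "ehmm_index_law T p l D x =
     (\<Pi>\<^sub>M td\<in>{1..T} \<times> {1..D}. mv_normal 0 (Sigma_cov :: real^'n^'n)) \<bind> ehmm_selection T p l D x"

section \<open>The limiting law\<close>

definition fisher_info :: "nat \<Rightarrow> ((nat \<Rightarrow> real) \<Rightarrow> real) \<Rightarrow> nat \<Rightarrow> real" where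
  "fisher_info T p t = (\<integral>x. (partial t (log_density p) x)\<^sup>2 \<partial>path_law T p)"

definition Psi :: "real^'n \<Rightarrow> 'n option \<Rightarrow> real" where
  "Psi h k = exp (case k of None \<Rightarrow> 0 | Some n \<Rightarrow> h $ n) / (1 + (\<Sum>m\<in>UNIV. exp (h $ m)))"

definition limit_index_law ::
  "nat \<Rightarrow> ((nat \<Rightarrow> real) \<Rightarrow> real) \<Rightarrow> (nat \<Rightarrow> real) \<Rightarrow> (nat \<Rightarrow> ('n::finite) option) measure" where
  "limit_index_law T p l =
     (\<Pi>\<^sub>M t\<in>{1..T}. mv_normal (\<chi> n. - (l t * fisher_info T p t) / 2)
                        ((l t * fisher_info T p t) *\<^sub>R (Sigma_cov :: real^'n^'n)))
     \<bind> (\<lambda>V. \<Pi>\<^sub>M t\<in>{1..T}. point_measure UNIV (\<lambda>k. ennreal (Psi (V t) k)))"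

end

theory Submission
  imports Defs
begin

text \<open>
  The log-likelihood ratios of the proposed paths are expanded to second order in the noise.  Given a
  typical state, the first-order part is exactly Gaussian with covariance close to
  \<open>\<ell>\<^sub>t \<I>\<^sub>t \<Sigma>\<close> and independent over \<open>t\<close>, so after a deterministic rescaling it
  has exactly the law of the limiting potentials; no central limit theorem is needed.  The diagonal second-order
  part concentrates at \<open>- \<ell>\<^sub>t \<I>\<^sub>t / 2\<close> by the law of large numbers together with
  \<open>\<pi>\<^sub>T (\<partial>\<^sub>t\<^sup>2 log \<pi>\<^sub>T) = - \<I>\<^sub>t\<close>, the mixed part is centred
  with variance of order \<open>1 / D\<close>, and the Lipschitz remainder is of order \<open>D\<^sup>-\<^sup>1\<^sup>/\<^sup>2\<close>
  in mean.  Realising both index laws with the same noise, the Lipschitz continuity of the softmax function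
  bounds their total variation distance.  Chebyshev's inequality shows that the typical states have
  probability tending to one.
\<close>

section \<open>Gaussian laws with covariance proportional to \<open>\<Sigma>\<close>\<close>

text \<open>The obstacle is that, given the state, the first-order part has covariance
  \<open>l t * m t\<close> times Sigma with the empirical information \<open>m t\<close>, not
  \<open>I t\<close>. Instead of comparing two Gaussian laws, the factor
  \<open>r t = sqrt (I t / m t)\<close> turns the mismatch into an additive error on the same noise,
  so that only mean absolute errors of log weights remain to be bounded. This works only if
  \<open>I t\<close> is positive, which is a consequence of integrability of the density along lines
  and not an assumption. The shape of Sigma = (I + 11^T)/2 is exploited twice: its determinant and
  inverse are explicit, and a vector with this covariance is a shared normal variable plus
  independent ones, which gives total mass and marginals by integrating one coordinate at a time.
  Typicality is imposed on averages of squared scores, so Chebyshev's inequality asks for fourth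
  moments of the score. Mixed second derivatives enter only multiplied by independent centred noise,
  so for them a uniform bound replaces a law of large numbers.\<close>

lemma det_unit_rows_ones_row:
  fixes a :: "'n::finite"
  shows "det ((\<chi> i j. if i = a then 1 else if i = j then 1 else 0) :: real^'n^'n) = 1"
proof -
  have rows: "row i (mat 1 :: real^'n^'n) = axis i 1" for i
    by (simp add: row_def mat_def axis_def vec_eq_iff)
  \<comment> \<open>The other unit rows sum to the all-ones vector minus \<open>axis a 1\<close>,
    and adding a vector from the span of the other rows to row \<open>a\<close> keeps the
    determinant.\<close>
  define x :: "real^'n" where "x = (\<Sum>j\<in>UNIV - {a}. axis j 1)"
  have "x \<in> vec.span {row j (mat 1 :: real^'n^'n) |j. j \<noteq> a}"
    unfolding x_def rows by (intro vec.span_sum vec.span_base) auto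
  from det_row_span[OF this]
  have "det ((\<chi> k. if k = a then row a (mat 1) + x else row k (mat 1)) :: real^'n^'n) = 1"
    by simp
  moreover have "axis a (1::real) + x = 1"
  proof -
    have "axis a 1 + x = (\<Sum>j\<in>UNIV. axis j 1)"
      unfolding x_def by (simp add: sum.remove[of UNIV a])
    also have "\<dots> = 1"
      by (simp add: vec_eq_iff axis_def)
    finally show ?thesis .
  qed
  ultimately have "det ((\<chi> k. if k = a then 1 else axis k 1) :: real^'n^'n) = 1"
    by (simp add: rows cong: if_cong)
  also have "((\<chi> k. if k = a then 1 else axis k 1) :: real^'n^'n) =
      (\<chi> i j. if i = a then 1 else if i = j then 1 else 0)"
    by (auto simp: vec_eq_iff axis_def)
  finally show ?thesis .
qed

lemma det_ones_row_added:
  fixes a :: "'n::finite"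
  assumes "a \<notin> S"
  shows "det ((\<chi> i j. if i = a then 1 else (if i = j then 1 else 0) + (if i \<in> S then 1 else 0))
    :: real^'n^'n) = 1" (is "det (?B S) = 1")
  using finite[of S] assms
proof (induction S rule: finite_induct)
  case empty
  then show ?case by (simp add: det_unit_rows_ones_row cong: if_cong)
next
  case (insert s S)
  have "det (\<chi> k. if k = s then row s (?B S) + 1 *s row a (?B S) else row k (?B S)) = det (?B S)"
    by (rule det_row_operation) (use insert in auto)
  also have "(\<chi> k. if k = s then row s (?B S) + 1 *s row a (?B S) else row k (?B S)) = ?B (insert s S)"
    using insert by (auto simp: vec_eq_iff row_def)
  finally show ?case using insert by simp
qed

text \<open>Induction over the modified rows: the new row is a unit vector plus the all-ones vector,
  and linearity in that row adds one more determinant, equal to 1 by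
  \<open>det_ones_row_added\<close>. The case \<open>S = UNIV\<close> is the determinant of I +
  11^T.\<close>

lemma det_mat_1_add_ones_on:
  "det ((\<chi> i j. (if i = j then 1 else 0) + (if i \<in> S then 1 else 0)) :: real^'n^'n)
    = 1 + card (S :: 'n::finite set)" (is "det (?A S) = _")
  using finite[of S]
proof (induction S rule: finite_induct)
  case empty
  have "?A {} = mat 1" by (simp add: vec_eq_iff mat_def)
  then show ?case by simp
next
  case (insert a S)
  have "?A (insert a S) = (\<chi> i. if i = a then axis a 1 + 1 else ?A S $ i)"
    by (auto simp: vec_eq_iff axis_def)
  then have "det (?A (insert a S)) = det (\<chi> i. if i = a then axis a 1 else ?A S $ i)
      + det (\<chi> i. if i = a then 1 else ?A S $ i)"
    by (simp only: det_row_add)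
  also have "(\<chi> i. if i = a then axis a 1 else ?A S $ i) = ?A S"
    using insert by (auto simp: vec_eq_iff axis_def)
  also have "(\<chi> i. if i = a then 1 else ?A S $ i) =
      (\<chi> i j. if i = a then 1 else (if i = j then 1 else 0) + (if i \<in> S then 1 else 0))"
    by (auto simp: vec_eq_iff)
  finally show ?case using insert by (simp add: det_ones_row_added)
qed

lemma det_scaleR_matrix: "det (c *\<^sub>R (A :: real^'n^'n)) = c ^ CARD('n) * det A"
proof -
  have "c *\<^sub>R A = (\<chi> i. c *s (A $ i))" by (simp add: vec_eq_iff)
  then have "det (c *\<^sub>R A) = prod (\<lambda>_. c) (UNIV :: 'n set) * det ((\<chi> i. A $ i) :: real^'n^'n)"
    by (simp only: det_rows_mul)
  then show ?thesis by simp
qed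

lemma det_Sigma_cov:
  "det (c *\<^sub>R Sigma_cov :: real^'n^'n) = (c / 2) ^ CARD('n::finite) * (real CARD('n) + 1)"
proof -
  have "mat 1 + (\<chi> i j. 1) = ((\<chi> i j. (if i = j then 1 else 0) + (if i \<in> UNIV then 1 else 0)) :: real^'n^'n)"
    by (simp add: vec_eq_iff mat_def)
  then have "det (mat 1 + (\<chi> i j. 1) :: real^'n^'n) = 1 + CARD('n)"
    by (simp only: det_mat_1_add_ones_on)
  then show ?thesis
    unfolding Sigma_cov_def scaleR_scaleR det_scaleR_matrix by simp
qed

text \<open>\<open>matrix_inv\<close> is a Hilbert choice. The existence of one two-sided inverse
  makes the chosen matrix such an inverse, and inverses are unique.\<close>

lemma matrix_inv_eqI:
  fixes A :: "real^'n^'n"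
  assumes "A ** B = mat 1" "B ** A = mat 1"
  shows "matrix_inv A = B"
proof -
  have "A ** matrix_inv A = mat 1 \<and> matrix_inv A ** A = mat 1"
    unfolding matrix_inv_def by (rule someI_ex) (use assms in blast)
  then show ?thesis
    by (metis assms(2) matrix_mul_assoc matrix_mul_lid matrix_mul_rid)
qed

text \<open>Sherman-Morrison formula for a rank-one update of the identity: the inverse of I + 11^T
  is I - 11^T/(N+1).\<close>

lemma matrix_inv_Sigma_cov:
  assumes "c \<noteq> 0"
  shows "matrix_inv (c *\<^sub>R Sigma_cov :: real^'n::finite^'n)
    = (\<chi> i j. 2 / c * ((if i = j then 1 else 0) - 1 / (real CARD('n) + 1)))" (is "matrix_inv ?A = ?B")
proof (rule matrix_inv_eqI)
  have delta: "(\<Sum>k\<in>UNIV. (if i = k then 1 else 0) * f k) = f i"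
              "(\<Sum>k\<in>UNIV. f k * (if k = i then 1 else 0)) = f i" for f :: "'n \<Rightarrow> real" and i
    by (simp_all add: if_distrib[of "\<lambda>x. x * _"] if_distrib[of "\<lambda>x. _ * x"] cong: if_cong)
  define a where "a = 1 / (real CARD('n) + 1)"
  \<comment> \<open>The single relation that cancels the rank-one terms in both products
    below.\<close>
  have a: "real CARD('n) * a = 1 - a" unfolding a_def by (simp add: field_simps)
  have main: "(\<Sum>k\<in>(UNIV::'n set). ((if i = k then 1 else 0) + 1) * ((if k = j then 1 else 0) - a))
     = (if i = j then 1 else (0::real))" for i j
    by (simp add: distrib_right delta sum.distrib sum_subtractf right_diff_distrib left_diff_distrib a)
  have main': "(\<Sum>k\<in>(UNIV::'n set). ((if i = k then 1 else 0) - a) * ((if k = j then 1 else 0) + 1))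
     = (if i = j then 1 else (0::real))" for i j
    by (simp add: distrib_left delta sum.distrib sum_subtractf right_diff_distrib left_diff_distrib a)
  have S: "(c *\<^sub>R Sigma_cov :: real^'n^'n) $ i $ j = c / 2 * ((if i = j then 1 else 0) + 1)" for i j
    by (simp add: Sigma_cov_def mat_def)
  have 1: "(\<Sum>k\<in>(UNIV::'n set). c / 2 * ((if i = k then 1 else 0) + 1) * (2 / c * ((if k = j then 1 else 0) - a)))
     = (if i = j then 1 else (0::real))" for i j
    by (rule trans[OF sum.cong[OF refl] main]) (use assms in simp)
  have 2: "(\<Sum>k\<in>(UNIV::'n set). 2 / c * ((if i = k then 1 else 0) - a) * (c / 2 * ((if k = j then 1 else 0) + 1)))
     = (if i = j then 1 else (0::real))" for i j
    by (rule trans[OF sum.cong[OF refl] main']) (use assms in simp)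
  show "?A ** ?B = mat 1"
    by (simp only: vec_eq_iff matrix_matrix_mult_def vec_lambda_beta S mat_def a_def[symmetric] 1) simp
  show "?B ** ?A = mat 1"
    by (simp only: vec_eq_iff matrix_matrix_mult_def vec_lambda_beta S mat_def a_def[symmetric] 2) simp
qed

text \<open>The quadratic form of the inverse of Sigma, written without
  \<open>matrix_inv\<close>.\<close>

definition Sigma_form :: "real^'n \<Rightarrow> real" where
  "Sigma_form v = 2 * (v \<bullet> v - (\<Sum>n\<in>UNIV. v $ n)\<^sup>2 / (real CARD('n) + 1))"

text \<open>The factor 2 pi of the general density and the 1/2 in Sigma combine to
  \<open>pi * c\<close> per dimension; the determinant of I + 11^T contributes N + 1.\<close>

lemma mv_normal_Sigma_cov:
  assumes "0 < c"
  shows "mv_normal \<mu> (c *\<^sub>R Sigma_cov :: real^'n::finite^'n) =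
    density lborel (\<lambda>v. ennreal (exp (- Sigma_form (v - \<mu>) / (2 * c))
      / sqrt ((pi * c) ^ CARD('n) * (real CARD('n) + 1))))"
proof -
  have "v \<bullet> (matrix_inv (c *\<^sub>R Sigma_cov :: real^'n^'n) *v v) = Sigma_form v / c" for v :: "real^'n"
  proof -
    define b where "b = real CARD('n) + 1"
    have b: "b \<noteq> 0" unfolding b_def by simp
    have "v \<bullet> (matrix_inv (c *\<^sub>R Sigma_cov :: real^'n^'n) *v v) =
      (\<Sum>i\<in>UNIV. \<Sum>j\<in>UNIV. (2 / c) * (v $ i * (if i = j then v $ j else 0)) - 2 / (c * b) * (v $ i * v $ j))"
      using assms b
      by (simp add: matrix_inv_Sigma_cov matrix_vector_mult_def inner_vec_def sum_distrib_left b_def[symmetric])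
        (intro sum.cong refl, simp add: field_simps)
    also have "\<dots> = (2 / c) * (v \<bullet> v) - 2 / (c * b) * (\<Sum>n\<in>UNIV. v $ n)\<^sup>2"
      by (simp add: sum_subtractf sum_distrib_left sum_divide_distrib inner_vec_def power2_eq_square
          sum_distrib_right mult_ac if_distrib[of "\<lambda>x. _ * x"] if_distrib[of "\<lambda>x. x / _"] cong: if_cong)
    finally show ?thesis unfolding Sigma_form_def b_def[symmetric] using b assms by (simp add: field_simps)
  qed
  moreover have "(2 * pi) ^ CARD('n) * det (c *\<^sub>R Sigma_cov :: real^'n^'n) = (pi * c) ^ CARD('n) * (real CARD('n) + 1)"
    by (simp add: det_Sigma_cov power_mult_distrib power_divide)
  ultimately show ?thesis
    unfolding mv_normal_def by (simp add: mult.commute)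
qed

section \<open>Density, marginals and total mass of the Gaussian law\<close>

lemma measurable_vec_nth_comp [measurable (raw)]:
  "f \<in> borel_measurable M \<Longrightarrow> (\<lambda>x. (f x :: real^'n) $ n) \<in> borel_measurable M"
  by (rule measurable_compose[OF _ borel_measurable_continuous_onI]) (auto intro: continuous_intros)

definition gauss_dens :: "real \<Rightarrow> real^'n \<Rightarrow> real" where
  "gauss_dens c v = exp (- Sigma_form v / (2 * c)) / sqrt ((pi * c) ^ CARD('n) * (real CARD('n) + 1))"

lemma Sigma_form_measurable [measurable]: "Sigma_form \<in> borel_measurable borel"
  unfolding Sigma_form_def by measurable

lemma gauss_dens_measurable [measurable]: "gauss_dens c \<in> borel_measurable borel"
  unfolding gauss_dens_def[abs_def] by measurable

lemma gauss_dens_nonneg: "0 \<le> c \<Longrightarrow> 0 \<le> gauss_dens c v"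
  unfolding gauss_dens_def by (intro divide_nonneg_nonneg real_sqrt_ge_zero mult_nonneg_nonneg) auto

lemma Sigma_form_scaleR: "Sigma_form (a *\<^sub>R v) = a\<^sup>2 * Sigma_form v"
proof -
  have "(\<Sum>n\<in>UNIV. (a *\<^sub>R v) $ n) = a * (\<Sum>n\<in>UNIV. v $ n)" by (simp add: sum_distrib_left)
  moreover have "(a *\<^sub>R v) \<bullet> (a *\<^sub>R v) = a\<^sup>2 * (v \<bullet> v)" by (simp add: power2_eq_square)
  ultimately show ?thesis unfolding Sigma_form_def by (simp only: power_mult_distrib) (simp add: algebra_simps)
qed

text \<open>Polarisation: the bracket is the bilinear form belonging to \<open>Sigma_form\<close>.
  It serves to complete the square in the convolution identity
  \<open>gauss_dens_mult\<close>.\<close>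

lemma Sigma_form_diff_scaleR:
  "Sigma_form (v - a *\<^sub>R w) = Sigma_form v
    - 2 * a * (2 * (v \<bullet> w - (\<Sum>n\<in>UNIV. v $ n) * (\<Sum>n\<in>UNIV. w $ n) / (real CARD('n) + 1)))
    + a\<^sup>2 * Sigma_form w" for v w :: "real^'n::finite"
proof -
  define b where "b = real CARD('n) + 1"
  have "b \<noteq> 0" by (simp add: b_def)
  moreover have "(\<Sum>n\<in>UNIV. (v - a *\<^sub>R w) $ n) = (\<Sum>n\<in>UNIV. v $ n) - a * (\<Sum>n\<in>UNIV. w $ n)"
    by (simp add: sum_subtractf sum_distrib_left)
  moreover have "(v - a *\<^sub>R w) \<bullet> (v - a *\<^sub>R w) = v \<bullet> v - 2 * a * (v \<bullet> w) + a\<^sup>2 * (w \<bullet> w)"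
    by (simp add: inner_diff_left inner_diff_right inner_commute[of w v] power2_eq_square algebra_simps)
  ultimately show ?thesis
    unfolding Sigma_form_def b_def[symmetric]
    by (simp only:) (simp add: diff_divide_distrib add_divide_distrib power2_eq_square algebra_simps)
qed

text \<open>Coordinates are inner products with the basis vectors \<open>axis i 1\<close>, so the
  product formula over \<open>Basis\<close> can be reindexed by \<open>'n\<close>.\<close>

lemma nn_integral_lborel_vec_prod:
  fixes f :: "'n::finite \<Rightarrow> real \<Rightarrow> ennreal"
  assumes [measurable]: "\<And>i. f i \<in> borel_measurable borel"
  shows "(\<integral>\<^sup>+v. (\<Prod>i\<in>UNIV. f i (v $ i)) \<partial>(lborel :: (real^'n) measure)) = (\<Prod>i\<in>UNIV. \<integral>\<^sup>+x. f i x \<partial>lborel)"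
proof -
  define h where "h b = f (the_inv (\<lambda>i. axis i (1::real)) b)" for b
  have inj: "inj (\<lambda>i::'n. axis i (1::real))" by (simp add: inj_on_def axis_eq_axis)
  have B: "(Basis :: (real^'n) set) = range (\<lambda>i. axis i 1)" by (auto simp: Basis_vec_def)
  have h: "h (axis i 1) = f i" for i using inj unfolding h_def by (subst the_inv_f_f[OF inj]) simp
  have "(\<integral>\<^sup>+v. (\<Prod>b\<in>Basis. h b (v \<bullet> b)) \<partial>(lborel :: (real^'n) measure)) = (\<Prod>b\<in>Basis. \<integral>\<^sup>+x. h b x \<partial>lborel)"
    by (rule nn_integral_lborel_prod) (auto simp: h_def)
  then show ?thesis
    unfolding B by (subst (asm) (1 2) prod.reindex[OF inj]) (simp_all add: h inner_axis)
qed

text \<open>Since Sigma = (I + 11^T)/2, a centred vector V with covariance c Sigma can be written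
  V_n = Z + W_n with Z and all W_n independent N(0, c/2). The left side is the joint density of Z
  and V; the right side factors it into the density of V and the conditional density of Z given
  V.\<close>

lemma normal_density_prod_gauss_dens:
  fixes v :: "real^'n::finite"
  assumes c: "0 < c"
  shows "normal_density 0 (sqrt (c / 2)) z * (\<Prod>n\<in>UNIV. normal_density 0 (sqrt (c / 2)) (v $ n - z)) =
    gauss_dens c v * normal_density ((\<Sum>n\<in>UNIV. v $ n) / (real CARD('n) + 1)) (sqrt (c / (2 * (real CARD('n) + 1)))) z"
proof -
  define b s where "b = real CARD('n) + 1" and "s = (\<Sum>n\<in>UNIV. v $ n)"
  have b: "b > 0" by (simp add: b_def)
  have nd: "normal_density 0 (sqrt (c / 2)) x = exp (- x\<^sup>2 / c) / sqrt (pi * c)" for x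
    using c by (simp add: normal_density_def)
  have nd': "normal_density m (sqrt (c / (2 * b))) z = exp (- b * (z - m)\<^sup>2 / c) / sqrt (pi * c / b)" for m
    using c b by (simp add: normal_density_def field_simps)
  have sq: "(\<Sum>n\<in>UNIV. (v $ n - z)\<^sup>2) = v \<bullet> v - 2 * z * s + (b - 1) * z\<^sup>2"
    by (simp add: power2_diff sum.distrib sum_subtractf s_def inner_vec_def sum_distrib_left b_def
      power2_eq_square algebra_simps)
  \<comment> \<open>Completing the square in \<open>z\<close>; what remains is half of
    \<open>Sigma_form\<close>.\<close>
  have "z\<^sup>2 + (\<Sum>n\<in>UNIV. (v $ n - z)\<^sup>2) = Sigma_form v / 2 + b * (z - s / b)\<^sup>2"
    using b unfolding sq Sigma_form_def b_def[symmetric] s_def[symmetric]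
    by (simp add: field_simps power2_eq_square)
  then have "exp (- z\<^sup>2 / c) * (\<Prod>n\<in>UNIV. exp (- (v $ n - z)\<^sup>2 / c)) =
      exp (- Sigma_form v / (2 * c)) * exp (- b * (z - s / b)\<^sup>2 / c)"
    unfolding exp_sum[OF finite, symmetric] exp_add[symmetric] sum_divide_distrib[symmetric] sum_negf
    by (auto dest: arg_cong[of _ _ "\<lambda>x. - x / c"] simp: add_divide_distrib diff_divide_distrib)
  moreover have "sqrt (pi * c) * sqrt (pi * c) ^ CARD('n) = sqrt ((pi * c) ^ CARD('n) * b) * sqrt (pi * c / b)"
    using b c by (simp add: real_sqrt_mult real_sqrt_power real_sqrt_divide)
  ultimately show ?thesis
    unfolding nd gauss_dens_def b_def[symmetric] s_def[symmetric] nd'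
    by (simp add: prod_dividef)
qed

lemma gauss_dens_eq_nn_integral:
  fixes v :: "real^'n::finite"
  assumes c: "0 < c"
  shows "ennreal (gauss_dens c v) =
    (\<integral>\<^sup>+z. ennreal (normal_density 0 (sqrt (c / 2)) z * (\<Prod>n\<in>UNIV. normal_density 0 (sqrt (c / 2)) (v $ n - z))) \<partial>lborel)"
proof -
  have "(\<integral>\<^sup>+z. ennreal (normal_density m (sqrt (c / (2 * (real CARD('n) + 1)))) z) \<partial>lborel) = 1" for m
    using c by (subst nn_integral_eq_integral) auto
  then show ?thesis
    using c by (simp add: normal_density_prod_gauss_dens ennreal_mult' gauss_dens_nonneg nn_integral_cmult)
qed

text \<open>Given the shared variable Z, all coordinates except \<open>n\<close> integrate to one.
  The convolution of the two remaining N(0, c/2) densities is N(0, c). Constant \<open>F\<close>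
  yields the total mass.\<close>

lemma nn_integral_gauss_dens_component:
  fixes F :: "real \<Rightarrow> ennreal" and n :: "'n::finite"
  assumes c: "0 < c" and [measurable]: "F \<in> borel_measurable borel"
  shows "(\<integral>\<^sup>+v. ennreal (gauss_dens c v) * F (v $ n) \<partial>lborel) =
    (\<integral>\<^sup>+x. ennreal (normal_density 0 (sqrt c) x) * F x \<partial>lborel)"
proof -
  define g where "g = normal_density 0 (sqrt (c / 2))"
  have [measurable]: "g \<in> borel_measurable borel" and g0: "\<And>x. 0 \<le> g x" by (auto simp: g_def)
  have g1: "(\<integral>\<^sup>+x. ennreal (g (x - z)) \<partial>lborel) = 1" for z
  proof -
    have "g (x - z) = normal_density z (sqrt (c / 2)) x" for x
      by (simp add: g_def normal_density_def)
    then show ?thesis using c by (subst nn_integral_eq_integral) auto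
  qed
  have "(\<integral>\<^sup>+v. ennreal (gauss_dens c v) * F (v $ n) \<partial>lborel) =
    (\<integral>\<^sup>+v. \<integral>\<^sup>+z. ennreal (g z) * ((\<Prod>m\<in>UNIV. ennreal (g (v $ m - z))) * F (v $ n)) \<partial>lborel \<partial>lborel)"
    by (simp add: gauss_dens_eq_nn_integral[OF c] g_def[symmetric] nn_integral_multc[symmetric] ennreal_mult' g0
      prod_nonneg prod_ennreal mult.assoc)
  also have "\<dots> = (\<integral>\<^sup>+z. \<integral>\<^sup>+v. ennreal (g z) * ((\<Prod>m\<in>UNIV. ennreal (g (v $ m - z))) * F (v $ n)) \<partial>lborel \<partial>lborel)"
    by (rule lborel_pair.Fubini') measurable
  also have "\<dots> = (\<integral>\<^sup>+z. ennreal (g z) * (\<integral>\<^sup>+x. ennreal (g (x - z)) * F x \<partial>lborel) \<partial>lborel)"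
  proof (rule nn_integral_cong)
    fix z
    have "(\<integral>\<^sup>+v. (\<Prod>m\<in>UNIV. ennreal (g (v $ m - z))) * F (v $ n) \<partial>lborel) =
      (\<integral>\<^sup>+v. (\<Prod>m\<in>UNIV. ennreal (g (v $ m - z)) * (if m = n then F (v $ m) else 1)) \<partial>lborel)"
      by (simp add: prod.distrib prod.delta)
    also have "\<dots> = (\<Prod>m\<in>UNIV. \<integral>\<^sup>+x. ennreal (g (x - z)) * (if m = n then F x else 1) \<partial>lborel)"
      by (rule nn_integral_lborel_vec_prod[of "\<lambda>m x. ennreal (g (x - z)) * (if m = n then F x else 1)"]) measurable
    also have "\<dots> = (\<Prod>m\<in>UNIV. if m = n then \<integral>\<^sup>+x. ennreal (g (x - z)) * F x \<partial>lborel else 1)"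
      by (rule prod.cong) (auto simp: g1)
    also have "\<dots> = (\<integral>\<^sup>+x. ennreal (g (x - z)) * F x \<partial>lborel)" by (simp add: prod.delta)
    finally show "(\<integral>\<^sup>+v. ennreal (g z) * ((\<Prod>m\<in>UNIV. ennreal (g (v $ m - z))) * F (v $ n)) \<partial>lborel) =
        ennreal (g z) * (\<integral>\<^sup>+x. ennreal (g (x - z)) * F x \<partial>lborel)"
      by (subst nn_integral_cmult) auto
  qed
  also have "\<dots> = (\<integral>\<^sup>+z. \<integral>\<^sup>+x. ennreal (g (x - z) * g z) * F x \<partial>lborel \<partial>lborel)"
    by (simp add: nn_integral_cmult[symmetric] ennreal_mult' g0 mult_ac)
  also have "\<dots> = (\<integral>\<^sup>+x. \<integral>\<^sup>+z. ennreal (g (x - z) * g z) * F x \<partial>lborel \<partial>lborel)"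
    by (rule lborel_pair.Fubini') measurable
  also have "\<dots> = (\<integral>\<^sup>+x. ennreal (normal_density 0 (sqrt c) x) * F x \<partial>lborel)"
    using fun_cong[OF conv_normal_density_zero_mean[of "sqrt (c/2)" "sqrt (c/2)"]] c
    by (simp add: nn_integral_multc g_def)
  finally show ?thesis .
qed

lemma nn_integral_gauss_dens:
  assumes "0 < c"
  shows "(\<integral>\<^sup>+v. ennreal (gauss_dens c (v - m)) \<partial>(lborel :: (real^'n::finite) measure)) = 1"
proof -
  have "(\<integral>\<^sup>+v. ennreal (gauss_dens c (v - m)) \<partial>(lborel :: (real^'n) measure)) =
    (\<integral>\<^sup>+v. ennreal (gauss_dens c v) \<partial>(lborel :: (real^'n) measure))"
    by (subst lborel_affine[of 1 m]) (simp_all add: nn_integral_density nn_integral_distr)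
  also have "\<dots> = 1"
    using nn_integral_gauss_dens_component[OF assms, of "\<lambda>_. 1"] assms by (simp add: nn_integral_eq_integral)
  finally show ?thesis .
qed

text \<open>For \<open>c = 0\<close> the density formula in \<open>mv_normal\<close> degenerates to the null measure, so the
  point mass is inserted by hand.\<close>

definition gauss :: "real \<Rightarrow> (real^'n) measure" where
  "gauss c = (if c = 0 then return borel 0 else mv_normal 0 (c *\<^sub>R Sigma_cov))"

lemma mv_normal_Sigma_cov_gauss_dens:
  "0 < c \<Longrightarrow> mv_normal \<mu> (c *\<^sub>R Sigma_cov :: real^'n::finite^'n) = density lborel (\<lambda>v. ennreal (gauss_dens c (v - \<mu>)))"
  by (simp add: mv_normal_Sigma_cov gauss_dens_def)

section \<open>Scaling and addition of independent Gaussian vectors\<close>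

lemma sets_mv_normal [simp, measurable_cong]: "sets (mv_normal \<mu> S) = sets borel"
  and space_mv_normal [simp]: "space (mv_normal \<mu> S) = UNIV"
  by (simp_all add: mv_normal_def)

lemma sets_gauss [simp, measurable_cong]: "sets (gauss c) = sets borel"
  and space_gauss [simp]: "space (gauss c) = UNIV"
  by (simp_all add: gauss_def)

lemma prob_space_mv_normal:
  assumes "0 < c"
  shows "prob_space (mv_normal \<mu> (c *\<^sub>R Sigma_cov :: real^'n::finite^'n))"
  using assms by (intro prob_spaceI) (simp add: mv_normal_Sigma_cov_gauss_dens emeasure_density nn_integral_gauss_dens)

lemma prob_space_gauss: "0 \<le> c \<Longrightarrow> prob_space (gauss c :: (real^'n::finite) measure)"
  by (auto simp: gauss_def prob_space_mv_normal intro!: prob_space_return)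

text \<open>Substitution with Jacobian \<open>\<bar>a\<bar> ^ CARD('n)\<close>, which the
  normalising constant absorbs. For \<open>a = 0\<close> the image is a point mass, which
  \<open>mv_normal\<close> cannot express.\<close>

lemma nn_integral_gauss_scale:
  fixes F :: "real^'n::finite \<Rightarrow> ennreal"
  assumes "0 < c" and [measurable]: "F \<in> borel_measurable borel"
  shows "(\<integral>\<^sup>+v. F (\<mu> + a *\<^sub>R v) \<partial>gauss c) =
    (if a = 0 then F \<mu> else \<integral>\<^sup>+v. F v \<partial>mv_normal \<mu> ((a\<^sup>2 * c) *\<^sub>R Sigma_cov))"
proof (cases "a = 0")
  case True
  interpret prob_space "gauss c :: (real^'n) measure" using assms by (simp add: prob_space_gauss)
  show ?thesis using True emeasure_space_1 by simp
next
  case False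
  have eq: "\<bar>a\<bar> ^ CARD('n) * gauss_dens (a\<^sup>2 * c) (a *\<^sub>R v) = gauss_dens c v" for v :: "real^'n"
  proof -
    have "sqrt ((pi * (a\<^sup>2 * c)) ^ CARD('n)) = \<bar>a\<bar> ^ CARD('n) * sqrt ((pi * c) ^ CARD('n))"
    proof -
      have "sqrt ((a\<^sup>2) ^ CARD('n)) = \<bar>a\<bar> ^ CARD('n)"
        by (metis power_mult mult.commute real_sqrt_abs power_abs)
      then show ?thesis by (simp add: power_mult_distrib real_sqrt_mult)
    qed
    moreover have "Sigma_form (a *\<^sub>R v) / (2 * (a\<^sup>2 * c)) = Sigma_form v / (2 * c)"
      using False by (simp add: Sigma_form_scaleR)
    ultimately show ?thesis using False by (simp add: gauss_dens_def real_sqrt_mult)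
  qed
  have "(\<integral>\<^sup>+v. F v \<partial>mv_normal \<mu> ((a\<^sup>2 * c) *\<^sub>R Sigma_cov)) =
      (\<integral>\<^sup>+v. ennreal (gauss_dens (a\<^sup>2 * c) (v - \<mu>)) * F v \<partial>lborel)"
    using False assms by (simp add: mv_normal_Sigma_cov_gauss_dens nn_integral_density)
  also have "\<dots> = (\<integral>\<^sup>+v. ennreal (\<bar>a\<bar> ^ CARD('n)) * (ennreal (gauss_dens (a\<^sup>2 * c) (a *\<^sub>R v)) * F (\<mu> + a *\<^sub>R v)) \<partial>lborel)"
    by (subst lborel_affine[OF False, of \<mu>]) (simp_all add: nn_integral_density nn_integral_distr ennreal_power[symmetric])
  also have "\<dots> = (\<integral>\<^sup>+v. ennreal (gauss_dens c v) * F (\<mu> + a *\<^sub>R v) \<partial>lborel)"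
    by (simp add: mult.assoc[symmetric] ennreal_mult'[symmetric] eq)
  also have "\<dots> = (\<integral>\<^sup>+v. F (\<mu> + a *\<^sub>R v) \<partial>gauss c)"
    using assms by (simp add: gauss_def mv_normal_Sigma_cov_gauss_dens nn_integral_density)
  finally show ?thesis using False by simp
qed

text \<open>The algebra behind convolution. With \<open>w\<close> the sum of two independent
  vectors, the joint density factors into the density of \<open>w\<close> and the conditional
  density of the summand \<open>y\<close> given \<open>w\<close>, whose mean is
  \<open>(b / (a + b)) *\<^sub>R w\<close> and whose variance factor is
  \<open>a * b / (a + b)\<close>.\<close>

lemma gauss_dens_mult:
  fixes w y :: "real^'n::finite"
  assumes "0 < a" "0 < b"
  shows "gauss_dens a (w - y) * gauss_dens b y =
    gauss_dens (a + b) w * gauss_dens (a * b / (a + b)) (y - (b / (a + b)) *\<^sub>R w)"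
proof -
  define B where "B = 2 * (w \<bullet> y - (\<Sum>n\<in>UNIV. w $ n) * (\<Sum>n\<in>UNIV. y $ n) / (real CARD('n) + 1))"
  have 1: "Sigma_form (w - y) = Sigma_form w - 2 * B + Sigma_form y"
    using Sigma_form_diff_scaleR[of w 1 y] by (simp add: B_def)
  have 2: "Sigma_form (y - r *\<^sub>R w) = Sigma_form y - 2 * r * B + r\<^sup>2 * Sigma_form w" for r
    using Sigma_form_diff_scaleR[of y r w] by (simp add: B_def inner_commute mult.commute)
  have "Sigma_form (w - y) / (2 * a) + Sigma_form y / (2 * b) =
    Sigma_form w / (2 * (a + b)) + Sigma_form (y - (b / (a + b)) *\<^sub>R w) / (2 * (a * b / (a + b)))"
  proof -
    define s where "s = a + b"
    have s: "s \<noteq> 0" "b = s - a" using assms by (auto simp: s_def)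
    have nz: "a \<noteq> 0" "b \<noteq> 0" using assms by auto
    show ?thesis unfolding 1 2 s_def[symmetric]
      using s(1) nz unfolding s(2) by (simp add: divide_simps power2_eq_square) (simp add: algebra_simps)
  qed
  then have "exp (- Sigma_form (w - y) / (2 * a)) * exp (- Sigma_form y / (2 * b)) =
    exp (- Sigma_form w / (2 * (a + b))) * exp (- Sigma_form (y - (b / (a + b)) *\<^sub>R w) / (2 * (a * b / (a + b))))"
    unfolding exp_add[symmetric] by (intro arg_cong[of _ _ exp]) linarith
  moreover have "sqrt ((pi * a) ^ CARD('n)) * sqrt ((pi * b) ^ CARD('n)) =
      sqrt ((pi * (a + b)) ^ CARD('n)) * sqrt ((pi * (a * b / (a + b))) ^ CARD('n))"
  proof -
    have "pi * a * (pi * b) = pi * (a + b) * (pi * (a * b / (a + b)))" using assms by simp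
    then show ?thesis by (simp only: real_sqrt_mult[symmetric] power_mult_distrib[symmetric])
  qed
  \<comment> \<open>\<open>K\<close> stands for the square root of N + 1, which occurs twice on each
    side; only the identities for exponentials and powers are left.\<close>
  moreover have "E1 / (P1 * K) * (E2 / (P2 * K)) = E3 / (P3 * K) * (E4 / (P4 * K))"
    if "E1 * E2 = E3 * E4" "P1 * P2 = P3 * P4" for E1 E2 E3 E4 P1 P2 P3 P4 K :: real
  proof -
    have "P1 * K * (P2 * K) = P3 * K * (P4 * K)" using that(2) by algebra
    then show ?thesis using that(1) by (simp only: times_divide_times_eq)
  qed
  ultimately show ?thesis
    unfolding gauss_dens_def real_sqrt_mult[of "_ ^ CARD('n)"] by blast
qed

text \<open>Point masses have no density and are treated apart. Otherwise the substitution
  \<open>w = x + y\<close> and \<open>gauss_dens_mult\<close> make the inner integral over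
  \<open>y\<close> the total mass of a Gaussian.\<close>

lemma nn_integral_gauss_add:
  fixes F :: "real^'n::finite \<Rightarrow> ennreal"
  assumes "0 \<le> a" "0 \<le> b" and [measurable]: "F \<in> borel_measurable borel"
  shows "(\<integral>\<^sup>+x. \<integral>\<^sup>+y. F (x + y) \<partial>gauss b \<partial>gauss a) = (\<integral>\<^sup>+x. F x \<partial>gauss (a + b))"
proof (cases "a = 0 \<or> b = 0")
  case True
  interpret Ga: prob_space "gauss a :: (real^'n) measure" using assms by (simp add: prob_space_gauss)
  interpret Gb: prob_space "gauss b :: (real^'n) measure" using assms by (simp add: prob_space_gauss)
  from True show ?thesis
  proof
    assume "a = 0"
    then show ?thesis
      unfolding gauss_def[of a] by (simp add: nn_integral_return Gb.borel_measurable_nn_integral)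
  next
    assume "b = 0"
    then show ?thesis
      unfolding gauss_def[of b] by (simp add: nn_integral_return)
  qed
next
  case False
  then have ab: "0 < a" "0 < b" using assms by auto
  have "(\<integral>\<^sup>+x. \<integral>\<^sup>+y. F (x + y) \<partial>gauss b \<partial>gauss a) =
    (\<integral>\<^sup>+x. \<integral>\<^sup>+y. ennreal (gauss_dens a x) * ennreal (gauss_dens b y) * F (x + y) \<partial>lborel \<partial>lborel)"
    using ab by (simp add: gauss_def mv_normal_Sigma_cov_gauss_dens nn_integral_density mult.assoc nn_integral_cmult)
  also have "\<dots> = (\<integral>\<^sup>+y. \<integral>\<^sup>+x. ennreal (gauss_dens a x) * ennreal (gauss_dens b y) * F (x + y) \<partial>lborel \<partial>lborel)"
    by (rule lborel_pair.Fubini') measurable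
  also have "\<dots> = (\<integral>\<^sup>+y. \<integral>\<^sup>+w. ennreal (gauss_dens a (w - y)) * ennreal (gauss_dens b y) * F w \<partial>lborel \<partial>lborel)"
  proof (rule nn_integral_cong)
    fix y :: "real^'n"
    show "(\<integral>\<^sup>+x. ennreal (gauss_dens a x) * ennreal (gauss_dens b y) * F (x + y) \<partial>lborel) =
      (\<integral>\<^sup>+w. ennreal (gauss_dens a (w - y)) * ennreal (gauss_dens b y) * F w \<partial>lborel)"
      by (subst (2) lborel_affine[of 1 y]) (simp_all add: nn_integral_density nn_integral_distr add.commute)
  qed
  also have "\<dots> = (\<integral>\<^sup>+w. \<integral>\<^sup>+y. ennreal (gauss_dens a (w - y)) * ennreal (gauss_dens b y) * F w \<partial>lborel \<partial>lborel)"
    by (rule lborel_pair.Fubini') measurable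
  also have "\<dots> = (\<integral>\<^sup>+w. \<integral>\<^sup>+y. ennreal (gauss_dens (a + b) w) * F w *
      ennreal (gauss_dens (a * b / (a + b)) (y - (b / (a + b)) *\<^sub>R w)) \<partial>lborel \<partial>lborel)"
  proof (intro nn_integral_cong)
    fix w y :: "real^'n"
    have "ennreal (gauss_dens a (w - y)) * ennreal (gauss_dens b y) =
        ennreal (gauss_dens (a + b) w) * ennreal (gauss_dens (a * b / (a + b)) (y - (b / (a + b)) *\<^sub>R w))"
      using ab by (simp add: ennreal_mult[symmetric] gauss_dens_nonneg gauss_dens_mult)
    then show "ennreal (gauss_dens a (w - y)) * ennreal (gauss_dens b y) * F w = ennreal (gauss_dens (a + b) w) * F w *
        ennreal (gauss_dens (a * b / (a + b)) (y - (b / (a + b)) *\<^sub>R w))"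
      by (simp add: mult_ac)
  qed
  also have "\<dots> = (\<integral>\<^sup>+w. ennreal (gauss_dens (a + b) w) * F w \<partial>lborel)"
    using ab by (simp add: nn_integral_cmult nn_integral_gauss_dens)
  also have "\<dots> = (\<integral>\<^sup>+x. F x \<partial>gauss (a + b))"
    using ab by (simp add: gauss_def mv_normal_Sigma_cov_gauss_dens nn_integral_density)
  finally show ?thesis .
qed

text \<open>Induction over \<open>I\<close>, absorbing one term at a time. The point mass
  \<open>gauss 0\<close> is the law of the empty sum and of a term with \<open>a i = 0\<close>; zero
  coefficients are later used to select one block of the noise.\<close>

lemma nn_integral_sum_gauss:
  fixes F :: "real^'n::finite \<Rightarrow> ennreal" and a :: "'i \<Rightarrow> real"
  assumes "finite I" and "F \<in> borel_measurable borel"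
  shows "(\<integral>\<^sup>+U. F (\<Sum>i\<in>I. a i *\<^sub>R U i) \<partial>(\<Pi>\<^sub>M i\<in>I. gauss 1)) = (\<integral>\<^sup>+v. F v \<partial>gauss (\<Sum>i\<in>I. (a i)\<^sup>2))"
  using assms
proof (induction I arbitrary: F rule: finite_induct)
  case empty
  then show ?case by (simp add: gauss_def nn_integral_return PiM_empty nn_integral_count_space_finite)
next
  case (insert i I)
  note [measurable] = insert.prems
  interpret G: prob_space "gauss 1 :: (real^'n) measure" by (simp add: prob_space_gauss)
  interpret product_sigma_finite "\<lambda>_. gauss 1 :: (real^'n) measure" ..
  interpret Gi: prob_space "gauss ((a i)\<^sup>2) :: (real^'n) measure" by (simp add: prob_space_gauss)
  have "(\<integral>\<^sup>+U. F (\<Sum>j\<in>insert i I. a j *\<^sub>R U j) \<partial>(\<Pi>\<^sub>M i\<in>insert i I. gauss 1)) =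
    (\<integral>\<^sup>+U. \<integral>\<^sup>+u. F (\<Sum>j\<in>insert i I. a j *\<^sub>R (U(i := u)) j) \<partial>gauss 1 \<partial>(\<Pi>\<^sub>M i\<in>I. gauss 1))"
    by (rule product_nn_integral_insert) (use insert in auto)
  also have "\<dots> = (\<integral>\<^sup>+U. \<integral>\<^sup>+u. F ((\<Sum>j\<in>I. a j *\<^sub>R U j) + a i *\<^sub>R u) \<partial>gauss 1 \<partial>(\<Pi>\<^sub>M i\<in>I. gauss 1))"
  proof -
    have "(\<Sum>j\<in>insert i I. a j *\<^sub>R (U(i := u)) j) = (\<Sum>j\<in>I. a j *\<^sub>R U j) + a i *\<^sub>R u" for U :: "'i \<Rightarrow> real^'n" and u
    proof -
      have "(\<Sum>j\<in>I. a j *\<^sub>R (U(i := u)) j) = (\<Sum>j\<in>I. a j *\<^sub>R U j)"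
        using insert.hyps by (intro sum.cong) auto
      then show ?thesis using insert.hyps by (simp add: add.commute)
    qed
    then show ?thesis by simp
  qed
  also have "\<dots> = (\<integral>\<^sup>+U. \<integral>\<^sup>+u. F ((\<Sum>j\<in>I. a j *\<^sub>R U j) + u) \<partial>gauss ((a i)\<^sup>2) \<partial>(\<Pi>\<^sub>M i\<in>I. gauss 1))"
  proof (intro nn_integral_cong)
    fix U :: "'i \<Rightarrow> real^'n"
    define w where "w = (\<Sum>j\<in>I. a j *\<^sub>R U j)"
    show "(\<integral>\<^sup>+u. F ((\<Sum>j\<in>I. a j *\<^sub>R U j) + a i *\<^sub>R u) \<partial>gauss 1) =
      (\<integral>\<^sup>+u. F ((\<Sum>j\<in>I. a j *\<^sub>R U j) + u) \<partial>gauss ((a i)\<^sup>2))"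
      using nn_integral_gauss_scale[of 1 "\<lambda>v. F (w + v)" 0 "a i"]
      unfolding w_def[symmetric] by (simp add: gauss_def nn_integral_return split: if_splits)
  qed
  also have "\<dots> = (\<integral>\<^sup>+w. \<integral>\<^sup>+u. F (w + u) \<partial>gauss ((a i)\<^sup>2) \<partial>gauss (\<Sum>i\<in>I. (a i)\<^sup>2))"
    by (rule insert.IH) measurable
  also have "\<dots> = (\<integral>\<^sup>+v. F v \<partial>gauss (\<Sum>i\<in>insert i I. (a i)\<^sup>2))"
    using insert.hyps by (subst nn_integral_gauss_add) (simp_all add: sum_nonneg add.commute)
  finally show ?case .
qed

text \<open>The diagonal entries of Sigma are 1, so every single increment is standard normal and
  its moments are known.\<close>

lemma distr_gauss_component:
  "distr (gauss 1 :: (real^'n::finite) measure) borel (\<lambda>v. v $ n) = density lborel std_normal_density"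
proof (rule measure_eqI)
  fix A assume A: "A \<in> sets (distr (gauss 1 :: (real^'n) measure) borel (\<lambda>v. v $ n))"
  then have [measurable]: "A \<in> sets borel" by simp
  have "emeasure (distr (gauss 1 :: (real^'n) measure) borel (\<lambda>v. v $ n)) A =
    (\<integral>\<^sup>+v. indicator A (v $ n) \<partial>(gauss 1 :: (real^'n) measure))"
    by (simp add: nn_integral_indicator[symmetric] nn_integral_distr del: nn_integral_indicator)
  also have "\<dots> = emeasure (density lborel std_normal_density) A"
    using nn_integral_gauss_dens_component[of 1 "indicator A" n]
    by (simp add: gauss_def mv_normal_Sigma_cov_gauss_dens[of 1, simplified] nn_integral_density emeasure_density)
  finally show "emeasure (distr (gauss 1 :: (real^'n) measure) borel (\<lambda>v. v $ n)) A =
    emeasure (density lborel std_normal_density) A" .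
qed simp

section \<open>Taylor expansion along coordinates\<close>

text \<open>Points of a product space are \<open>undefined\<close> outside \<open>{1..T}\<close>,
  whereas proposals and columns are arbitrary there. This property transfers values between a path
  and its restriction.\<close>

definition on_coords :: "nat \<Rightarrow> ((nat \<Rightarrow> real) \<Rightarrow> 'a) \<Rightarrow> bool" where
  "on_coords T f \<longleftrightarrow> (\<forall>x y. (\<forall>t\<in>{1..T}. x t = y t) \<longrightarrow> f x = f y)"

lemma on_coordsD: "on_coords T f \<Longrightarrow> (\<And>t. t \<in> {1..T} \<Longrightarrow> x t = y t) \<Longrightarrow> f x = f y"
  unfolding on_coords_def by blast

lemma on_coords_partial:
  assumes "on_coords T f" "t \<in> {1..T}"
  shows "on_coords T (partial t f)"
  unfolding on_coords_def
proof (intro allI impI)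
  fix x y :: "nat \<Rightarrow> real" assume eq: "\<forall>t\<in>{1..T}. x t = y t"
  have "(\<lambda>u. f (x(t := u))) = (\<lambda>u. f (y(t := u)))"
    by (intro ext on_coordsD[OF assms(1)]) (use eq in auto)
  then show "partial t f x = partial t f y"
    unfolding partial_def using eq assms(2) by simp
qed

lemma partial_DERIV:
  assumes "has_partials T f" "t \<in> {1..T}"
  shows "((\<lambda>v. f (x(t := v))) has_real_derivative partial t f (x(t := u))) (at u)"
proof -
  have "(\<lambda>v. f ((x(t := u))(t := v))) differentiable at ((x(t := u)) t)"
    using assms unfolding has_partials_def by blast
  then show ?thesis
    by (simp add: partial_def DERIV_deriv_iff_real_differentiable)
qed

lemma has_partialsI:
  assumes "\<And>t x. t \<in> {1..T} \<Longrightarrow> ((\<lambda>v. f (x(t := v))) has_real_derivative f' t x) (at (x t))"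
  shows "has_partials T f" and "\<And>t. t \<in> {1..T} \<Longrightarrow> partial t f = f' t"
proof -
  show "has_partials T f"
    unfolding has_partials_def using assms real_differentiable_def by blast
  show "partial t f = f' t" if "t \<in> {1..T}" for t
    using assms[OF that] by (auto simp: partial_def fun_eq_iff intro: DERIV_imp_deriv)
qed

lemma partial_log_density:
  assumes C2: "twice_cont_diff T p" and pos: "\<And>x. 0 < p x" 
  shows "has_partials T (log_density p)"
    and "\<And>t. t \<in> {1..T} \<Longrightarrow> partial t (log_density p) = (\<lambda>x. partial t p x / p x)"
    and "\<And>t. t \<in> {1..T} \<Longrightarrow> has_partials T (partial t (log_density p))"
    and "\<And>s t. s \<in> {1..T} \<Longrightarrow> t \<in> {1..T} \<Longrightarrow> partial s (partial t (log_density p)) =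
      (\<lambda>x. (partial s (partial t p) x * p x - partial t p x * partial s p x) / (p x * p x))"
proof -
  have hp: "has_partials T p" and hpp: "\<And>t. t \<in> {1..T} \<Longrightarrow> has_partials T (partial t p)"
    using C2 by (auto simp: twice_cont_diff_def)
  have p': "((\<lambda>v. p (x(t := v))) has_real_derivative partial t p x) (at (x t))" if "t \<in> {1..T}" for t x
    using partial_DERIV[OF hp that, of x "x t"] by simp
  have "((\<lambda>v. log_density p (x(t := v))) has_real_derivative partial t p x / p x) (at (x t))" if "t \<in> {1..T}" for t x
    unfolding log_density_def using DERIV_chain2[OF DERIV_ln_divide p'[OF that, of x]] pos by simp
  from has_partialsI[OF this]
  show 1: "has_partials T (log_density p)"
    and 2: "\<And>t. t \<in> {1..T} \<Longrightarrow> partial t (log_density p) = (\<lambda>x. partial t p x / p x)" by auto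
  have "((\<lambda>v. partial t (log_density p) (x(s := v))) has_real_derivative 
      (partial s (partial t p) x * p x - partial t p x * partial s p x) / (p x * p x)) (at (x s))"
    if "s \<in> {1..T}" "t \<in> {1..T}" for s t x
    unfolding 2[OF that(2)]
    using DERIV_divide[OF _ p'[OF that(1), of x], of "\<lambda>v. partial t p (x(s := v))" "partial s (partial t p) x"]
      partial_DERIV[OF hpp[OF that(2)] that(1), of x "x s"] pos[of x] by simp
  from has_partialsI[OF this]
  show "\<And>t. t \<in> {1..T} \<Longrightarrow> has_partials T (partial t (log_density p))"
    "\<And>s t. s \<in> {1..T} \<Longrightarrow> t \<in> {1..T} \<Longrightarrow> partial s (partial t (log_density p)) =
      (\<lambda>x. (partial s (partial t p) x * p x - partial t p x * partial s p x) / (p x * p x))"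
    by blast+
qed

lemma continuous_partials_log_density:
  assumes C2: "twice_cont_diff T p" and pos: "\<And>x. 0 < p x"
  shows "continuous_on UNIV (log_density p)"
    and "\<And>t. t \<in> {1..T} \<Longrightarrow> continuous_on UNIV (partial t (log_density p))"
    and "\<And>s t. s \<in> {1..T} \<Longrightarrow> t \<in> {1..T} \<Longrightarrow> continuous_on UNIV (partial s (partial t (log_density p)))"
proof -
  have c: "continuous_on UNIV p" "\<And>t. t \<in> {1..T} \<Longrightarrow> continuous_on UNIV (partial t p)"
    "\<And>s t. s \<in> {1..T} \<Longrightarrow> t \<in> {1..T} \<Longrightarrow> continuous_on UNIV (partial s (partial t p))"
    using C2 by (auto simp: twice_cont_diff_def)
  have nz: "p x \<noteq> 0" for x using pos[of x] by simp
  show "continuous_on UNIV (log_density p)"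
    unfolding log_density_def[abs_def] using c nz by (intro continuous_intros) auto
  show "continuous_on UNIV (partial t (log_density p))" if "t \<in> {1..T}" for t
    using partial_log_density(2)[OF C2 pos that] c(1) c(2)[OF that] nz
    by (auto intro!: continuous_intros)
  show "continuous_on UNIV (partial s (partial t (log_density p)))" if "s \<in> {1..T}" "t \<in> {1..T}" for s t
    using partial_log_density(4)[OF C2 pos that] c(1) c(2)[OF that(1)] c(2)[OF that(2)] c(3)[OF that] nz
    by (auto intro!: continuous_intros)
qed

text \<open>Only the distance of the intermediate point from \<open>x t\<close> is recorded, so that
  both signs of \<open>u\<close> are covered. Taylor's theorem speaks of distinct points, hence the
  separate case \<open>u = 0\<close>.\<close>

lemma partial_taylor1:
  assumes "has_partials T f" "t \<in> {1..T}"
  obtains \<xi> where "\<bar>\<xi> - x t\<bar> \<le> \<bar>u\<bar>" "f (x(t := x t + u)) = f x + u * partial t f (x(t := \<xi>))"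
proof (cases "u = 0")
  case True
  then show ?thesis using that[of "x t"] by simp
next
  case False
  define diff where "diff m v = (if m = 0 then f (x(t := v)) else partial t f (x(t := v)))" for m :: nat and v
  have d: "diff 0 = (\<lambda>v. f (x(t := v)))" "diff (Suc 0) = (\<lambda>v. partial t f (x(t := v)))"
    by (simp_all add: diff_def fun_eq_iff)
  have "\<exists>\<xi>. (if x t + u < x t then x t + u < \<xi> \<and> \<xi> < x t else x t < \<xi> \<and> \<xi> < x t + u) \<and>
    f (x(t := x t + u)) = (\<Sum>m<1. diff m (x t) / fact m * (x t + u - x t) ^ m) + diff 1 \<xi> / fact 1 * (x t + u - x t) ^ 1"
    by (rule Taylor[of 1 diff "\<lambda>v. f (x(t := v))" "x t - \<bar>u\<bar>" "x t + \<bar>u\<bar>"])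
      (use False partial_DERIV[OF assms] in \<open>auto simp: d\<close>)
  then show ?thesis
    by (elim exE) (rule that, auto simp: diff_def split: if_splits)
qed

lemma partial_taylor2:
  assumes "has_partials T f" "t \<in> {1..T}" "has_partials T (partial t f)"
  obtains \<xi> where "\<bar>\<xi> - x t\<bar> \<le> \<bar>u\<bar>"
    "f (x(t := x t + u)) = f x + u * partial t f x + u\<^sup>2 / 2 * partial t (partial t f) (x(t := \<xi>))"
proof (cases "u = 0")
  case True
  then show ?thesis using that[of "x t"] by simp
next
  case False
  define diff where "diff m v = (if m = 0 then f (x(t := v)) else if m = 1 then partial t f (x(t := v))
    else partial t (partial t f) (x(t := v)))" for m :: nat and v
  have d: "diff 0 = (\<lambda>v. f (x(t := v)))" "diff (Suc 0) = (\<lambda>v. partial t f (x(t := v)))"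
    "diff 2 = (\<lambda>v. partial t (partial t f) (x(t := v)))"
    by (simp_all add: diff_def fun_eq_iff)
  have "\<exists>\<xi>. (if x t + u < x t then x t + u < \<xi> \<and> \<xi> < x t else x t < \<xi> \<and> \<xi> < x t + u) \<and>
    f (x(t := x t + u)) = (\<Sum>m<2. diff m (x t) / fact m * (x t + u - x t) ^ m) + diff 2 \<xi> / fact 2 * (x t + u - x t) ^ 2"
    by (rule Taylor[of 2 diff "\<lambda>v. f (x(t := v))" "x t - \<bar>u\<bar>" "x t + \<bar>u\<bar>"])
      (use False partial_DERIV[OF assms(1,2)] partial_DERIV[OF assms(3,2)] in
        \<open>auto simp: d less_2_cases_iff numeral_2_eq_2[symmetric]\<close>)
  then show ?thesis
    by (elim exE) (rule that, auto simp: diff_def numeral_2_eq_2 lessThan_Suc split: if_splits)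
qed

text \<open>Coordinates are moved one at a time, \<open>y n\<close> having the first
  \<open>n\<close> already moved, with the mean value theorem at each move. Every intermediate point
  stays in the box in which \<open>c s\<close> approximates the partial derivative within
  \<open>e\<close>.\<close>

lemma multi_taylor1:
  fixes x h :: "nat \<Rightarrow> real"
  defines "y \<equiv> \<lambda>n j. if 1 \<le> j \<and> j \<le> n then x j + h j else x j"
  assumes f: "has_partials T f"
    and c: "\<And>s z. s \<in> {1..T} \<Longrightarrow> (\<And>j. \<bar>z j - x j\<bar> \<le> \<bar>h j\<bar>) \<Longrightarrow> \<bar>partial s f z - c s\<bar> \<le> e"
    and n: "n \<le> T"
  shows "\<bar>f (y n) - f x - (\<Sum>s=1..n. h s * c s)\<bar> \<le> e * (\<Sum>s=1..n. \<bar>h s\<bar>)"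
  using n
proof (induction n)
  case 0
  have "y 0 = x" by (auto simp: y_def fun_eq_iff)
  then show ?case by simp
next
  case (Suc n)
  have S: "Suc n \<in> {1..T}" using Suc.prems by simp
  have y: "y (Suc n) = (y n)(Suc n := y n (Suc n) + h (Suc n))" by (auto simp: y_def fun_eq_iff)
  obtain \<xi> where \<xi>: "\<bar>\<xi> - y n (Suc n)\<bar> \<le> \<bar>h (Suc n)\<bar>"
    and eq: "f (y (Suc n)) = f (y n) + h (Suc n) * partial (Suc n) f ((y n)(Suc n := \<xi>))"
    unfolding y by (rule partial_taylor1[OF f S])
  have "\<bar>partial (Suc n) f ((y n)(Suc n := \<xi>)) - c (Suc n)\<bar> \<le> e"
    by (rule c[OF S]) (use \<xi> in \<open>auto simp: y_def\<close>)
  then have "\<bar>h (Suc n) * (partial (Suc n) f ((y n)(Suc n := \<xi>)) - c (Suc n))\<bar> \<le> \<bar>h (Suc n)\<bar> * e"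
    unfolding abs_mult by (rule mult_left_mono) simp
  moreover have "f (y (Suc n)) - f x - (\<Sum>s=1..Suc n. h s * c s) =
    (f (y n) - f x - (\<Sum>s=1..n. h s * c s)) + h (Suc n) * (partial (Suc n) f ((y n)(Suc n := \<xi>)) - c (Suc n))"
    unfolding eq by (simp add: algebra_simps)
  ultimately show ?case using Suc by (simp add: algebra_simps)
qed

text \<open>Regularity is given through partial derivatives, so the increment is built coordinate by
  coordinate: coordinate \<open>t\<close> is expanded to second order at the partially moved point,
  and the slope there is compared with the slope at \<open>x\<close> by
  \<open>multi_taylor1\<close>. This comparison produces each mixed term once, for
  \<open>s < t\<close>, without a factor 1/2. The Lipschitz bound makes all errors cubic.\<close>

lemma multi_taylor2:
  fixes x h :: "nat \<Rightarrow> real"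
  assumes f: "has_partials T f" and f': "\<And>t. t \<in> {1..T} \<Longrightarrow> has_partials T (partial t f)"
    and on: "on_coords T f"
    and lip: "\<And>s t x y. s \<in> {1..T} \<Longrightarrow> t \<in> {1..T} \<Longrightarrow>
      \<bar>partial s (partial t f) x - partial s (partial t f) y\<bar> \<le> L * L2_set (\<lambda>j. x j - y j) {1..T}"
    and L: "0 \<le> L"
    and z: "\<And>t. t \<in> {1..T} \<Longrightarrow> z t = x t + h t"
  shows "\<bar>f z - f x - (\<Sum>t=1..T. h t * partial t f x
      + (\<Sum>s\<in>{1..<t}. h s * h t * partial s (partial t f) x)
      + (h t)\<^sup>2 / 2 * partial t (partial t f) x)\<bar> \<le> L * (\<Sum>t=1..T. \<bar>h t\<bar>) ^ 3"
proof -
  define y where "y = (\<lambda>n j. if 1 \<le> j \<and> j \<le> n then x j + h j else x j)"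
  define A where "A = (\<Sum>t=1..T. \<bar>h t\<bar>)"
  have A0: "0 \<le> A" by (simp add: A_def sum_nonneg)
  have box: "\<bar>partial s (partial t f) z - partial s (partial t f) x\<bar> \<le> L * A"
    if "s \<in> {1..T}" "t \<in> {1..T}" "\<And>j. \<bar>z j - x j\<bar> \<le> \<bar>h j\<bar>" for s t z
  proof -
    have "L2_set (\<lambda>j. z j - x j) {1..T} \<le> (\<Sum>j=1..T. \<bar>z j - x j\<bar>)" by (rule L2_set_le_sum_abs)
    also have "\<dots> \<le> A" unfolding A_def by (rule sum_mono) (rule that(3))
    finally show ?thesis using lip[OF that(1,2), of z x] L by (meson mult_left_mono order_trans)
  qed
  have "\<bar>f (y n) - f x - (\<Sum>t=1..n. h t * partial t f x
      + (\<Sum>s\<in>{1..<t}. h s * h t * partial s (partial t f) x)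
      + (h t)\<^sup>2 / 2 * partial t (partial t f) x)\<bar> \<le> L * A\<^sup>2 * (\<Sum>t=1..n. \<bar>h t\<bar>)" if "n \<le> T" for n
    using that
  proof (induction n)
    case 0
    have "y 0 = x" by (auto simp: y_def fun_eq_iff)
    then show ?case by simp
  next
    case (Suc n)
    let ?t = "Suc n"
    have S: "?t \<in> {1..T}" using Suc.prems by simp
    have y: "y ?t = (y n)(?t := y n ?t + h ?t)" by (auto simp: y_def fun_eq_iff)
    obtain \<xi> where \<xi>: "\<bar>\<xi> - y n ?t\<bar> \<le> \<bar>h ?t\<bar>"
      and eq: "f (y ?t) = f (y n) + h ?t * partial ?t f (y n)
        + (h ?t)\<^sup>2 / 2 * partial ?t (partial ?t f) ((y n)(?t := \<xi>))"
      unfolding y by (rule partial_taylor2[OF f S f'[OF S]])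
    \<comment> \<open>\<open>D\<close> is the error of expanding the slope to first order,
      \<open>E\<close> the error of freezing the second derivative at \<open>x\<close>.\<close>
    define D where "D = partial ?t f (y n) - partial ?t f x - (\<Sum>s=1..n. h s * partial s (partial ?t f) x)"
    define E where "E = partial ?t (partial ?t f) ((y n)(?t := \<xi>)) - partial ?t (partial ?t f) x"
    have D: "\<bar>D\<bar> \<le> L * A * (\<Sum>s=1..n. \<bar>h s\<bar>)"
      unfolding D_def y_def by (rule multi_taylor1[OF f'[OF S] box[OF _ S]]) (use Suc.prems in auto)
    have E: "\<bar>E\<bar> \<le> L * A"
      unfolding E_def by (rule box[OF S S]) (use \<xi> in \<open>auto simp: y_def\<close>)
    have sums: "(\<Sum>s=1..n. \<bar>h s\<bar>) + \<bar>h ?t\<bar> \<le> A"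
    proof -
      have "(\<Sum>s=1..n. \<bar>h s\<bar>) + \<bar>h ?t\<bar> = (\<Sum>s=1..?t. \<bar>h s\<bar>)" by simp
      also have "\<dots> \<le> A" unfolding A_def by (rule sum_mono2) (use Suc.prems in auto)
      finally show ?thesis .
    qed
    have "\<bar>h ?t * D + (h ?t)\<^sup>2 / 2 * E\<bar> \<le> \<bar>h ?t\<bar> * \<bar>D\<bar> + (h ?t)\<^sup>2 / 2 * \<bar>E\<bar>"
      by (rule order_trans[OF abs_triangle_ineq]) (simp add: abs_mult)
    \<comment> \<open>The factor 1/2 is dropped so that both bounds combine into the partial sum up
      to \<open>?t\<close>, which is at most \<open>A\<close>.\<close>
    also have "\<dots> \<le> \<bar>h ?t\<bar> * (L * A * (\<Sum>s=1..n. \<bar>h s\<bar>)) + (h ?t)\<^sup>2 * (L * A)"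
      using D E by (intro add_mono mult_left_mono mult_mono) auto
    also have "\<dots> = L * A * \<bar>h ?t\<bar> * ((\<Sum>s=1..n. \<bar>h s\<bar>) + \<bar>h ?t\<bar>)"
      by (simp add: algebra_simps power2_eq_square)
    also have "\<dots> \<le> L * A * \<bar>h ?t\<bar> * A"
      using sums L A0 by (intro mult_left_mono mult_nonneg_nonneg) auto
    finally have step: "\<bar>h ?t * D + (h ?t)\<^sup>2 / 2 * E\<bar> \<le> L * A\<^sup>2 * \<bar>h ?t\<bar>"
      by (simp add: power2_eq_square mult_ac)
    have ivl: "{1..<Suc n} = {1..n}" by auto
    define R where "R = f (y n) - f x - (\<Sum>t=1..n. h t * partial t f x
      + (\<Sum>s\<in>{1..<t}. h s * h t * partial s (partial t f) x)
      + (h t)\<^sup>2 / 2 * partial t (partial t f) x)"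
    have "f (y ?t) - f x - (\<Sum>t=1..?t. h t * partial t f x
      + (\<Sum>s\<in>{1..<t}. h s * h t * partial s (partial t f) x)
      + (h t)\<^sup>2 / 2 * partial t (partial t f) x) = R + (h ?t * D + (h ?t)\<^sup>2 / 2 * E)"
      unfolding eq D_def E_def R_def sum.cl_ivl_Suc ivl
      by (simp add: sum_distrib_left algebra_simps)
    moreover have "\<bar>R\<bar> \<le> L * A\<^sup>2 * (\<Sum>t=1..n. \<bar>h t\<bar>)"
      unfolding R_def by (rule Suc.IH) (use Suc.prems in simp)
    ultimately show ?case using step by (simp add: distrib_left)
  qed
  from this[of T] have "\<bar>f (y T) - f x - (\<Sum>t=1..T. h t * partial t f x
      + (\<Sum>s\<in>{1..<t}. h s * h t * partial s (partial t f) x)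
      + (h t)\<^sup>2 / 2 * partial t (partial t f) x)\<bar> \<le> L * A ^ 3"
    unfolding A_def[symmetric] by (simp add: power3_eq_cube power2_eq_square mult.assoc)
  moreover have "f z = f (y T)" by (rule on_coordsD[OF on]) (use z in \<open>auto simp: y_def\<close>)
  ultimately show ?thesis by (simp add: A_def)
qed

section \<open>The Fisher information\<close>

declare One_nat_def [simp del]

abbreviation leb :: "nat \<Rightarrow> (nat \<Rightarrow> real) measure" where
  "leb n \<equiv> \<Pi>\<^sub>M i\<in>{1..n}. lborel"

abbreviation states :: "nat \<Rightarrow> nat \<Rightarrow> (nat \<Rightarrow> nat \<Rightarrow> real) measure" where
  "states m n \<equiv> \<Pi>\<^sub>M i\<in>{1..m}. leb n"

type_synonym 'n noise = "nat \<times> nat \<Rightarrow> real^'n"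

text \<open>\<open>F\<close> is continuous on the full product, while the measure space only carries
  coordinates in \<open>I\<close>. The other coordinates are constantly \<open>undefined\<close>,
  hence measurable, so the space embeds measurably into the full product.\<close>

lemma borel_measurable_PiM_continuous:
  fixes F :: "(nat \<Rightarrow> real) \<Rightarrow> real"
  assumes "continuous_on UNIV F" "\<And>i. i \<in> I \<Longrightarrow> sets (M i) = sets borel"
  shows "F \<in> borel_measurable (PiM I M)"
proof -
  have "(\<lambda>x. x i) \<in> borel_measurable (PiM I M)" for i
  proof (cases "i \<in> I")
    case True
    then have "(\<lambda>x. x i) \<in> measurable (PiM I M) (M i)" by simp
    then show ?thesis using assms(2)[OF True] measurable_cong_sets by blast
  next
    case False
    have "(\<lambda>x. x i) \<in> borel_measurable (PiM I M) \<longleftrightarrow> (\<lambda>x. undefined :: real) \<in> borel_measurable (PiM I M)"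
      by (rule measurable_cong) (use False in \<open>auto simp: space_PiM PiE_def extensional_def\<close>)
    then show ?thesis by simp
  qed
  then have "(\<lambda>x. x) \<in> measurable (PiM I M) (PiM UNIV (\<lambda>_. borel :: real measure))"
    by (intro measurable_PiM_single') (auto simp: space_PiM)
  moreover have "F \<in> borel_measurable (PiM UNIV (\<lambda>_. borel :: real measure))"
    using borel_measurable_continuous_onI[OF assms(1)] sets_PiM_equal_borel measurable_cong_sets by blast
  ultimately show ?thesis using measurable_compose[of "\<lambda>x. x"] by blast
qed

section \<open>Lebesgue integration along coordinate lines\<close>

lemma AE_eq_0_continuous:
  fixes g :: "real \<Rightarrow> real"
  assumes "AE u in lborel. g u = 0" "continuous_on UNIV g"
  shows "g u = 0"
proof (rule ccontr)
  assume "g u \<noteq> 0"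
  have o: "open {u. g u \<noteq> 0}" by (rule open_Collect_neq[OF assms(2) continuous_on_const])
  then have "{u. g u \<noteq> 0} \<in> null_sets lborel"
    using assms(1) by (subst AE_iff_null_sets) (auto simp: borel_open)
  then have "negligible {u. g u \<noteq> 0}"
    by (simp add: negligible_iff_null_sets null_sets_completionI)
  then show False using open_not_negligible[OF o] \<open>g u \<noteq> 0\<close> by auto
qed

lemma emeasure_lborel_atLeast: "emeasure lborel {a::real..} = \<infinity>"
proof (rule ccontr)
  assume "emeasure lborel {a..} \<noteq> \<infinity>"
  then obtain n where n: "emeasure lborel {a..} < of_nat n"
    using ennreal_Ex_less_of_nat less_top by (auto simp: infinity_ennreal_def)
  have "emeasure lborel {a..a + real n} \<le> emeasure lborel {a..}"
    by (rule emeasure_mono) auto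
  then show False using n by (simp add: ennreal_of_nat_eq_real_of_nat)
qed

lemma emeasure_PiM_lborel_space_neq_0:
  assumes "finite J"
  shows "emeasure (\<Pi>\<^sub>M t\<in>J. lborel :: real measure) (space (\<Pi>\<^sub>M t\<in>J. lborel)) \<noteq> 0"
proof -
  interpret product_sigma_finite "\<lambda>_. lborel :: real measure" ..
  have "emeasure (\<Pi>\<^sub>M t\<in>J. lborel :: real measure) (Pi\<^sub>E J (\<lambda>_. UNIV)) = (\<Prod>t\<in>J. emeasure lborel (UNIV :: real set))"
    using assms by (subst emeasure_PiM) auto
  also have "\<dots> \<noteq> 0" using assms by simp
  finally show ?thesis by (simp add: space_PiM)
qed

text \<open>By the fundamental theorem on [-y, y], the difference \<open>g y - g (- y)\<close> tends
  to the integral of \<open>k\<close>. A nonzero limit would keep the integrable function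
  \<open>h\<close> away from zero on a half-line, which has infinite measure.\<close>

lemma integral_derivative_eq_0:
  fixes g k :: "real \<Rightarrow> real"
  assumes deriv: "\<And>u. (g has_real_derivative k u) (at u)" and k: "continuous_on UNIV k"
    and gi: "integrable lborel g" and ki: "integrable lborel k"
  shows "(\<integral>u. k u \<partial>lborel) = 0"
proof (rule ccontr)
  let ?c = "\<integral>u. k u \<partial>lborel"
  assume c: "?c \<noteq> 0"
  define h where "h u = g u - g (- u)" for u
  have hi: "integrable lborel h"
    unfolding h_def using lborel_integrable_real_affine[OF gi, of "-1" 0] gi by simp
  have kc: "isCont k u" for u using k by (simp add: continuous_on_eq_continuous_at)
  have FTC: "(\<integral>u. k u * indicator {-y..y} u \<partial>lborel) = h y" if "0 \<le> y" for y
    unfolding h_def by (rule integral_FTC_Icc_real) (use that deriv kc in auto)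
  have "((\<lambda>y. \<integral>u. k u * indicator {-y..y} u \<partial>lborel) \<longlongrightarrow> ?c) at_top"
  proof (rule integral_dominated_convergence_at_top[where w="\<lambda>u. norm (k u)"])
    show "AE u in lborel. ((\<lambda>y. k u * indicator {-y..y} u) \<longlongrightarrow> k u) at_top"
    proof (rule AE_I2)
      fix u :: real
      have "\<forall>\<^sub>F y in at_top. k u * indicator {-y..y} u = k u"
        using eventually_ge_at_top[of "\<bar>u\<bar>"] by eventually_elim (auto simp: indicator_def)
      then show "((\<lambda>y. k u * indicator {-y..y} u) \<longlongrightarrow> k u) at_top"
        by (rule tendsto_eventually)
    qed
    show "\<forall>\<^sub>F y in at_top. AE u in lborel. norm (k u * indicator {-y..y} u) \<le> norm (k u)"
      by (intro always_eventually allI AE_I2) (auto simp: indicator_def)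
  qed (use ki in auto)
  moreover have "\<forall>\<^sub>F y in at_top. (\<integral>u. k u * indicator {-y..y} u \<partial>lborel) = h y"
    using eventually_ge_at_top[of 0] by eventually_elim (rule FTC)
  ultimately have "(h \<longlongrightarrow> ?c) at_top" by (rule Lim_transform_eventually)
  then have "((\<lambda>y. \<bar>h y\<bar>) \<longlongrightarrow> \<bar>?c\<bar>) at_top" by (rule tendsto_rabs)
  then have "\<forall>\<^sub>F y in at_top. \<bar>?c\<bar> / 2 < \<bar>h y\<bar>"
    by (rule order_tendstoD) (use c in auto)
  then obtain M where M: "\<And>y. M \<le> y \<Longrightarrow> \<bar>?c\<bar> / 2 < \<bar>h y\<bar>"
    by (auto simp: eventually_at_top_linorder)
  have "(\<integral>\<^sup>+u. ennreal (\<bar>?c\<bar> / 2) * indicator {M..} u \<partial>lborel) \<le> (\<integral>\<^sup>+u. ennreal (norm (h u)) \<partial>lborel)"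
    by (intro nn_integral_mono) (auto simp: indicator_def intro!: ennreal_leI dest: M)
  moreover have "(\<integral>\<^sup>+u. ennreal (\<bar>?c\<bar> / 2) * indicator {M..} u \<partial>lborel) = \<infinity>"
    using c by (simp add: nn_integral_cmult_indicator emeasure_lborel_atLeast ennreal_mult_top)
  ultimately show False
    using hi by (auto simp: integrable_iff_bounded top_unique)
qed

text \<open>Fubini with coordinate \<open>t\<close> innermost, together with integrability on almost
  every line in direction \<open>t\<close>. Through this, one-dimensional calculus applies to
  integrals over all coordinates.\<close>

lemma product_integral_insert_split:
  fixes F :: "(nat \<Rightarrow> real) \<Rightarrow> real"
  assumes t: "t \<in> {1..T}" and F: "integrable (leb T) F"
  shows "(\<integral>x. F x \<partial>(leb T)) = (\<integral>x. \<integral>u. F (x(t := u)) \<partial>lborel \<partial>(\<Pi>\<^sub>M t\<in>{1..T} - {t}. lborel))"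
    and "AE x in (\<Pi>\<^sub>M t\<in>{1..T} - {t}. lborel). (\<integral>\<^sup>+u. ennreal \<bar>F (x(t := u))\<bar> \<partial>lborel) \<noteq> \<infinity>"
proof -
  interpret product_sigma_finite "\<lambda>_::nat. lborel :: real measure" ..
  define J where "J = {1..T} - {t}"
  have ins: "{1..T} = insert t J" and J: "finite J" "t \<notin> J" using t by (auto simp: J_def)
  from F have F': "integrable (\<Pi>\<^sub>M t\<in>insert t J. lborel) F" using ins by simp
  then have [measurable]: "F \<in> borel_measurable (\<Pi>\<^sub>M t\<in>insert t J. lborel)" by (rule borel_measurable_integrable)
  show "(\<integral>x. F x \<partial>(leb T)) = (\<integral>x. \<integral>u. F (x(t := u)) \<partial>lborel \<partial>(\<Pi>\<^sub>M t\<in>{1..T} - {t}. lborel))"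
    using product_integral_insert[OF J F'] by (simp only: ins[symmetric]) (simp only: J_def)
  have "(\<integral>\<^sup>+x. ennreal \<bar>F x\<bar> \<partial>(\<Pi>\<^sub>M t\<in>insert t J. lborel)) =
    (\<integral>\<^sup>+x. \<integral>\<^sup>+u. ennreal \<bar>F (x(t := u))\<bar> \<partial>lborel \<partial>(\<Pi>\<^sub>M t\<in>J. lborel))"
    by (rule product_nn_integral_insert[OF J]) measurable
  with F' have fin: "(\<integral>\<^sup>+x. \<integral>\<^sup>+u. ennreal \<bar>F (x(t := u))\<bar> \<partial>lborel \<partial>(\<Pi>\<^sub>M t\<in>J. lborel)) \<noteq> \<infinity>"
    by (simp add: integrable_iff_bounded)
  show "AE x in (\<Pi>\<^sub>M t\<in>{1..T} - {t}. lborel). (\<integral>\<^sup>+u. ennreal \<bar>F (x(t := u))\<bar> \<partial>lborel) \<noteq> \<infinity>"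
    unfolding J_def[symmetric] by (rule nn_integral_PInf_AE[OF _ fin]) measurable
qed

lemma continuous_on_fun_upd:
  fixes F :: "(nat \<Rightarrow> real) \<Rightarrow> real"
  assumes "continuous_on UNIV F"
  shows "continuous_on UNIV (\<lambda>u. F (x(t := u)))"
proof (rule continuous_on_compose2[OF assms])
  show "continuous_on UNIV (\<lambda>u. x(t := u))"
  proof (rule continuous_on_coordinatewise_then_product)
    show "continuous_on UNIV (\<lambda>u. (x(t := u)) i)" for i by (cases "i = t") auto
  qed
qed auto

text \<open>Used with \<open>partial t p\<close> in the role of \<open>g\<close>: the second
  derivative of the density then integrates to zero.\<close>

lemma integral_partial_eq_0:
  assumes t: "t \<in> {1..T}" and g: "has_partials T g" and c: "continuous_on UNIV g" "continuous_on UNIV (partial t g)"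
    and gi: "integrable (leb T) g" and ki: "integrable (leb T) (partial t g)"
  shows "(\<integral>x. partial t g x \<partial>(leb T)) = 0"
proof -
  have "(\<integral>x. \<integral>u. partial t g (x(t := u)) \<partial>lborel \<partial>(\<Pi>\<^sub>M t\<in>{1..T} - {t}. lborel)) = 0"
  proof (rule integral_eq_zero_AE)
    show "AE x in (\<Pi>\<^sub>M t\<in>{1..T} - {t}. lborel). (\<integral>u. partial t g (x(t := u)) \<partial>lborel) = 0"
      using product_integral_insert_split(2)[OF t gi] product_integral_insert_split(2)[OF t ki]
    proof eventually_elim
      case (elim x)
      have cc: "continuous_on UNIV (\<lambda>u. g (x(t := u)))" "continuous_on UNIV (\<lambda>u. partial t g (x(t := u)))"
        by (intro continuous_on_fun_upd c)+
      show ?case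
        by (rule integral_derivative_eq_0[OF partial_DERIV[OF g t] cc(2)])
          (use elim cc in \<open>auto simp: integrable_iff_bounded less_top intro: borel_measurable_continuous_onI\<close>)
    qed
  qed
  then show ?thesis using product_integral_insert_split(1)[OF t ki] by simp
qed

lemma integrable_path_law_iff:
  assumes p: "p \<in> borel_measurable (leb T)" "\<And>x. 0 < p x"
    and F: "F \<in> borel_measurable (leb T)"
  shows "integrable (path_law T p) F \<longleftrightarrow> integrable (leb T) (\<lambda>x. p x * F x)"
    and "(\<integral>x. F x \<partial>path_law T p) = (\<integral>x. p x * F x \<partial>(leb T))"
proof -
  have "AE x in (leb T). 0 \<le> p x" using p(2) by (intro AE_I2 less_imp_le)
  then show "integrable (path_law T p) F \<longleftrightarrow> integrable (leb T) (\<lambda>x. p x * F x)"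
    "(\<integral>x. F x \<partial>path_law T p) = (\<integral>x. p x * F x \<partial>(leb T))"
    unfolding path_law_def using integrable_real_density[OF p(1) _ F] integral_real_density[OF p(1) _ F] by blast+
qed

text \<open>The properties of the target that the analysis works with. For a Feynman-Kac density,
  \<open>on\<close> and \<open>prob\<close> are derived in the last part.\<close>

locale smooth_target =
  fixes T :: nat and p :: "(nat \<Rightarrow> real) \<Rightarrow> real"
  assumes C2: "twice_cont_diff T p" and pos: "\<And>x. 0 < p x" and on: "on_coords T p"
    and prob: "prob_space (path_law T p)"
    and lip: "\<And>s t. s \<in> {1..T} \<Longrightarrow> t \<in> {1..T} \<Longrightarrow> euclid_lipschitz T (partial s (partial t (log_density p)))"
    and bdd: "\<And>s t. s \<in> {1..T} \<Longrightarrow> t \<in> {1..T} \<Longrightarrow> bounded (range (partial s (partial t (log_density p))))"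
    and moment: "\<And>t. t \<in> {1..T} \<Longrightarrow> integrable (path_law T p) (\<lambda>x. \<bar>partial t (log_density p) x\<bar> ^ 4)"
begin

sublocale path: prob_space "path_law T p" by (rule prob)

abbreviation "f \<equiv> log_density p"
abbreviation "f1 t \<equiv> partial t f"
abbreviation "f2 s t \<equiv> partial s (partial t f)"

lemma p_measurable [measurable]: "p \<in> borel_measurable (leb T)"
  using C2 by (intro borel_measurable_PiM_continuous) (auto simp: twice_cont_diff_def)

lemma sets_path_law [simp, measurable_cong]: "sets (path_law T p) = sets (leb T)"
  by (simp add: path_law_def)

lemma f1_measurable [measurable]:
  assumes "t \<in> {1..T}"
  shows "f1 t \<in> borel_measurable (leb T)"
  by (rule borel_measurable_PiM_continuous[OF continuous_partials_log_density(2)[OF C2 pos assms] sets_lborel])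

lemma f2_measurable [measurable]:
  assumes "s \<in> {1..T}" "t \<in> {1..T}"
  shows "f2 s t \<in> borel_measurable (leb T)"
  by (rule borel_measurable_PiM_continuous[OF continuous_partials_log_density(3)[OF C2 pos assms] sets_lborel])

lemma f1_power_integrable:
  assumes "t \<in> {1..T}" "k \<le> 4"
  shows "integrable (path_law T p) (\<lambda>x. f1 t x ^ k)"
proof (rule Bochner_Integration.integrable_bound[of _ "\<lambda>x. 1 + \<bar>f1 t x\<bar> ^ 4"])
  show "integrable (path_law T p) (\<lambda>x. 1 + \<bar>f1 t x\<bar> ^ 4)" using moment[OF assms(1)] by simp
  have "\<bar>y\<bar> ^ k \<le> 1 + \<bar>y\<bar> ^ 4" for y :: real
  proof (cases "\<bar>y\<bar> \<le> 1")
    case True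
    then have "\<bar>y\<bar> ^ k \<le> 1" by (simp add: power_le_one)
    then show ?thesis by (smt (verit) zero_le_power abs_ge_zero)
  next
    case False
    then show ?thesis using power_increasing[OF assms(2), of "\<bar>y\<bar>"] by simp
  qed
  then show "AE x in path_law T p. norm (f1 t x ^ k) \<le> norm (1 + \<bar>f1 t x\<bar> ^ 4)"
    by (intro AE_I2) (simp add: power_abs)
qed (use assms in measurable)

lemma f2_bounded:
  "\<exists>B\<ge>0. \<forall>s\<in>{1..T}. \<forall>t\<in>{1..T}. \<forall>x. \<bar>f2 s t x\<bar> \<le> B"
proof -
  have "\<exists>b. \<forall>x. \<bar>f2 s t x\<bar> \<le> b" if "s \<in> {1..T}" "t \<in> {1..T}" for s t
    using bdd[OF that] by (auto simp: bounded_iff)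
  then obtain b where b: "\<And>s t x. s \<in> {1..T} \<Longrightarrow> t \<in> {1..T} \<Longrightarrow> \<bar>f2 s t x\<bar> \<le> b s t"
    by metis
  have "\<bar>f2 s t x\<bar> \<le> (\<Sum>s=1..T. \<Sum>t=1..T. \<bar>b s t\<bar>)" if "s \<in> {1..T}" "t \<in> {1..T}" for s t x
  proof -
    have "\<bar>f2 s t x\<bar> \<le> \<bar>b s t\<bar>" using b[OF that, of x] by simp
    also have "\<dots> \<le> (\<Sum>t=1..T. \<bar>b s t\<bar>)" by (rule member_le_sum[OF that(2)]) auto
    also have "\<dots> \<le> (\<Sum>s=1..T. \<Sum>t=1..T. \<bar>b s t\<bar>)"
      by (rule member_le_sum[OF that(1), of "\<lambda>s. \<Sum>t=1..T. \<bar>b s t\<bar>"]) (auto simp: sum_nonneg)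
    finally show ?thesis .
  qed
  then show ?thesis by (intro exI[of _ "\<Sum>s=1..T. \<Sum>t=1..T. \<bar>b s t\<bar>"]) (auto simp: sum_nonneg)
qed

lemma f2_integrable:
  assumes "s \<in> {1..T}" "t \<in> {1..T}"
  shows "integrable (path_law T p) (f2 s t)"
proof -
  obtain B where B: "\<forall>s\<in>{1..T}. \<forall>t\<in>{1..T}. \<forall>x. \<bar>f2 s t x\<bar> \<le> B" using f2_bounded by blast
  have "AE x in path_law T p. norm (f2 s t x) \<le> B"
    unfolding real_norm_def by (intro AE_I2 B[rule_format] assms)
  moreover have "f2 s t \<in> borel_measurable (path_law T p)"
    using f2_measurable[OF assms] unfolding path_law_def by simp
  ultimately show ?thesis by (rule path.integrable_const_bound)
qed

text \<open>The second derivative of \<open>p\<close> in direction \<open>t\<close> is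
  \<open>p\<close> times the sum of \<open>f2 t t\<close> and the squared score, and its integral
  vanishes. Since \<open>partial t p\<close> is \<open>p\<close> times the score, moments of the
  score supply the required integrability.\<close>

lemma fisher_identity:
  assumes t: "t \<in> {1..T}"
  shows "(\<integral>x. f2 t t x \<partial>path_law T p) = - fisher_info T p t"
proof -
  note pl = partial_log_density[OF C2 pos]
  have hp: "has_partials T (partial t p)" "continuous_on UNIV (partial t p)" "continuous_on UNIV (partial t (partial t p))"
    using C2 t by (auto simp: twice_cont_diff_def)
  have e1: "partial t p x = p x * f1 t x" for x
    using pos[of x] by (simp add: pl(2)[OF t])
  have e2: "partial t (partial t p) x = p x * (f2 t t x + (f1 t x)\<^sup>2)" for x
  proof -
    have "f2 t t x = (partial t (partial t p) x * p x - partial t p x * partial t p x) / (p x * p x)"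
      by (simp only: pl(4)[OF t t])
    moreover have "f1 t x = partial t p x / p x" by (simp only: pl(2)[OF t])
    ultimately show ?thesis
      using pos[of x] by (simp only:) (simp add: field_simps power2_eq_square)
  qed
  have i1: "integrable (path_law T p) (f1 t)" using f1_power_integrable[OF t, of 1] by simp
  have i2: "integrable (path_law T p) (\<lambda>x. f2 t t x + (f1 t x)\<^sup>2)"
    using f1_power_integrable[OF t, of 2] f2_integrable[OF t t] by simp
  have "(\<integral>x. partial t (partial t p) x \<partial>(leb T)) = 0"
  proof (rule integral_partial_eq_0[OF t hp])
    show "integrable (leb T) (partial t p)"
      unfolding e1[abs_def] using i1 integrable_path_law_iff(1)[OF p_measurable pos f1_measurable[OF t]] by simp
    show "integrable (leb T) (partial t (partial t p))"
      unfolding e2[abs_def] using i2 t by (subst integrable_path_law_iff(1)[symmetric, OF p_measurable pos]) auto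
  qed
  then have "(\<integral>x. f2 t t x + (f1 t x)\<^sup>2 \<partial>path_law T p) = 0"
    unfolding e2[abs_def] using t by (subst integrable_path_law_iff(2)[OF p_measurable pos]) auto
  then show ?thesis
    using f1_power_integrable[OF t, of 2] f2_integrable[OF t t] by (simp add: fisher_info_def)
qed

text \<open>With zero information the score would vanish almost everywhere, hence by continuity on
  entire lines in direction \<open>t\<close>. The density would be a positive constant on such a
  line, which is incompatible with integrability there.\<close>

lemma fisher_info_pos:
  assumes t: "t \<in> {1..T}"
  shows "0 < fisher_info T p t"
proof (rule ccontr)
  interpret product_sigma_finite "\<lambda>_::nat. lborel :: real measure" ..
  assume "\<not> 0 < fisher_info T p t"
  moreover have "0 \<le> fisher_info T p t" by (simp add: fisher_info_def)
  ultimately have "fisher_info T p t = 0" by simp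
  then have "(\<integral>x. (f1 t x)\<^sup>2 \<partial>path_law T p) = 0" by (simp add: fisher_info_def)
  then have "AE x in path_law T p. (f1 t x)\<^sup>2 = 0"
    using f1_power_integrable[OF t, of 2] by (subst (asm) integral_nonneg_eq_0_iff_AE) auto
  then have "AE x in (leb T). f1 t x = 0"
    unfolding path_law_def using pos by (subst (asm) AE_density) auto
  then have z: "(\<integral>\<^sup>+x. ennreal \<bar>f1 t x\<bar> \<partial>(leb T)) = 0"
    using t by (subst nn_integral_0_iff_AE) auto
  define J where "J = {1..T} - {t}"
  have ins: "{1..T} = insert t J" and J: "finite J" "t \<notin> J" using t by (auto simp: J_def)
  have [measurable]: "f1 t \<in> borel_measurable (\<Pi>\<^sub>M t\<in>insert t J. lborel)"
    using f1_measurable[OF t] ins by simp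
  have "(\<integral>\<^sup>+x. ennreal \<bar>f1 t x\<bar> \<partial>(\<Pi>\<^sub>M t\<in>insert t J. lborel)) =
    (\<integral>\<^sup>+x. \<integral>\<^sup>+u. ennreal \<bar>f1 t (x(t := u))\<bar> \<partial>lborel \<partial>(\<Pi>\<^sub>M t\<in>J. lborel))"
    by (rule product_nn_integral_insert[OF J]) measurable
  then have "(\<integral>\<^sup>+x. \<integral>\<^sup>+u. ennreal \<bar>f1 t (x(t := u))\<bar> \<partial>lborel \<partial>(\<Pi>\<^sub>M t\<in>J. lborel)) = 0"
    using z ins by simp
  then have ae1: "AE x in (\<Pi>\<^sub>M t\<in>J. lborel). (\<integral>\<^sup>+u. ennreal \<bar>f1 t (x(t := u))\<bar> \<partial>lborel) = 0"
    by (subst (asm) nn_integral_0_iff_AE) measurable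
  have "integrable (leb T) (\<lambda>x. p x * 1)"
    by (subst integrable_path_law_iff(1)[symmetric, OF p_measurable pos]) auto
  then have ae2: "AE x in (\<Pi>\<^sub>M t\<in>{1..T} - {t}. lborel). (\<integral>\<^sup>+u. ennreal \<bar>p (x(t := u))\<bar> \<partial>lborel) \<noteq> \<infinity>"
    using product_integral_insert_split(2)[OF t, of p] by simp
  note ae2 = ae2[folded J_def]
  \<comment> \<open>A contradiction for almost every choice of the remaining coordinates makes their
    space null, although its Lebesgue measure is not zero.\<close>
  have "AE x in (\<Pi>\<^sub>M t\<in>J. lborel :: real measure). False"
    using ae1 ae2
  proof eventually_elim
    case (elim x)
    have c1: "continuous_on UNIV (\<lambda>u. f1 t (x(t := u)))"
      by (intro continuous_on_fun_upd continuous_partials_log_density[OF C2 pos] t)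
    then have "(\<lambda>u. f1 t (x(t := u))) \<in> borel_measurable borel" by (rule borel_measurable_continuous_onI)
    then have "AE u in lborel. f1 t (x(t := u)) = 0"
      using elim(1) by (subst (asm) nn_integral_0_iff_AE) auto
    from AE_eq_0_continuous[OF this c1]
    have "f1 t (x(t := u)) = 0" for u .
    then have "((\<lambda>v. f (x(t := v))) has_real_derivative 0) (at u)" for u
      using partial_DERIV[OF partial_log_density(1)[OF C2 pos] t, of x u] by simp
    then have "f (x(t := u)) = f (x(t := 0))" for u
      using DERIV_isconst_all[of "\<lambda>v. f (x(t := v))"] by blast
    then have "p (x(t := u)) = p (x(t := 0))" for u
      unfolding log_density_def using pos ln_inj_iff by blast
    moreover define c where "c = p (x(t := 0))"
    ultimately have c: "p (x(t := u)) = c" for u by blast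
    have "0 < c" using pos by (simp add: c_def)
    then show ?case using elim(2) by (simp add: c ennreal_mult_top)
  qed
  then have "emeasure (\<Pi>\<^sub>M t\<in>J. lborel :: real measure) (space (\<Pi>\<^sub>M t\<in>J. lborel)) = 0"
    by (simp add: AE_iff_null null_sets_def)
  moreover have "emeasure (\<Pi>\<^sub>M t\<in>J. lborel :: real measure) (space (\<Pi>\<^sub>M t\<in>J. lborel)) \<noteq> 0"
    by (rule emeasure_PiM_lborel_space_neq_0[OF J(1)])
  ultimately show False by simp
qed

end

section \<open>Orthogonal sums and the weak law of large numbers\<close>

text \<open>Indices outside \<open>J\<close> receive the constant factor 1, which turns a product
  over \<open>J\<close> into one over \<open>I\<close>.\<close>

lemma PiM_expectation_prod:
  fixes f :: "'i \<Rightarrow> 'a \<Rightarrow> real"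
  assumes M: "prob_space M" and "finite I" "J \<subseteq> I" and f: "\<And>j. j \<in> J \<Longrightarrow> integrable M (f j)"
  shows "integrable (\<Pi>\<^sub>M i\<in>I. M) (\<lambda>x. \<Prod>j\<in>J. f j (x j))"
    and "(\<integral>x. (\<Prod>j\<in>J. f j (x j)) \<partial>(\<Pi>\<^sub>M i\<in>I. M)) = (\<Prod>j\<in>J. \<integral>y. f j y \<partial>M)"
proof -
  interpret M: prob_space M by fact
  interpret product_sigma_finite "\<lambda>_. M" ..
  define g where "g j = (if j \<in> J then f j else (\<lambda>_. 1))" for j
  have g: "integrable M (g i)" for i using f by (auto simp: g_def)
  have eq: "(\<Prod>j\<in>J. f j (x j)) = (\<Prod>i\<in>I. g i (x i))" for x :: "'i \<Rightarrow> 'a"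
    using assms(2,3) by (intro prod.mono_neutral_cong_left) (auto simp: g_def)
  show "integrable (\<Pi>\<^sub>M i\<in>I. M) (\<lambda>x. \<Prod>j\<in>J. f j (x j))"
    unfolding eq using assms(2) g by (intro product_integrable_prod)
  have "(\<integral>x. (\<Prod>j\<in>J. f j (x j)) \<partial>(\<Pi>\<^sub>M i\<in>I. M)) = (\<Prod>i\<in>I. \<integral>y. g i y \<partial>M)"
    unfolding eq using assms(2) g by (intro product_integral_prod)
  also have "\<dots> = (\<Prod>j\<in>J. \<integral>y. f j y \<partial>M)"
    using assms(2,3) by (intro prod.mono_neutral_cong_right) (auto simp: g_def M.prob_space)
  finally show "(\<integral>x. (\<Prod>j\<in>J. f j (x j)) \<partial>(\<Pi>\<^sub>M i\<in>I. M)) = (\<Prod>j\<in>J. \<integral>y. f j y \<partial>M)" .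
qed

lemma PiM_expectation_single:
  fixes f :: "'a \<Rightarrow> real"
  assumes "prob_space M" "finite I" "i \<in> I" "integrable M f"
  shows "integrable (\<Pi>\<^sub>M i\<in>I. M) (\<lambda>x. f (x i))"
    and "(\<integral>x. f (x i) \<partial>(\<Pi>\<^sub>M i\<in>I. M)) = (\<integral>y. f y \<partial>M)"
proof -
  have "{i} \<subseteq> I" "\<And>k. k \<in> {i} \<Longrightarrow> integrable M f" using assms by auto
  note * = PiM_expectation_prod[where f="\<lambda>_. f", OF assms(1,2) this]
  have "integrable (\<Pi>\<^sub>M i\<in>I. M) (\<lambda>x. \<Prod>j\<in>{i}. f (x j))" by (rule *)
  then show "integrable (\<Pi>\<^sub>M i\<in>I. M) (\<lambda>x. f (x i))" by simp
  have "(\<integral>x. (\<Prod>j\<in>{i}. f (x j)) \<partial>(\<Pi>\<^sub>M i\<in>I. M)) = (\<Prod>j\<in>{i}. \<integral>y. f y \<partial>M)" by (rule *)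
  then show "(\<integral>x. f (x i) \<partial>(\<Pi>\<^sub>M i\<in>I. M)) = (\<integral>y. f y \<partial>M)" by simp
qed

lemma PiM_expectation_pair:
  fixes f g :: "'a \<Rightarrow> real"
  assumes "prob_space M" "finite I" "i \<in> I" "j \<in> I" "i \<noteq> j" "integrable M f" "integrable M g"
  shows "integrable (\<Pi>\<^sub>M i\<in>I. M) (\<lambda>x. f (x i) * g (x j))"
    and "(\<integral>x. f (x i) * g (x j) \<partial>(\<Pi>\<^sub>M i\<in>I. M)) = (\<integral>y. f y \<partial>M) * (\<integral>y. g y \<partial>M)"
proof -
  define h where "h k = (if k = i then f else g)" for k
  have h: "(\<Prod>k\<in>{i, j}. h k (x k)) = f (x i) * g (x j)" "(\<Prod>k\<in>{i, j}. \<integral>y. h k y \<partial>M) = (\<integral>y. f y \<partial>M) * (\<integral>y. g y \<partial>M)" for x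
    using assms(5) by (simp_all add: h_def)
  have "{i, j} \<subseteq> I" "\<And>k. k \<in> {i, j} \<Longrightarrow> integrable M (h k)" using assms by (auto simp: h_def)
  note * = PiM_expectation_prod[where f=h, OF assms(1,2) this, unfolded h]
  from * show "integrable (\<Pi>\<^sub>M i\<in>I. M) (\<lambda>x. f (x i) * g (x j))"
    "(\<integral>x. f (x i) * g (x j) \<partial>(\<Pi>\<^sub>M i\<in>I. M)) = (\<integral>y. f y \<partial>M) * (\<integral>y. g y \<partial>M)" by blast+
qed

context prob_space
begin

lemma expectation_sum_orthogonal_square:
  fixes \<zeta> :: "'i \<Rightarrow> 'a \<Rightarrow> real"
  assumes I: "finite I"
    and int: "\<And>i j. i \<in> I \<Longrightarrow> j \<in> I \<Longrightarrow> integrable M (\<lambda>x. \<zeta> i x * \<zeta> j x)"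
    and orth: "\<And>i j. i \<in> I \<Longrightarrow> j \<in> I \<Longrightarrow> i \<noteq> j \<Longrightarrow> expectation (\<lambda>x. \<zeta> i x * \<zeta> j x) = 0"
  shows "integrable M (\<lambda>x. (\<Sum>i\<in>I. c i * \<zeta> i x)\<^sup>2)"
    and "expectation (\<lambda>x. (\<Sum>i\<in>I. c i * \<zeta> i x)\<^sup>2) = (\<Sum>i\<in>I. (c i)\<^sup>2 * expectation (\<lambda>x. (\<zeta> i x)\<^sup>2))"
proof -
  have eq: "(\<Sum>i\<in>I. c i * \<zeta> i x)\<^sup>2 = (\<Sum>i\<in>I. \<Sum>j\<in>I. c i * c j * (\<zeta> i x * \<zeta> j x))" for x
    by (simp add: power2_eq_square sum_product mult_ac)
  show "integrable M (\<lambda>x. (\<Sum>i\<in>I. c i * \<zeta> i x)\<^sup>2)"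
    unfolding eq using int by (intro Bochner_Integration.integrable_sum integrable_mult_right)
  have "expectation (\<lambda>x. (\<Sum>i\<in>I. c i * \<zeta> i x)\<^sup>2) =
    (\<Sum>i\<in>I. \<Sum>j\<in>I. c i * c j * expectation (\<lambda>x. \<zeta> i x * \<zeta> j x))"
    unfolding eq using int
    by (simp add: Bochner_Integration.integral_sum Bochner_Integration.integrable_sum integrable_mult_right)
  also have "\<dots> = (\<Sum>i\<in>I. \<Sum>j\<in>I. if j = i then (c i)\<^sup>2 * expectation (\<lambda>x. (\<zeta> i x)\<^sup>2) else 0)"
    by (intro sum.cong refl) (simp add: orth power2_eq_square)
  also have "\<dots> = (\<Sum>i\<in>I. (c i)\<^sup>2 * expectation (\<lambda>x. (\<zeta> i x)\<^sup>2))"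
    using I by simp
  finally show "expectation (\<lambda>x. (\<Sum>i\<in>I. c i * \<zeta> i x)\<^sup>2) = (\<Sum>i\<in>I. (c i)\<^sup>2 * expectation (\<lambda>x. (\<zeta> i x)\<^sup>2))" .
qed

text \<open>Jensen's inequality in the form that the variance of \<open>\<bar>X x\<bar>\<close> is
  nonnegative.\<close>

lemma expectation_abs_le_sqrt:
  assumes X: "X \<in> borel_measurable M" and int: "integrable M (\<lambda>x. (X x)\<^sup>2)"
  shows "integrable M X" and "expectation (\<lambda>x. \<bar>X x\<bar>) \<le> sqrt (expectation (\<lambda>x. (X x)\<^sup>2))"
proof -
  show iX: "integrable M X" by (rule square_integrable_imp_integrable[OF X int])
  have "(expectation (\<lambda>x. \<bar>X x\<bar>))\<^sup>2 \<le> expectation (\<lambda>x. (X x)\<^sup>2)"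
    using variance_positive[of "\<lambda>x. \<bar>X x\<bar>"] variance_eq[of "\<lambda>x. \<bar>X x\<bar>"] iX int by simp
  then show "expectation (\<lambda>x. \<bar>X x\<bar>) \<le> sqrt (expectation (\<lambda>x. (X x)\<^sup>2))"
    by (rule real_le_rsqrt)
qed

text \<open>Mean absolute values are estimated through second moments because cross terms then
  vanish: a sum of D terms of equal size grows like the square root of D.\<close>

lemma expectation_abs_sum_orthogonal:
  fixes \<zeta> :: "'i \<Rightarrow> 'a \<Rightarrow> real"
  assumes I: "finite I"
    and meas: "\<And>i. i \<in> I \<Longrightarrow> \<zeta> i \<in> borel_measurable M"
    and int: "\<And>i j. i \<in> I \<Longrightarrow> j \<in> I \<Longrightarrow> integrable M (\<lambda>x. \<zeta> i x * \<zeta> j x)"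
    and orth: "\<And>i j. i \<in> I \<Longrightarrow> j \<in> I \<Longrightarrow> i \<noteq> j \<Longrightarrow> expectation (\<lambda>x. \<zeta> i x * \<zeta> j x) = 0"
    and K: "\<And>i. i \<in> I \<Longrightarrow> expectation (\<lambda>x. (\<zeta> i x)\<^sup>2) \<le> K"
  shows "integrable M (\<lambda>x. \<Sum>i\<in>I. c i * \<zeta> i x)"
    and "expectation (\<lambda>x. \<bar>\<Sum>i\<in>I. c i * \<zeta> i x\<bar>) \<le> sqrt (K * (\<Sum>i\<in>I. (c i)\<^sup>2))"
proof -
  have sq: "integrable M (\<lambda>x. (\<Sum>i\<in>I. c i * \<zeta> i x)\<^sup>2)"
    "expectation (\<lambda>x. (\<Sum>i\<in>I. c i * \<zeta> i x)\<^sup>2) = (\<Sum>i\<in>I. (c i)\<^sup>2 * expectation (\<lambda>x. (\<zeta> i x)\<^sup>2))"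
    by (intro expectation_sum_orthogonal_square I int orth; assumption)+
  have m: "(\<lambda>x. \<Sum>i\<in>I. c i * \<zeta> i x) \<in> borel_measurable M" using meas by measurable
  show "integrable M (\<lambda>x. \<Sum>i\<in>I. c i * \<zeta> i x)"
    by (rule expectation_abs_le_sqrt(1)[OF m sq(1)])
  have "expectation (\<lambda>x. \<bar>\<Sum>i\<in>I. c i * \<zeta> i x\<bar>) \<le> sqrt (expectation (\<lambda>x. (\<Sum>i\<in>I. c i * \<zeta> i x)\<^sup>2))"
    by (rule expectation_abs_le_sqrt(2)[OF m sq(1)])
  also have "\<dots> \<le> sqrt (\<Sum>i\<in>I. (c i)\<^sup>2 * K)"
    unfolding sq(2) by (intro real_sqrt_le_mono sum_mono mult_left_mono K) auto
  finally show "expectation (\<lambda>x. \<bar>\<Sum>i\<in>I. c i * \<zeta> i x\<bar>) \<le> sqrt (K * (\<Sum>i\<in>I. (c i)\<^sup>2))"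
    by (simp add: sum_distrib_left mult.commute)
qed

end

lemma PiM_weak_law:
  fixes g :: "'a \<Rightarrow> real"
  assumes M: "prob_space M" and [measurable]: "g \<in> borel_measurable M" and g2: "integrable M (\<lambda>y. (g y)\<^sup>2)"
    and D: "1 \<le> D" and e: "0 < e"
  shows "measure (\<Pi>\<^sub>M d\<in>{1..D}. M) {y \<in> space (\<Pi>\<^sub>M d\<in>{1..D}. M). e \<le> \<bar>(\<Sum>d=1..D. g (y d)) / real D - (\<integral>y. g y \<partial>M)\<bar>}
    \<le> (\<integral>y. (g y - (\<integral>y. g y \<partial>M))\<^sup>2 \<partial>M) / (real D * e\<^sup>2)"
proof -
  interpret M: prob_space M by fact
  let ?P = "\<Pi>\<^sub>M d\<in>{1..D}. M"
  interpret P: prob_space ?P by (rule prob_space_PiM) (rule M)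
  define m where "m = (\<integral>y. g y \<partial>M)"
  have gi: "integrable M g" by (rule M.square_integrable_imp_integrable[OF _ g2]) measurable
  have g0i: "integrable M (\<lambda>y. g y - m)" using gi by simp
  have g02i: "integrable M (\<lambda>y. (g y - m)\<^sup>2)" using g2 gi by (simp add: power2_diff)
  have g00: "(\<integral>y. g y - m \<partial>M) = 0" using gi by (simp add: m_def M.prob_space)
  note pair = PiM_expectation_pair[OF M finite_atLeastAtMost _ _ _ g0i g0i, of _ 1 D]
  note single = PiM_expectation_single[OF M finite_atLeastAtMost _ g02i, of _ 1 D]
  have int: "integrable ?P (\<lambda>y. (g (y i) - m) * (g (y j) - m))" if "i \<in> {1..D}" "j \<in> {1..D}" for i j
    using pair(1)[OF that] single(1)[OF that(1)] by (cases "i = j") (auto simp: power2_eq_square)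
  have orth: "(\<integral>y. (g (y i) - m) * (g (y j) - m) \<partial>?P) = 0" if "i \<in> {1..D}" "j \<in> {1..D}" "i \<noteq> j" for i j
    using pair(2)[OF that] g00 by simp
  define X where "X y = (\<Sum>d=1..D. (1 / real D) * (g (y d) - m))" for y
  have X: "X y = (\<Sum>d=1..D. g (y d)) / real D - m" for y
    using D by (simp add: X_def sum_subtractf diff_divide_distrib sum_divide_distrib)
  have [measurable]: "X \<in> borel_measurable ?P"
    unfolding X_def by measurable
  have EX: "(\<integral>y. (X y)\<^sup>2 \<partial>?P) = (\<integral>y. (g y - m)\<^sup>2 \<partial>M) / real D"
  proof -
    have "(\<integral>y. (X y)\<^sup>2 \<partial>?P) = (\<Sum>d=1..D. (1 / real D)\<^sup>2 * (\<integral>y. (g y - m)\<^sup>2 \<partial>M))"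
      unfolding X_def
      by (subst P.expectation_sum_orthogonal_square(2)[where \<zeta>="\<lambda>d y. g (y d) - m", OF _ int orth]) (auto intro!: sum.cong simp: single(2))
    then show ?thesis using D by (simp add: power2_eq_square)
  qed
  have iX: "integrable ?P (\<lambda>y. (X y)\<^sup>2)"
    unfolding X_def by (rule P.expectation_sum_orthogonal_square(1)[where \<zeta>="\<lambda>d y. g (y d) - m", OF _ int orth]) auto
  have "measure ?P {y \<in> space ?P. e \<le> \<bar>X y\<bar>} = measure ?P {y \<in> space ?P. e\<^sup>2 \<le> (X y)\<^sup>2}"
  proof -
    have "e \<le> \<bar>X y\<bar> \<longleftrightarrow> e\<^sup>2 \<le> (X y)\<^sup>2" for y
      using abs_le_square_iff[of e "X y"] e by simp
    then show ?thesis by simp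
  qed
  also have "\<dots> \<le> (\<integral>y. (X y)\<^sup>2 \<partial>?P) / e\<^sup>2"
    by (rule integral_Markov_inequality_measure[OF iX sets.empty_sets]) (use e in auto)
  also have "\<dots> = (\<integral>y. (g y - m)\<^sup>2 \<partial>M) / (real D * e\<^sup>2)" by (simp add: EX)
  finally show ?thesis unfolding X m_def .
qed

lemma measurable_component2:
  "i \<in> I \<Longrightarrow> j \<in> J \<Longrightarrow> (\<lambda>x. x i j) \<in> measurable (\<Pi>\<^sub>M i\<in>I. \<Pi>\<^sub>M j\<in>J. M) M"
  by (rule measurable_compose[where f="\<lambda>x. x i" and g="\<lambda>y. y j" and N="\<Pi>\<^sub>M j\<in>J. M"]) auto

text \<open>The target law is indexed by time first, but its independent copies are indexed by the
  component. The restrictions place the image in the space of the product measure.\<close>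

definition transpose_fun :: "nat \<Rightarrow> nat \<Rightarrow> (nat \<Rightarrow> nat \<Rightarrow> real) \<Rightarrow> nat \<Rightarrow> nat \<Rightarrow> real" where
  "transpose_fun T D y = (\<lambda>t\<in>{1..T}. \<lambda>d\<in>{1..D}. y d t)"

lemma transpose_fun_measurable [measurable]:
  "transpose_fun T D \<in> measurable (states D T) (states T D)"
  unfolding transpose_fun_def[abs_def] by (intro measurable_restrict measurable_component2)

section \<open>The target law as a transposed product\<close>

lemma PiE_restrict_eq:
  assumes "\<And>i. i \<in> I \<Longrightarrow> A i \<subseteq> \<Omega> i"
  shows "{f \<in> Pi\<^sub>E I \<Omega>. \<forall>i\<in>I. f i \<in> A i} = Pi\<^sub>E I A"
  using assms by (auto simp: PiE_iff extensional_def)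

text \<open>Uniqueness of measures calls for an intersection-stable generator that transposition
  respects. Rectangles with arbitrary measurable inner sides are not mapped to rectangles; double
  rectangles are.\<close>

lemma sets_PiM_PiM_lborel:
  fixes T D :: nat
  shows "sets (states T D) =
    sigma_sets (\<Pi>\<^sub>E t\<in>{1..T}. \<Pi>\<^sub>E d\<in>{1..D}. UNIV)
      {(\<Pi>\<^sub>E t\<in>{1..T}. \<Pi>\<^sub>E d\<in>{1..D}. B t d) |B. \<forall>t\<in>{1..T}. \<forall>d\<in>{1..D}. B t d \<in> sets (lborel :: real measure)}" (is "_ = sigma_sets ?\<Omega> ?G")
proof -
  define E where "E = {(\<Pi>\<^sub>E d\<in>{1..D}. A d) |A. \<forall>d\<in>{1..D}. A d \<in> sets (lborel :: real measure)}"
  define \<Omega> where "\<Omega> = (\<Pi>\<^sub>E d\<in>{1..D}. UNIV :: real set)"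
  have E: "E \<subseteq> Pow \<Omega>" by (auto simp: E_def \<Omega>_def)
  have \<Omega>E: "\<Omega> \<in> E" unfolding E_def \<Omega>_def by (intro CollectI exI[of _ "\<lambda>_. UNIV"]) auto
  have "sets (leb D) = sets (sigma \<Omega> E)"
  proof (rule antisym)
    have "sets (leb D) = sigma_sets \<Omega>
        {(\<Pi>\<^sub>E i\<in>{1..D}. X i) |X. (\<forall>i. X i \<in> sets (lborel :: real measure)) \<and> finite {i. X i \<noteq> space lborel}}"
      unfolding sets_PiM_finite \<Omega>_def by simp
    also have "\<dots> \<subseteq> sigma_sets \<Omega> E"
      by (rule sigma_sets_mono') (auto simp: E_def)
    finally show "sets (leb D) \<subseteq> sets (sigma \<Omega> E)" using E by simp
    have "E \<subseteq> sets (leb D)"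
      unfolding E_def by (auto intro!: sets_PiM_I_finite)
    then have "sigma_sets \<Omega> E \<subseteq> sets (leb D)"
      using sets.sigma_sets_subset[of E "leb D"] by (simp add: space_PiM \<Omega>_def)
    then show "sets (sigma \<Omega> E) \<subseteq> sets (leb D)" using E by simp
  qed
  then have "sets (states T D) = sets (\<Pi>\<^sub>M t\<in>{1..T}. sigma \<Omega> E)"
    by (intro sets_PiM_cong) auto
  also have "\<dots> = sets (sigma (\<Pi>\<^sub>E t\<in>{1..T}. \<Omega>)
      {{f \<in> (\<Pi>\<^sub>E i\<in>{1..T}. \<Omega>). \<forall>i\<in>j. f i \<in> A i} | A j. j \<in> {{1..T}} \<and> A \<in> Pi j (\<lambda>_. E)})"
    \<comment> \<open>\<open>{\<Omega>}\<close> is the countable cover by generators that each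
      factor has to possess.\<close>
    by (rule sets_PiM_sigma) (use E \<Omega>E in \<open>auto intro!: exI[of _ "{\<Omega>}"]\<close>)
  also have "{{f \<in> (\<Pi>\<^sub>E i\<in>{1..T}. \<Omega>). \<forall>i\<in>j. f i \<in> A i} | A j. j \<in> {{1..T}} \<and> A \<in> Pi j (\<lambda>_. E)} = ?G" (is "?P = ?G")
  proof (intro set_eqI iffI)
    fix Z assume "Z \<in> ?P"
    then obtain A where A: "A \<in> {1..T} \<rightarrow> E" and Z: "Z = {f \<in> (\<Pi>\<^sub>E i\<in>{1..T}. \<Omega>). \<forall>i\<in>{1..T}. f i \<in> A i}" by auto
    have "\<forall>t\<in>{1..T}. \<exists>B. A t = (\<Pi>\<^sub>E d\<in>{1..D}. B d) \<and> (\<forall>d\<in>{1..D}. B d \<in> sets (lborel :: real measure))"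
      using A by (auto simp: E_def Pi_iff)
    then obtain B where B: "\<forall>t\<in>{1..T}. A t = (\<Pi>\<^sub>E d\<in>{1..D}. B t d) \<and> (\<forall>d\<in>{1..D}. B t d \<in> sets (lborel :: real measure))"
      by (metis bchoice)
    have "Z = (\<Pi>\<^sub>E t\<in>{1..T}. A t)"
      unfolding Z by (rule PiE_restrict_eq) (use A E in blast)
    also have "\<dots> = (\<Pi>\<^sub>E t\<in>{1..T}. \<Pi>\<^sub>E d\<in>{1..D}. B t d)" using B by (intro PiE_cong) auto
    finally show "Z \<in> ?G" using B by blast
  next
    fix Z assume "Z \<in> ?G"
    then obtain B where Z: "Z = (\<Pi>\<^sub>E t\<in>{1..T}. \<Pi>\<^sub>E d\<in>{1..D}. B t d)"
      and B: "\<forall>t\<in>{1..T}. \<forall>d\<in>{1..D}. B t d \<in> sets (lborel :: real measure)" by auto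
    have "Z = {f \<in> (\<Pi>\<^sub>E i\<in>{1..T}. \<Omega>). \<forall>i\<in>{1..T}. f i \<in> (\<Pi>\<^sub>E d\<in>{1..D}. B i d)}"
      unfolding Z \<Omega>_def by (intro PiE_restrict_eq[symmetric] PiE_mono subset_UNIV)
    moreover have "(\<lambda>i. \<Pi>\<^sub>E d\<in>{1..D}. B i d) \<in> {1..T} \<rightarrow> E" using B by (auto simp: E_def)
    ultimately show "Z \<in> ?P"
      by (intro CollectI exI[of _ "\<lambda>i. \<Pi>\<^sub>E d\<in>{1..D}. B i d"] exI[of _ "{1..T}"] conjI singletonI)
  qed
  also have "sets (sigma (\<Pi>\<^sub>E t\<in>{1..T}. \<Omega>) ?G) = sigma_sets (\<Pi>\<^sub>E t\<in>{1..T}. \<Omega>) ?G"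
  proof (rule sets_measure_of)
    show "?G \<subseteq> Pow (\<Pi>\<^sub>E t\<in>{1..T}. \<Omega>)"
    proof
      fix X assume "X \<in> ?G"
      then obtain B where X: "X = (\<Pi>\<^sub>E t\<in>{1..T}. \<Pi>\<^sub>E d\<in>{1..D}. B t d)" by blast
      show "X \<in> Pow (\<Pi>\<^sub>E t\<in>{1..T}. \<Omega>)"
        unfolding X \<Omega>_def by (intro PowI PiE_mono subset_UNIV)
    qed
  qed
  finally show ?thesis by (simp only: \<Omega>_def)
qed

text \<open>On double rectangles both sides are a double product of side lengths, and the two
  products commute. Growing cubes exhaust the space by sets of finite measure.\<close>

lemma distr_transpose_lborel:
  "distr (states D T) (states T D) (transpose_fun T D)
    = (states T D)" (is "distr ?P ?Q _ = _")
proof -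
  interpret L: product_sigma_finite "\<lambda>_::nat. lborel :: real measure" ..
  have sf: "sigma_finite_measure (\<Pi>\<^sub>M d\<in>{1..n}. lborel :: real measure)" for n :: nat
    by (rule L.sigma_finite) simp
  interpret LT: product_sigma_finite "\<lambda>_::nat. \<Pi>\<^sub>M t\<in>{1..T}. lborel :: real measure"
    by (simp add: product_sigma_finite_def sf)
  interpret LD: product_sigma_finite "\<lambda>_::nat. leb D"
    by (simp add: product_sigma_finite_def sf)
  let ?\<Omega> = "\<Pi>\<^sub>E t\<in>{1..T}. \<Pi>\<^sub>E d\<in>{1..D}. UNIV :: real set"
  let ?R = "\<lambda>B. \<Pi>\<^sub>E t\<in>{1..T}. \<Pi>\<^sub>E d\<in>{1..D}. B t d :: real set"
  let ?G = "{?R B |B. \<forall>t\<in>{1..T}. \<forall>d\<in>{1..D}. B t d \<in> sets (lborel :: real measure)}"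
  have GI: "?R B \<in> ?G" if "\<forall>t\<in>{1..T}. \<forall>d\<in>{1..D}. B t d \<in> sets (lborel :: real measure)" for B
    by (intro CollectI exI[of _ B] conjI refl that)
  have emQ: "emeasure ?Q (?R B) = (\<Prod>t=1..T. \<Prod>d=1..D. emeasure lborel (B t d))"
    if B: "\<forall>t\<in>{1..T}. \<forall>d\<in>{1..D}. B t d \<in> sets (lborel :: real measure)" for B
    using B by (subst LD.emeasure_PiM) (auto intro!: prod.cong L.emeasure_PiM sets_PiM_I_finite)
  have emP: "emeasure (distr ?P ?Q (transpose_fun T D)) (?R B) = (\<Prod>t=1..T. \<Prod>d=1..D. emeasure lborel (B t d))"
    if B: "\<forall>t\<in>{1..T}. \<forall>d\<in>{1..D}. B t d \<in> sets (lborel :: real measure)" for B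
  proof -
    have "emeasure (distr ?P ?Q (transpose_fun T D)) (?R B) = emeasure ?P (transpose_fun T D -` ?R B \<inter> space ?P)"
      using B by (intro emeasure_distr transpose_fun_measurable) (auto intro!: sets_PiM_I_finite)
    also have "transpose_fun T D -` ?R B \<inter> space ?P = (\<Pi>\<^sub>E d\<in>{1..D}. \<Pi>\<^sub>E t\<in>{1..T}. B t d)"
      by (auto simp: space_PiM transpose_fun_def PiE_iff)
    also have "emeasure ?P \<dots> = (\<Prod>d=1..D. \<Prod>t=1..T. emeasure lborel (B t d))"
      using B by (subst LT.emeasure_PiM) (auto intro!: prod.cong L.emeasure_PiM sets_PiM_I_finite)
    also have "\<dots> = (\<Prod>t=1..T. \<Prod>d=1..D. emeasure lborel (B t d))" by (rule prod.swap)
    finally show ?thesis .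
  qed
  define A where "A n = ?R (\<lambda>_ _. {- real n..real n})" for n :: nat
  show ?thesis
  proof (rule measure_eqI_generator_eq[of ?G ?\<Omega> _ _ A])
    show "Int_stable ?G"
    proof (rule Int_stableI)
      fix X Y assume XY: "X \<in> ?G" "Y \<in> ?G"
      from XY(1) obtain B where B: "X = ?R B" "\<forall>t\<in>{1..T}. \<forall>d\<in>{1..D}. B t d \<in> sets (lborel :: real measure)"
        by blast
      from XY(2) obtain C where C: "Y = ?R C" "\<forall>t\<in>{1..T}. \<forall>d\<in>{1..D}. C t d \<in> sets (lborel :: real measure)"
        by blast
      from B(1) C(1) have "X \<inter> Y = ?R (\<lambda>t d. B t d \<inter> C t d)" by (simp add: PiE_Int)
      moreover have "?R (\<lambda>t d. B t d \<inter> C t d) \<in> ?G" by (intro GI ballI sets.Int B(2)[rule_format] C(2)[rule_format])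
      ultimately show "X \<inter> Y \<in> ?G" by (simp only:)
    qed
    have sub: "?R B \<subseteq> ?\<Omega>" for B by (intro PiE_mono subset_UNIV)
    then show "?G \<subseteq> Pow ?\<Omega>" by blast
    show "emeasure (distr ?P ?Q (transpose_fun T D)) X = emeasure ?Q X" if "X \<in> ?G" for X
    proof -
      from that obtain B where "X = ?R B" "\<forall>t\<in>{1..T}. \<forall>d\<in>{1..D}. B t d \<in> sets (lborel :: real measure)" by blast
      then show ?thesis using emP[of B] emQ[of B] by simp
    qed
    show "sets (distr ?P ?Q (transpose_fun T D)) = sigma_sets ?\<Omega> ?G" "sets ?Q = sigma_sets ?\<Omega> ?G"
      by (simp_all only: sets_PiM_PiM_lborel sets_distr)
    have "A n \<in> ?G" for n unfolding A_def by (intro GI ballI) simp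
    then show "range A \<subseteq> ?G" by (rule image_subsetI)
    show "(\<Union>n. A n) = ?\<Omega>"
    proof (intro antisym subsetI)
      fix x assume x: "x \<in> ?\<Omega>"
      \<comment> \<open>One bound for all coordinates: each \<open>\<bar>x t d\<bar>\<close> is at
        most the total sum.\<close>
      define n where "n = nat \<lceil>\<Sum>t=1..T. \<Sum>d=1..D. \<bar>x t d\<bar>\<rceil>"
      have "\<bar>x t d\<bar> \<le> real n" if "t \<in> {1..T}" "d \<in> {1..D}" for t d
      proof -
        have "\<bar>x t d\<bar> \<le> (\<Sum>d=1..D. \<bar>x t d\<bar>)" by (rule member_le_sum[OF that(2)]) auto
        also have "\<dots> \<le> (\<Sum>t=1..T. \<Sum>d=1..D. \<bar>x t d\<bar>)"
          by (rule member_le_sum[OF that(1), of "\<lambda>t. \<Sum>d=1..D. \<bar>x t d\<bar>"]) (auto simp: sum_nonneg)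
        also have "\<dots> \<le> real n" unfolding n_def by linarith
        finally show ?thesis .
      qed
      then have "x \<in> A n" using x by (auto simp: A_def PiE_iff abs_le_iff minus_le_iff)
      then show "x \<in> (\<Union>n. A n)" by blast
    next
      fix x assume "x \<in> (\<Union>n. A n)"
      then obtain n where "x \<in> A n" by blast
      then show "x \<in> ?\<Omega>" using sub unfolding A_def by (rule subsetD[rotated])
    qed
    show "emeasure (distr ?P ?Q (transpose_fun T D)) (A n) \<noteq> \<infinity>" for n
      using emP[of "\<lambda>_ _. {- real n..real n}"] unfolding A_def by (simp add: ennreal_power)
  qed
qed

text \<open>Tested on rectangles, where density and indicator both factor over the
  coordinates.\<close>

lemma PiM_density:
  fixes p :: "'a \<Rightarrow> ennreal"
  assumes M: "sigma_finite_measure M" and p: "p \<in> borel_measurable M" and I: "finite I"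
    and prob: "prob_space (density M p)"
  shows "(\<Pi>\<^sub>M i\<in>I. density M p) = density (\<Pi>\<^sub>M i\<in>I. M) (\<lambda>x. \<Prod>i\<in>I. p (x i))"
proof -
  interpret sigma_finite_measure M by fact
  interpret P: prob_space "density M p" by fact
  interpret A: product_sigma_finite "\<lambda>_. density M p" ..
  interpret B: product_sigma_finite "\<lambda>_. M" ..
  show ?thesis
  proof (rule A.PiM_eqI[symmetric, OF I])
    show "sets (density (\<Pi>\<^sub>M i\<in>I. M) (\<lambda>x. \<Prod>i\<in>I. p (x i))) = sets (\<Pi>\<^sub>M i\<in>I. density M p)"
      by (simp cong: sets_PiM_cong)
    fix A assume "\<And>i. i \<in> I \<Longrightarrow> A i \<in> sets (density M p)"
    then have A: "\<And>i. i \<in> I \<Longrightarrow> A i \<in> sets M" by simp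
    have "emeasure (density (\<Pi>\<^sub>M i\<in>I. M) (\<lambda>x. \<Prod>i\<in>I. p (x i))) (Pi\<^sub>E I A) =
      (\<integral>\<^sup>+x. (\<Prod>i\<in>I. p (x i)) * indicator (Pi\<^sub>E I A) x \<partial>(\<Pi>\<^sub>M i\<in>I. M))"
    proof (rule emeasure_density)
      show "Pi\<^sub>E I A \<in> sets (\<Pi>\<^sub>M i\<in>I. M)" by (rule sets_PiM_I_finite[OF I A])
      show "(\<lambda>x. \<Prod>i\<in>I. p (x i)) \<in> borel_measurable (\<Pi>\<^sub>M i\<in>I. M)"
      proof (rule borel_measurable_prod_ennreal)
        show "(\<lambda>x. p (x i)) \<in> borel_measurable (\<Pi>\<^sub>M i\<in>I. M)" if "i \<in> I" for i
          using measurable_compose[OF measurable_component_singleton[OF that, of "\<lambda>_. M"] p] .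
      qed
    qed
    also have "\<dots> = (\<integral>\<^sup>+x. (\<Prod>i\<in>I. p (x i) * indicator (A i) (x i)) \<partial>(\<Pi>\<^sub>M i\<in>I. M))"
    proof (rule nn_integral_cong)
      fix x assume "x \<in> space (\<Pi>\<^sub>M i\<in>I. M)"
      then have ext: "x \<in> Pi\<^sub>E I A \<longleftrightarrow> (\<forall>i\<in>I. x i \<in> A i)" by (simp add: space_PiM PiE_iff)
      have "indicator (Pi\<^sub>E I A) x = (\<Prod>i\<in>I. indicator (A i) (x i) :: ennreal)"
      proof (cases "\<forall>i\<in>I. x i \<in> A i")
        case True
        then show ?thesis using ext by simp
      next
        case False
        then obtain i where "i \<in> I" "indicator (A i) (x i) = (0 :: ennreal)" by (auto simp: indicator_def)
        then have "(\<Prod>i\<in>I. indicator (A i) (x i) :: ennreal) = 0" using I by (intro prod_zero) auto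
        then show ?thesis using False ext by simp
      qed
      then show "(\<Prod>i\<in>I. p (x i)) * indicator (Pi\<^sub>E I A) x = (\<Prod>i\<in>I. p (x i) * indicator (A i) (x i))"
        by (simp add: prod.distrib)
    qed
    also have "\<dots> = (\<Prod>i\<in>I. \<integral>\<^sup>+y. p y * indicator (A i) y \<partial>M)"
    proof (rule B.product_nn_integral_prod[OF I])
      show "(\<lambda>y. p y * indicator (A i) y) \<in> borel_measurable M" if "i \<in> I" for i
        using A[OF that] p by (intro borel_measurable_times_ennreal borel_measurable_indicator)
    qed
    also have "\<dots> = (\<Prod>i\<in>I. emeasure (density M p) (A i))"
      by (intro prod.cong refl emeasure_density[symmetric] A p)
    finally show "emeasure (density (\<Pi>\<^sub>M i\<in>I. M) (\<lambda>x. \<Prod>i\<in>I. p (x i))) (Pi\<^sub>E I A) = (\<Prod>i\<in>I. emeasure (density M p) (A i))" .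
  qed
qed

context smooth_target
begin

abbreviation "paths D \<equiv> \<Pi>\<^sub>M d\<in>{1..D}. path_law T p"

lemma sets_PiM_path_law:
  "sets (paths D) = sets (states D T)"
  by (intro sets_PiM_cong refl sets_path_law)

lemma transpose_fun_measurable_path_law:
  "transpose_fun T D \<in> measurable (paths D) (states T D)"
  unfolding measurable_cong_sets[OF sets_PiM_path_law refl] by (rule transpose_fun_measurable)

lemma on_coords_transpose_fun:
  assumes "on_coords T g" "d \<in> {1..D}"
  shows "g (\<lambda>t. transpose_fun T D y t d) = g (y d)"
  unfolding transpose_fun_def by (rule on_coordsD[OF assms(1)]) (use assms(2) in simp)

lemma measurable_on_coords_column:
  fixes g :: "(nat \<Rightarrow> real) \<Rightarrow> real" and d :: nat
  assumes "g \<in> borel_measurable (leb T)" "on_coords T g" "d \<in> {1..D}"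
  shows "(\<lambda>x. g (\<lambda>t. x t d)) \<in> borel_measurable (states T D)"
proof -
  have "(\<lambda>x. \<lambda>t\<in>{1..T}. x t d) \<in> measurable (states T D) (leb T)"
    by (intro measurable_restrict measurable_component2 assms(3))
  from measurable_compose[OF this assms(1)]
  have "(\<lambda>x. g (\<lambda>t\<in>{1..T}. x t d)) \<in> borel_measurable (states T D)" .
  moreover have "g (\<lambda>t\<in>{1..T}. x t d) = g (\<lambda>t. x t d)" for x :: "nat \<Rightarrow> nat \<Rightarrow> real"
    by (rule on_coordsD[OF assms(2)]) simp
  ultimately show ?thesis by (simp only:)
qed

text \<open>At a transposed point \<open>target_density\<close> is the product of \<open>p\<close>
  over independent paths. Averages over components under the target thereby become averages of
  independent copies of \<open>path_law T p\<close>.\<close>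

lemma target_law_eq_distr:
  "target_law T p D = distr (paths D) (states T D) (transpose_fun T D)"
proof -
  let ?P = "states D T" and ?Q = "states T D"
  interpret L: product_sigma_finite "\<lambda>_::nat. lborel :: real measure" ..
  have td: "target_density p D \<in> borel_measurable ?Q"
    unfolding target_density_def[abs_def]
    by (rule borel_measurable_prod, rule measurable_on_coords_column[OF p_measurable on])
  have sf: "sigma_finite_measure (leb T)" by (rule L.sigma_finite) simp
  have pm: "(\<lambda>x. ennreal (p x)) \<in> borel_measurable (leb T)"
    by (rule measurable_compose[OF p_measurable measurable_ennreal])
  have "(paths D) = density ?P (\<lambda>y. \<Prod>d=1..D. ennreal (p (y d)))"
    unfolding path_law_def by (rule PiM_density[OF sf pm _ prob[unfolded path_law_def]]) simp
  also have "(\<lambda>y. \<Prod>d=1..D. ennreal (p (y d))) = (\<lambda>y. ennreal (target_density p D (transpose_fun T D y)))"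
  proof
    fix y
    have "target_density p D (transpose_fun T D y) = (\<Prod>d=1..D. p (y d))"
      unfolding target_density_def by (intro prod.cong refl on_coords_transpose_fun[OF on])
    then show "(\<Prod>d=1..D. ennreal (p (y d))) = ennreal (target_density p D (transpose_fun T D y))"
      by (simp add: prod_ennreal less_imp_le[OF pos])
  qed
  finally have "distr (paths D) ?Q (transpose_fun T D) =
    distr (density ?P (\<lambda>y. ennreal (target_density p D (transpose_fun T D y)))) ?Q (transpose_fun T D)" by simp
  also have "\<dots> = density (distr ?P ?Q (transpose_fun T D)) (\<lambda>x. ennreal (target_density p D x))"
    by (rule density_distr[symmetric, OF measurable_compose[OF td measurable_ennreal] transpose_fun_measurable])
  finally show ?thesis unfolding distr_transpose_lborel target_law_def by simp
qed

lemma prob_space_target_law: "prob_space (target_law T p D)"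
proof -
  interpret P: prob_space "paths D" by (rule prob_space_PiM) (rule prob)
  show ?thesis unfolding target_law_eq_distr by (rule P.prob_space_distr[OF transpose_fun_measurable_path_law])
qed

lemma target_law_weak_law:
  fixes g :: "(nat \<Rightarrow> real) \<Rightarrow> real"
  assumes g: "g \<in> borel_measurable (leb T)" and gon: "on_coords T g"
    and g2: "integrable (path_law T p) (\<lambda>y. (g y)\<^sup>2)" and D: "1 \<le> D" and e: "0 < e"
  defines "A \<equiv> {x \<in> space (states T D).
    e \<le> \<bar>(\<Sum>d=1..D. g (\<lambda>t. x t d)) / real D - (\<integral>y. g y \<partial>path_law T p)\<bar>}"
  shows "A \<in> sets (states T D)" (is "_ \<in> sets ?Q")
    and "measure (target_law T p D) A
      \<le> (\<integral>y. (g y - (\<integral>y. g y \<partial>path_law T p))\<^sup>2 \<partial>path_law T p) / (real D * e\<^sup>2)"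
proof -
  define m where "m = (\<integral>y. g y \<partial>path_law T p)"
  have "(\<lambda>x. \<Sum>d=1..D. g (\<lambda>t. x t d)) \<in> borel_measurable ?Q"
    by (rule borel_measurable_sum, rule measurable_on_coords_column[OF g gon])
  then have "(\<lambda>x. \<bar>(\<Sum>d=1..D. g (\<lambda>t. x t d)) / real D - m\<bar>) \<in> borel_measurable ?Q"
    by (intro borel_measurable_abs borel_measurable_diff borel_measurable_divide borel_measurable_const)
  then show A: "A \<in> sets ?Q"
    unfolding A_def m_def[symmetric] by (rule borel_measurable_le[OF borel_measurable_const])
  have "measure (target_law T p D) A = measure (paths D) (transpose_fun T D -` A \<inter> space (paths D))"
    unfolding target_law_eq_distr by (rule measure_distr[OF transpose_fun_measurable_path_law A])
  also have "transpose_fun T D -` A \<inter> space (paths D) =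
    {y \<in> space (paths D). e \<le> \<bar>(\<Sum>d=1..D. g (y d)) / real D - m\<bar>}"
  proof -
    have "(\<Sum>d=1..D. g (\<lambda>t. transpose_fun T D y t d)) = (\<Sum>d=1..D. g (y d))" for y
      by (intro sum.cong refl on_coords_transpose_fun[OF gon])
    moreover have "transpose_fun T D y \<in> space ?Q" for y
      by (simp add: transpose_fun_def space_PiM)
    ultimately show ?thesis unfolding A_def m_def by auto
  qed
  also have "measure (paths D) \<dots> \<le> (\<integral>y. (g y - m)\<^sup>2 \<partial>path_law T p) / (real D * e\<^sup>2)"
    unfolding m_def
    by (rule PiM_weak_law[OF prob _ g2 D e]) (use g in \<open>simp only: measurable_cong_sets[OF sets_path_law refl]\<close>)
  finally show "measure (target_law T p D) A \<le> (\<integral>y. (g y - (\<integral>y. g y \<partial>path_law T p))\<^sup>2 \<partial>path_law T p) / (real D * e\<^sup>2)"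
    unfolding m_def .
qed

end

section \<open>Softmax weights and laws on index vectors\<close>

text \<open>Kept general in the label set: \<open>Psi\<close> is the case of single labels, the EHMM
  selection the case \<open>index_vectors T\<close>.\<close>

definition softmax :: "'k set \<Rightarrow> ('k \<Rightarrow> real) \<Rightarrow> 'k \<Rightarrow> real" where
  "softmax J a k = exp (a k) / (\<Sum>j\<in>J. exp (a j))"

context
  fixes J :: "'k set"
  assumes J: "finite J" "J \<noteq> {}"
begin

lemma softmax_sum_pos: "0 < (\<Sum>j\<in>J. exp (a j :: real))"
  using J by (intro sum_pos) auto

lemma softmax_nonneg: "0 \<le> softmax J a k"
  unfolding softmax_def using softmax_sum_pos[of a] by simp

lemma sum_softmax: "(\<Sum>k\<in>J. softmax J a k) = 1"
  unfolding softmax_def sum_divide_distrib[symmetric] using softmax_sum_pos[of a] by simp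

lemma softmax_le_1:
  assumes "k \<in> J"
  shows "softmax J a k \<le> 1"
  using member_le_sum[OF assms _ J(1), of "softmax J a"] softmax_nonneg sum_softmax by simp

lemma softmax_shift: "softmax J (\<lambda>j. c + a j) k = softmax J a k"
  unfolding softmax_def by (simp add: exp_add sum_distrib_left[symmetric])

text \<open>Moving all exponents by at most \<open>\<delta>\<close> changes numerator and normaliser
  by a factor within \<open>exp \<delta>\<close> each, so a weight shrinks at most by
  \<open>exp (- 2 * \<delta>)\<close>. As weights are at most 1, the loss is at most
  \<open>2 * \<delta>\<close>, whatever the size of \<open>J\<close>.\<close>

lemma softmax_diff_le:
  assumes k: "k \<in> J" and \<delta>: "\<And>j. j \<in> J \<Longrightarrow> \<bar>a j - b j\<bar> \<le> \<delta>"
  shows "softmax J a k - softmax J b k \<le> 2 * \<delta>"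
proof -
  have "(\<Sum>j\<in>J. exp (b j)) \<le> (\<Sum>j\<in>J. exp \<delta> * exp (a j))"
    by (intro sum_mono) (use \<delta> in \<open>fastforce simp: exp_add[symmetric] abs_le_iff\<close>)
  then have s: "(\<Sum>j\<in>J. exp (b j)) \<le> exp \<delta> * (\<Sum>j\<in>J. exp (a j))" by (simp add: sum_distrib_left)
  have e: "exp (- \<delta>) * exp (a k) \<le> exp (b k)"
    using \<delta>[OF k] by (simp add: exp_add[symmetric] abs_le_iff)
  have "exp (- \<delta>) * exp (- \<delta>) * softmax J a k = (exp (- \<delta>) * exp (a k)) / (exp \<delta> * (\<Sum>j\<in>J. exp (a j)))"
    unfolding softmax_def by (simp add: exp_minus field_simps)
  also have "\<dots> \<le> exp (b k) / (\<Sum>j\<in>J. exp (b j))"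
    by (rule frac_le) (use e s softmax_sum_pos[of b] in auto)
  finally have "exp (- 2 * \<delta>) * softmax J a k \<le> softmax J b k"
    by (simp add: softmax_def exp_add[symmetric])
  then have "softmax J a k - softmax J b k \<le> softmax J a k * (1 - exp (- 2 * \<delta>))"
    by (simp add: algebra_simps)
  also have "\<dots> \<le> 1 * (2 * \<delta>)"
  proof (rule mult_mono)
    show "1 - exp (- 2 * \<delta>) \<le> 2 * \<delta>" using exp_ge_add_one_self[of "- 2 * \<delta>"] by simp
    have "0 \<le> \<delta>" using \<delta>[OF k] by simp
    then show "0 \<le> 1 - exp (- 2 * \<delta>)" by simp
  qed (use softmax_le_1[OF k] in auto)
  finally show ?thesis by simp
qed

lemma softmax_lipschitz:
  assumes k: "k \<in> J" and \<delta>: "\<And>j. j \<in> J \<Longrightarrow> \<bar>a j - b j\<bar> \<le> \<delta>"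
  shows "\<bar>softmax J a k - softmax J b k\<bar> \<le> 2 * \<delta>"
  using softmax_diff_le[OF k, of a b \<delta>] softmax_diff_le[OF k, of b a \<delta>] \<delta>
  by (auto simp: abs_le_iff abs_minus_commute)

text \<open>A mixture of laws on a finite set is determined by its expected weights; both index laws
  are brought into this form.\<close>

lemma bind_point_measure:
  fixes w :: "'a \<Rightarrow> 'k \<Rightarrow> real"
  assumes M: "prob_space M" and meas: "\<And>k. k \<in> J \<Longrightarrow> (\<lambda>u. w u k) \<in> borel_measurable M"
    and nn: "\<And>u k. 0 \<le> w u k" and sum1: "\<And>u. (\<Sum>k\<in>J. w u k) = 1"
  defines "B \<equiv> M \<bind> (\<lambda>u. point_measure J (\<lambda>k. ennreal (w u k)))"
  shows "sets B = Pow J" and "prob_space B" and "\<And>k. k \<in> J \<Longrightarrow> measure B {k} = (\<integral>u. w u k \<partial>M)"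
proof -
  interpret M: prob_space M by fact
  let ?K = "\<lambda>u. point_measure J (\<lambda>k. ennreal (w u k))"
  have em: "emeasure (?K u) A = ennreal (\<Sum>k\<in>A. w u k)" if "A \<subseteq> J" for u A
    using J(1) that nn by (simp add: emeasure_point_measure_finite sum_ennreal)
  have pr: "prob_space (?K u)" for u
    by (rule prob_spaceI) (simp add: space_point_measure em sum1)
  have K: "?K \<in> measurable M (subprob_algebra (count_space J))"
  proof (rule measurable_subprob_algebra)
    show "subprob_space (?K u)" for u using pr prob_space_imp_subprob_space by blast
    show "sets (?K u) = sets (count_space J)" for u by (simp add: sets_point_measure)
    fix A assume "A \<in> sets (count_space J)"
    then have A: "A \<subseteq> J" by simp
    have "(\<lambda>u. \<Sum>k\<in>A. w u k) \<in> borel_measurable M"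
      by (intro borel_measurable_sum meas) (use A in auto)
    then show "(\<lambda>u. emeasure (?K u) A) \<in> borel_measurable M"
      unfolding em[OF A] by (rule measurable_compose[OF _ measurable_ennreal])
  qed
  show "sets B = Pow J"
    unfolding B_def by (subst sets_bind[where N="count_space J"]) (auto simp: sets_point_measure M.not_empty)
  show "prob_space B"
    unfolding B_def by (rule M.prob_space_bind[OF _ K]) (simp add: pr)
  show "measure B {k} = (\<integral>u. w u k \<partial>M)" if "k \<in> J" for k
  proof -
    have "measure (?K u) {k} = w u k" for u
      using em[of "{k}" u] that nn by (simp add: Sigma_Algebra.measure_def)
    moreover have "measure B {k} = (\<integral>u. measure (?K u) {k} \<partial>M)"
      unfolding B_def by (rule M.measure_bind[OF K]) (use that in simp)
    ultimately show ?thesis by simp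
  qed
qed

text \<open>Every event is a finite union of atoms. Nonnegativity is read off from the empty event,
  once the supremum is known to range over a bounded set.\<close>

lemma tv_dist_finite:
  assumes P: "prob_space P" "sets P = Pow J" and Q: "prob_space Q" "sets Q = Pow J"
  shows "0 \<le> tv_dist P Q" and "tv_dist P Q \<le> (\<Sum>k\<in>J. \<bar>measure P {k} - measure Q {k}\<bar>)"
proof -
  interpret P: prob_space P by fact
  interpret Q: prob_space Q by fact
  have le: "\<bar>measure P A - measure Q A\<bar> \<le> (\<Sum>k\<in>J. \<bar>measure P {k} - measure Q {k}\<bar>)" if "A \<in> sets P" for A
  proof -
    have A: "A \<subseteq> J" "finite A" using that P(2) J(1) finite_subset by auto
    have "measure P A - measure Q A = (\<Sum>k\<in>A. measure P {k} - measure Q {k})"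
      unfolding sum_subtractf using A P(2) Q(2)
      by (subst P.finite_measure_eq_sum_singleton, simp, blast)
        (subst Q.finite_measure_eq_sum_singleton, simp, blast, simp)
    also have "\<bar>\<dots>\<bar> \<le> (\<Sum>k\<in>A. \<bar>measure P {k} - measure Q {k}\<bar>)" by (rule sum_abs)
    also have "\<dots> \<le> (\<Sum>k\<in>J. \<bar>measure P {k} - measure Q {k}\<bar>)" by (rule sum_mono2) (use A J in auto)
    finally show ?thesis .
  qed
  have "\<bar>measure P {} - measure Q {}\<bar> \<le> tv_dist P Q"
    unfolding tv_dist_def by (rule cSUP_upper) (use le in \<open>auto intro!: bdd_aboveI\<close>)
  then show "0 \<le> tv_dist P Q" by simp
  show "tv_dist P Q \<le> (\<Sum>k\<in>J. \<bar>measure P {k} - measure Q {k}\<bar>)"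
    unfolding tv_dist_def by (rule cSUP_least) (use le in auto)
qed

end

lemma finite_index_vectors: "finite (index_vectors T :: (nat \<Rightarrow> ('n::finite) option) set)"
  unfolding index_vectors_def by (rule finite_PiE) auto

lemma index_vectors_nonempty: "(index_vectors T :: (nat \<Rightarrow> ('n::finite) option) set) \<noteq> {}"
  unfolding index_vectors_def by (simp add: PiE_eq_empty_iff)

text \<open>The increment that belongs to a label; the value 0 at \<open>None\<close> is the
  convention h^0 = 0 for the current state.\<close>

definition pick :: "'n option \<Rightarrow> real^'n \<Rightarrow> real" where
  "pick k v = (case k of None \<Rightarrow> 0 | Some n \<Rightarrow> v $ n)"

definition log_weight :: "nat \<Rightarrow> (nat \<Rightarrow> real^'n) \<Rightarrow> (nat \<Rightarrow> 'n option) \<Rightarrow> real" where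
  "log_weight T V k = (\<Sum>t=1..T. pick (k t) (V t))"

lemma Psi_nonneg: "0 \<le> Psi h k"
  unfolding Psi_def by (intro divide_nonneg_nonneg add_nonneg_nonneg sum_nonneg) auto

lemma Psi_eq_softmax: "Psi h k = softmax UNIV (\<lambda>j. pick j h) k"
  unfolding Psi_def softmax_def pick_def by (simp add: UNIV_option_conv sum.reindex)

text \<open>Distributing the product over the sums turns independent selections at each time into
  one softmax over index vectors with additive exponents, the same form as the EHMM
  selection.\<close>

lemma prod_Psi_eq_softmax:
  "(\<Prod>t=1..T. Psi (V t) (k t)) = softmax (index_vectors T) (log_weight T V) (k :: nat \<Rightarrow> ('n::finite) option)"
  unfolding Psi_eq_softmax softmax_def index_vectors_def log_weight_def
  by (simp add: prod_dividef exp_sum prod_sum_PiE)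

lemma PiM_point_measure_Psi:
  "(\<Pi>\<^sub>M t\<in>{1..T}. point_measure UNIV (\<lambda>k. ennreal (Psi (V t) k))) =
    point_measure (index_vectors T) (\<lambda>k. ennreal (softmax (index_vectors T) (log_weight T V) (k :: nat \<Rightarrow> ('n::finite) option)))"
proof (rule measure_eqI_countable)
  let ?M = "\<lambda>t. point_measure UNIV (\<lambda>k. ennreal (Psi (V t) (k :: 'n option)))"
  have em: "emeasure (?M t) {k} = ennreal (Psi (V t) k)" for t k
    by (simp add: emeasure_point_measure_finite)
  have pr: "prob_space (?M t)" for t
    by (rule prob_spaceI)
      (simp add: space_point_measure emeasure_point_measure_finite sum_ennreal Psi_nonneg,
       simp add: Psi_eq_softmax sum_softmax)
  interpret product_sigma_finite ?M
    unfolding product_sigma_finite_def using pr prob_space_imp_sigma_finite by blast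
  have "sets (\<Pi>\<^sub>M t\<in>{1..T}. ?M t) = sets (\<Pi>\<^sub>M t\<in>{1..T}. count_space (UNIV :: 'n option set))"
    by (intro sets_PiM_cong refl sets_point_measure_count_space)
  also have "\<dots> = Pow (index_vectors T)"
    by (subst count_space_PiM_finite) (auto simp: index_vectors_def)
  finally show "sets (\<Pi>\<^sub>M t\<in>{1..T}. ?M t) = Pow (index_vectors T)" .
  show "sets (point_measure (index_vectors T) (\<lambda>k. ennreal (softmax (index_vectors T) (log_weight T V) (k :: nat \<Rightarrow> 'n option))))
    = Pow (index_vectors T)"
    by (simp add: sets_point_measure)
  show "countable (index_vectors T :: (nat \<Rightarrow> 'n option) set)" by (rule countable_finite[OF finite_index_vectors])
  fix k :: "nat \<Rightarrow> 'n option" assume k: "k \<in> index_vectors T"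
  then have "{k} = (\<Pi>\<^sub>E t\<in>{1..T}. {k t})"
    by (simp add: index_vectors_def PiE_singleton PiE_iff)
  then have "emeasure (\<Pi>\<^sub>M t\<in>{1..T}. ?M t) {k} = (\<Prod>t=1..T. emeasure (?M t) {k t})"
    by (simp only:) (rule emeasure_PiM, simp_all add: sets_point_measure)
  also have "\<dots> = ennreal (\<Prod>t=1..T. Psi (V t) (k t))"
    unfolding em by (rule prod_ennreal) (rule Psi_nonneg)
  finally show "emeasure (\<Pi>\<^sub>M t\<in>{1..T}. ?M t) {k} =
    emeasure (point_measure (index_vectors T) (\<lambda>k. ennreal (softmax (index_vectors T) (log_weight T V) k))) {k}"
    using k by (simp add: emeasure_point_measure_finite finite_index_vectors prod_Psi_eq_softmax)
qed

section \<open>Linear images of the Gaussian noise\<close>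

text \<open>The joint law of the coordinates is the product measure itself, and this is the product
  of its marginals.\<close>

lemma indep_vars_PiM_components:
  assumes M: "prob_space M" and I: "I \<noteq> {}"
  shows "prob_space.indep_vars (\<Pi>\<^sub>M i\<in>I. M) (\<lambda>_. M) (\<lambda>i x. x i) I"
proof -
  interpret P: prob_space "\<Pi>\<^sub>M i\<in>I. M" by (rule prob_space_PiM) (rule M)
  have "distr (\<Pi>\<^sub>M i\<in>I. M) (\<Pi>\<^sub>M i\<in>I. M) (\<lambda>x. \<lambda>i\<in>I. x i) = distr (\<Pi>\<^sub>M i\<in>I. M) (\<Pi>\<^sub>M i\<in>I. M) (\<lambda>x. x)"
    by (rule distr_cong) (auto simp: space_PiM)
  also have "\<dots> = (\<Pi>\<^sub>M i\<in>I. M)" by (rule distr_id)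
  also have "\<dots> = (\<Pi>\<^sub>M i\<in>I. distr (\<Pi>\<^sub>M i\<in>I. M) M (\<lambda>x. x i))"
    by (intro PiM_cong refl distr_PiM_component[symmetric] M)
  finally show ?thesis
    by (subst P.indep_vars_iff_distr_eq_PiM'[OF I]) simp_all
qed

lemma mv_normal_Sigma_cov_eq_gauss: "mv_normal 0 (Sigma_cov :: real^'n::finite^'n) = gauss 1"
  by (simp add: gauss_def)

text \<open>Different \<open>t\<close> use disjoint blocks of the noise, which gives independence.
  Within a block the linear combination is Gaussian with the sum of squared coefficients as variance
  factor, so the limiting law is attained exactly at finite \<open>D\<close>.\<close>

lemma distr_affine_gauss:
  fixes b :: "nat \<Rightarrow> nat \<Rightarrow> real" and \<mu> :: "nat \<Rightarrow> real^'n::finite"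
  assumes T: "1 \<le> T" and c: "\<And>t. t \<in> {1..T} \<Longrightarrow> 0 < c t"
    and b: "\<And>t. t \<in> {1..T} \<Longrightarrow> (\<Sum>d=1..D. (b t d)\<^sup>2) = c t"
  shows "distr (\<Pi>\<^sub>M td\<in>{1..T} \<times> {1..D}. gauss 1) (\<Pi>\<^sub>M t\<in>{1..T}. borel)
      (\<lambda>U. \<lambda>t\<in>{1..T}. \<mu> t + (\<Sum>d=1..D. b t d *\<^sub>R U (t, d))) =
    (\<Pi>\<^sub>M t\<in>{1..T}. mv_normal (\<mu> t) (c t *\<^sub>R Sigma_cov))"
proof -
  let ?I = "{1..T} \<times> {1..D}"
  let ?P = "\<Pi>\<^sub>M td\<in>?I. gauss 1 :: (real^'n) measure"
  have G: "prob_space (gauss 1 :: (real^'n) measure)" by (rule prob_space_gauss) simp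
  interpret P: prob_space ?P by (rule prob_space_PiM) (rule G)
  \<comment> \<open>An empty block would make \<open>c 1\<close> an empty sum, against its
    positivity.\<close>
  have D: "{1..D} \<noteq> {}"
  proof
    assume "{1..D} = {}"
    then have "c 1 = 0" using b[of 1] T by simp
    then show False using c[of 1] T by simp
  qed
  have I: "?I \<noteq> {}" using T D by simp
  let ?K = "\<lambda>t. {t} \<times> {1..D}"
  let ?Y = "\<lambda>t (u :: nat \<times> nat \<Rightarrow> real^'n). \<mu> t + (\<Sum>d=1..D. b t d *\<^sub>R u (t, d))"
  have "P.indep_vars (\<lambda>t. \<Pi>\<^sub>M td\<in>?K t. gauss 1) (\<lambda>t U. restrict (\<lambda>i. U i) (?K t)) {1..T}"
    by (rule P.indep_vars_restrict[OF indep_vars_PiM_components[OF G I]]) (auto simp: disjoint_family_on_def)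
  moreover have "?Y t \<in> measurable (\<Pi>\<^sub>M td\<in>?K t. gauss 1) borel" for t
  proof -
    have "(\<lambda>u. u (t, d)) \<in> borel_measurable (\<Pi>\<^sub>M td\<in>?K t. gauss 1 :: (real^'n) measure)" if "d \<in> {1..D}" for d
    proof -
      have "(\<lambda>u. u (t, d)) \<in> measurable (\<Pi>\<^sub>M td\<in>?K t. gauss 1 :: (real^'n) measure) (gauss 1)"
        by (rule measurable_component_singleton) (use that in simp)
      then show ?thesis unfolding measurable_cong_sets[OF refl sets_gauss] .
    qed
    then show ?thesis
      by (intro borel_measurable_add borel_measurable_const borel_measurable_sum borel_measurable_scaleR)
  qed
  ultimately have "P.indep_vars (\<lambda>_. borel) (\<lambda>t U. ?Y t (restrict (\<lambda>i. U i) (?K t))) {1..T}"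
    by (rule P.indep_vars_compose2)
  moreover have "?Y t (restrict (\<lambda>i. U i) (?K t)) = ?Y t U" for t U
    by (intro arg_cong2[of _ _ _ _ "(+)"] sum.cong refl) simp
  ultimately have ind: "P.indep_vars (\<lambda>_. borel) ?Y {1..T}" by (simp only:)
  have meas: "?Y t \<in> borel_measurable ?P" if "t \<in> {1..T}" for t
    using ind that unfolding P.indep_vars_def by blast
  have "distr ?P (\<Pi>\<^sub>M t\<in>{1..T}. borel) (\<lambda>U. \<lambda>t\<in>{1..T}. ?Y t U) = (\<Pi>\<^sub>M t\<in>{1..T}. distr ?P borel (?Y t))"
  proof (rule P.indep_vars_iff_distr_eq_PiM'[THEN iffD1, OF _ _ ind])
    show "{1..T} \<noteq> {}" using T by simp
  qed (rule meas)
  also have "\<dots> = (\<Pi>\<^sub>M t\<in>{1..T}. mv_normal (\<mu> t) (c t *\<^sub>R Sigma_cov))"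
  proof (rule PiM_cong[OF refl])
    fix t assume t: "t \<in> {1..T}"
    show "distr ?P borel (?Y t) = mv_normal (\<mu> t) (c t *\<^sub>R Sigma_cov)"
    proof (rule measure_eqI)
      fix A assume "A \<in> sets (distr ?P borel (?Y t))"
      then have A: "A \<in> sets borel" by simp
      \<comment> \<open>Zero coefficients outside block \<open>t\<close> express the block sum as a
        sum over the whole noise.\<close>
      define a where "a i = (if fst i = t then b t (snd i) else 0)" for i :: "nat \<times> nat"
      have s1: "(\<Sum>i\<in>?I. a i *\<^sub>R U i) = (\<Sum>d=1..D. b t d *\<^sub>R U (t, d))" for U :: "nat \<times> nat \<Rightarrow> real^'n"
      proof -
        have "(\<Sum>i\<in>?I. a i *\<^sub>R U i) = (\<Sum>s=1..T. \<Sum>d=1..D. a (s, d) *\<^sub>R U (s, d))"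
          by (simp add: sum.cartesian_product)
        also have "\<dots> = (\<Sum>s=1..T. if s = t then \<Sum>d=1..D. b t d *\<^sub>R U (t, d) else 0)"
          by (intro sum.cong refl) (simp add: a_def)
        finally show ?thesis using t by simp
      qed
      have s2: "(\<Sum>i\<in>?I. (a i)\<^sup>2) = c t"
      proof -
        have "(\<Sum>i\<in>?I. (a i)\<^sup>2) = (\<Sum>s=1..T. \<Sum>d=1..D. (a (s, d))\<^sup>2)"
          by (simp add: sum.cartesian_product)
        also have "\<dots> = (\<Sum>s=1..T. if s = t then c t else 0)"
          by (intro sum.cong refl) (simp add: a_def b[OF t])
        finally show ?thesis using t by simp
      qed
      have ind_meas: "(\<lambda>v. indicator A (\<mu> t + v) :: ennreal) \<in> borel_measurable borel"
        by (rule measurable_compose[OF _ borel_measurable_indicator[OF A]])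
          (intro borel_measurable_add borel_measurable_const measurable_ident_sets refl)
      have "emeasure (distr ?P borel (?Y t)) A = integral\<^sup>N (distr ?P borel (?Y t)) (indicator A)"
        by (rule nn_integral_indicator[symmetric], unfold sets_distr, rule A)
      also have "\<dots> = (\<integral>\<^sup>+U. indicator A (?Y t U) \<partial>?P)"
        by (rule nn_integral_distr[OF meas[OF t]], unfold measurable_distr_eq1, rule borel_measurable_indicator[OF A])
      also have "\<dots> = (\<integral>\<^sup>+U. indicator A (\<mu> t + (\<Sum>i\<in>?I. a i *\<^sub>R U i)) \<partial>?P)" unfolding s1 by (rule refl)
      also have "\<dots> = (\<integral>\<^sup>+v. indicator A (\<mu> t + v) \<partial>gauss (\<Sum>i\<in>?I. (a i)\<^sup>2))"
        by (rule nn_integral_sum_gauss[OF _ ind_meas], rule finite_cartesian_product, rule finite_atLeastAtMost, rule finite_atLeastAtMost)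
      also have "\<dots> = (\<integral>\<^sup>+v. indicator A (\<mu> t + 1 *\<^sub>R v) \<partial>gauss (c t))" unfolding s2 scaleR_one by (rule refl)
      also have "\<dots> = integral\<^sup>N (mv_normal (\<mu> t) (c t *\<^sub>R Sigma_cov)) (indicator A)"
        using nn_integral_gauss_scale[OF c[OF t] borel_measurable_indicator[OF A], of "\<mu> t" 1]
        by (simp only: one_neq_zero if_False power_one mult_1)
      also have "\<dots> = emeasure (mv_normal (\<mu> t) (c t *\<^sub>R Sigma_cov)) A"
        by (rule nn_integral_indicator, unfold sets_mv_normal, rule A)
      finally show "emeasure (distr ?P borel (?Y t)) A = emeasure (mv_normal (\<mu> t) (c t *\<^sub>R Sigma_cov)) A" .
    qed simp
  qed
  finally show ?thesis .
qed

lemma gauss_component_integral: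
  fixes F :: "real \<Rightarrow> real" and n :: "'n::finite"
  assumes F: "F \<in> borel_measurable borel"
  shows "integrable (gauss 1 :: (real^'n) measure) (\<lambda>v. F (v $ n)) \<longleftrightarrow> integrable lborel (\<lambda>x. std_normal_density x * F x)"
    and "(\<integral>v. F (v $ n) \<partial>(gauss 1 :: (real^'n) measure)) = (\<integral>x. std_normal_density x * F x \<partial>lborel)"
proof -
  have m0: "(\<lambda>v :: real^'n. v $ n) \<in> measurable borel borel"
    by (rule measurable_vec_nth_comp, rule measurable_ident_sets, rule refl)
  have m: "(\<lambda>v. v $ n) \<in> measurable (gauss 1 :: (real^'n) measure) borel"
    by (rule subst[OF measurable_cong_sets[OF sets_gauss[symmetric] refl], of "\<lambda>S. (\<lambda>v. v $ n) \<in> S", OF m0])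
  have nd: "std_normal_density \<in> borel_measurable lborel" "F \<in> borel_measurable lborel"
    "AE x in lborel. 0 \<le> std_normal_density x"
    using F by simp_all
  have "integrable (gauss 1 :: (real^'n) measure) (\<lambda>v. F (v $ n)) \<longleftrightarrow>
    integrable (distr (gauss 1 :: (real^'n) measure) borel (\<lambda>v. v $ n)) F"
    by (rule integrable_distr_eq[OF m F, symmetric])
  also have "\<dots> \<longleftrightarrow> integrable lborel (\<lambda>x. std_normal_density x * F x)"
    unfolding distr_gauss_component by (rule integrable_real_density[OF nd(1,3,2)])
  finally show "integrable (gauss 1 :: (real^'n) measure) (\<lambda>v. F (v $ n)) \<longleftrightarrow> integrable lborel (\<lambda>x. std_normal_density x * F x)" .
  have "(\<integral>v. F (v $ n) \<partial>(gauss 1 :: (real^'n) measure)) =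
    (\<integral>x. F x \<partial>distr (gauss 1 :: (real^'n) measure) borel (\<lambda>v. v $ n))"
    by (rule integral_distr[OF m F, symmetric])
  also have "\<dots> = (\<integral>x. std_normal_density x * F x \<partial>lborel)"
    unfolding distr_gauss_component by (rule integral_real_density[OF nd(1,3,2)])
  finally show "(\<integral>v. F (v $ n) \<partial>(gauss 1 :: (real^'n) measure)) = (\<integral>x. std_normal_density x * F x \<partial>lborel)" .
qed

section \<open>Moments of selected noise components\<close>

lemma gauss_component_power_integrable:
  "integrable (gauss 1 :: (real^'n::finite) measure) (\<lambda>v. (v $ n) ^ k)"
  using gauss_component_integral(1)[of "\<lambda>x. x ^ k" n] integrable_std_normal_moment[of k] by simp

lemma gauss_component_abs_power_integrable:
  "integrable (gauss 1 :: (real^'n::finite) measure) (\<lambda>v. \<bar>v $ n\<bar> ^ k)"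
  using gauss_component_integral(1)[of "\<lambda>x. \<bar>x\<bar> ^ k" n] integrable_std_normal_moment_abs[of k] by simp

lemma gauss_component_mean: "(\<integral>v. v $ n \<partial>(gauss 1 :: (real^'n::finite) measure)) = 0"
  using integral_std_normal_moment_odd[of 0] by (subst gauss_component_integral(2)[of "\<lambda>x. x"]) simp_all

lemma gauss_component_second_moment: "(\<integral>v. (v $ n)\<^sup>2 \<partial>(gauss 1 :: (real^'n::finite) measure)) = 1"
  using integral_std_normal_moment_even[of 1] by (subst gauss_component_integral(2)[of "\<lambda>x. x\<^sup>2"]) simp_all

lemma pick_simps [simp]: "pick None v = 0" "pick (Some n) v = v $ n"
  by (simp_all add: pick_def)

lemma pick_add: "pick k (v + w) = pick k v + pick k w"
  and pick_scaleR: "pick k (c *\<^sub>R v) = c * pick k v"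
  by (cases k; simp)+

lemma pick_sum: "pick k (\<Sum>i\<in>I. g i) = (\<Sum>i\<in>I. pick k (g i))"
  by (cases k) simp_all

lemma pick_measurable [measurable (raw)]:
  "g \<in> borel_measurable M \<Longrightarrow> (\<lambda>x. pick k (g x)) \<in> borel_measurable M"
  by (cases k) simp_all

lemma pick_integrable:
  "integrable (gauss 1 :: (real^'n::finite) measure) (\<lambda>v. pick k v ^ j)"
  "integrable (gauss 1 :: (real^'n::finite) measure) (\<lambda>v. \<bar>pick k v\<bar> ^ j)"
proof -
  interpret prob_space "gauss 1 :: (real^'n) measure" by (simp add: prob_space_gauss)
  show "integrable (gauss 1 :: (real^'n::finite) measure) (\<lambda>v. pick k v ^ j)"
    "integrable (gauss 1 :: (real^'n::finite) measure) (\<lambda>v. \<bar>pick k v\<bar> ^ j)"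
    by (cases k; simp add: gauss_component_power_integrable gauss_component_abs_power_integrable)+
qed

lemma pick_mean: "(\<integral>v. pick k v \<partial>(gauss 1 :: (real^'n::finite) measure)) = 0"
  by (cases k) (simp_all add: gauss_component_mean)

lemma pick_second_moment:
  "(\<integral>v. (pick k v)\<^sup>2 \<partial>(gauss 1 :: (real^'n::finite) measure)) = of_bool (k \<noteq> None)"
  by (cases k) (simp_all add: gauss_component_second_moment)

lemma pick_fourth_moment:
  "(\<integral>v. (pick k v) ^ 4 \<partial>(gauss 1 :: (real^'n::finite) measure)) = 3 * of_bool (k \<noteq> None)"
proof (cases k)
  case (Some n)
  have "(\<integral>v. (v $ n) ^ 4 \<partial>(gauss 1 :: (real^'n) measure)) = (\<integral>x. std_normal_density x * x ^ (2 * 2) \<partial>lborel)"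
    by (subst gauss_component_integral(2)[of "\<lambda>x. x ^ 4"]) simp_all
  also have "\<dots> = 3"
    unfolding integral_std_normal_moment_even by (simp add: fact_numeral)
  finally show ?thesis using Some by simp
qed simp

text \<open>The absolute cube is at most the mean of the square and the fourth power; the constant
  is (1 + 3)/2.\<close>

lemma pick_abs_third_moment:
  "(\<integral>v. \<bar>pick k v\<bar> ^ 3 \<partial>(gauss 1 :: (real^'n::finite) measure)) \<le> 2"
proof -
  have "\<bar>y\<bar> ^ 3 \<le> (y\<^sup>2 + y ^ 4) / 2" for y :: real
  proof -
    have "0 \<le> y\<^sup>2 * (1 - \<bar>y\<bar>)\<^sup>2" by simp
    also have "\<dots> = y\<^sup>2 + y ^ 4 - 2 * \<bar>y\<bar> ^ 3"
      by (cases "0 \<le> y") (simp_all add: power2_eq_square power3_eq_cube power4_eq_xxxx algebra_simps)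
    finally show ?thesis by simp
  qed
  then have "(\<integral>v. \<bar>pick k v\<bar> ^ 3 \<partial>(gauss 1 :: (real^'n) measure)) \<le>
    (\<integral>v. ((pick k v)\<^sup>2 + (pick k v) ^ 4) / 2 \<partial>(gauss 1 :: (real^'n) measure))"
    by (intro integral_mono) (auto simp: pick_integrable)
  also have "\<dots> = (of_bool (k \<noteq> None) + 3 * of_bool (k \<noteq> None)) / 2"
    by (simp add: pick_integrable pick_second_moment pick_fourth_moment)
  also have "\<dots> \<le> 2" by simp
  finally show ?thesis .
qed

text \<open>The injection \<open>idx\<close> places the summation range inside the noise, so that a
  sum can run over a single time slice of the doubly indexed family.\<close>

lemma PiM_L1_bound:
  fixes F :: "'a \<Rightarrow> real" and idx :: "'d \<Rightarrow> 'i"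
  assumes M: "prob_space M" and I: "finite I" and S: "finite S" "inj_on idx S" "idx ` S \<subseteq> I"
    and F: "F \<in> borel_measurable M" "integrable M (\<lambda>v. (F v)\<^sup>2)" "(\<integral>v. F v \<partial>M) = 0"
  shows "integrable (\<Pi>\<^sub>M i\<in>I. M) (\<lambda>U. \<Sum>d\<in>S. c d * F (U (idx d)))"
    and "(\<integral>U. \<bar>\<Sum>d\<in>S. c d * F (U (idx d))\<bar> \<partial>(\<Pi>\<^sub>M i\<in>I. M)) \<le> sqrt ((\<integral>v. (F v)\<^sup>2 \<partial>M) * (\<Sum>d\<in>S. (c d)\<^sup>2))"
proof -
  interpret M: prob_space M by fact
  let ?P = "\<Pi>\<^sub>M i\<in>I. M"
  interpret P: prob_space ?P by (rule prob_space_PiM) (rule M)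
  have Fi: "integrable M F" by (rule M.square_integrable_imp_integrable[OF F(1,2)])
  have iI: "idx d \<in> I" if "d \<in> S" for d using S(3) that by auto
  have ne: "idx d \<noteq> idx e" if "d \<in> S" "e \<in> S" "d \<noteq> e" for d e using S(2) that by (auto dest: inj_onD)
  have meas: "(\<lambda>U. F (U (idx d))) \<in> borel_measurable ?P" if "d \<in> S" for d
    using measurable_compose[OF measurable_component_singleton[OF iI[OF that], of "\<lambda>_. M"] F(1)] .
  have int: "integrable ?P (\<lambda>U. F (U (idx d)) * F (U (idx e)))" if "d \<in> S" "e \<in> S" for d e
  proof (cases "d = e")
    case True
    then show ?thesis
      using PiM_expectation_single(1)[OF M I iI[OF that(1)] F(2)] by (simp add: power2_eq_square)
  next
    case False
    then show ?thesis using PiM_expectation_pair(1)[OF M I iI iI ne Fi Fi] that by blast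
  qed
  have orth: "P.expectation (\<lambda>U. F (U (idx d)) * F (U (idx e))) = 0" if "d \<in> S" "e \<in> S" "d \<noteq> e" for d e
    using PiM_expectation_pair(2)[OF M I iI[OF that(1)] iI[OF that(2)] ne[OF that] Fi Fi] F(3) by simp
  have K: "P.expectation (\<lambda>U. (F (U (idx d)))\<^sup>2) \<le> (\<integral>v. (F v)\<^sup>2 \<partial>M)" if "d \<in> S" for d
    using PiM_expectation_single(2)[OF M I iI[OF that] F(2)] by simp
  show "integrable ?P (\<lambda>U. \<Sum>d\<in>S. c d * F (U (idx d)))"
    by (rule P.expectation_abs_sum_orthogonal(1)[OF S(1) meas int orth K]; assumption)
  show "P.expectation (\<lambda>U. \<bar>\<Sum>d\<in>S. c d * F (U (idx d))\<bar>) \<le> sqrt ((\<integral>v. (F v)\<^sup>2 \<partial>M) * (\<Sum>d\<in>S. (c d)\<^sup>2))"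
    by (rule P.expectation_abs_sum_orthogonal(2)[OF S(1) meas int orth K]; assumption)
qed

text \<open>For different \<open>d\<close> the products \<open>F (U (idx d)) * G (U (jdx d))\<close>
  are orthogonal, because the four noise variables involved are distinct and every factor is
  centred.\<close>

lemma PiM_L1_bound_cross:
  fixes F G :: "'a \<Rightarrow> real" and idx jdx :: "'d \<Rightarrow> 'i"
  assumes M: "prob_space M" and I: "finite I" and S: "finite S" "inj_on idx S" "inj_on jdx S" "idx ` S \<subseteq> I" "jdx ` S \<subseteq> I"
    and disj: "idx ` S \<inter> jdx ` S = {}"
    and F: "F \<in> borel_measurable M" "integrable M (\<lambda>v. (F v)\<^sup>2)" "(\<integral>v. F v \<partial>M) = 0"
    and G: "G \<in> borel_measurable M" "integrable M (\<lambda>v. (G v)\<^sup>2)" "(\<integral>v. G v \<partial>M) = 0"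
  shows "integrable (\<Pi>\<^sub>M i\<in>I. M) (\<lambda>U. \<Sum>d\<in>S. c d * (F (U (idx d)) * G (U (jdx d))))"
    and "(\<integral>U. \<bar>\<Sum>d\<in>S. c d * (F (U (idx d)) * G (U (jdx d)))\<bar> \<partial>(\<Pi>\<^sub>M i\<in>I. M)) \<le>
      sqrt ((\<integral>v. (F v)\<^sup>2 \<partial>M) * (\<integral>v. (G v)\<^sup>2 \<partial>M) * (\<Sum>d\<in>S. (c d)\<^sup>2))"
proof -
  interpret M: prob_space M by fact
  let ?P = "\<Pi>\<^sub>M i\<in>I. M"
  interpret P: prob_space ?P by (rule prob_space_PiM) (rule M)
  have Fi: "integrable M F" by (rule M.square_integrable_imp_integrable[OF F(1,2)])
  have Gi: "integrable M G" by (rule M.square_integrable_imp_integrable[OF G(1,2)])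
  have iI: "idx d \<in> I" and jI: "jdx d \<in> I" if "d \<in> S" for d using S(4,5) that by auto
  have nei: "idx d \<noteq> idx e" "jdx d \<noteq> jdx e" if "d \<in> S" "e \<in> S" "d \<noteq> e" for d e
    using S(2,3) that by (auto dest: inj_onD)
  have neij: "idx d \<noteq> jdx e" if "d \<in> S" "e \<in> S" for d e using disj that by blast
  have meas: "(\<lambda>U. F (U (idx d)) * G (U (jdx d))) \<in> borel_measurable ?P" if "d \<in> S" for d
    using measurable_compose[OF measurable_component_singleton[OF iI[OF that], of "\<lambda>_. M"] F(1)]
      measurable_compose[OF measurable_component_singleton[OF jI[OF that], of "\<lambda>_. M"] G(1)]
    by (rule borel_measurable_times)
  have sq: "integrable ?P (\<lambda>U. (F (U (idx d)))\<^sup>2 * (G (U (jdx d)))\<^sup>2)"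
    "P.expectation (\<lambda>U. (F (U (idx d)))\<^sup>2 * (G (U (jdx d)))\<^sup>2) = (\<integral>v. (F v)\<^sup>2 \<partial>M) * (\<integral>v. (G v)\<^sup>2 \<partial>M)" if "d \<in> S" for d
    by (rule PiM_expectation_pair[OF M I iI[OF that] jI[OF that] neij[OF that that] F(2) G(2)])+
  have four: "integrable ?P (\<lambda>U. F (U (idx d)) * G (U (jdx d)) * (F (U (idx e)) * G (U (jdx e))))"
    "P.expectation (\<lambda>U. F (U (idx d)) * G (U (jdx d)) * (F (U (idx e)) * G (U (jdx e)))) = 0"
    if de: "d \<in> S" "e \<in> S" "d \<noteq> e" for d e
  proof -
    \<comment> \<open>Assigns to each of the four distinct indices its own function, so that the
      product formula for expectations applies over \<open>?J\<close>.\<close>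
    define H where "H i = (if i = idx d \<or> i = idx e then F else G)" for i
    have ne: "idx d \<noteq> idx e" "jdx d \<noteq> jdx e" "idx d \<noteq> jdx d" "idx d \<noteq> jdx e" "idx e \<noteq> jdx d" "idx e \<noteq> jdx e"
      using nei[OF de] neij de by auto
    let ?J = "{idx d, jdx d, idx e, jdx e}"
    have J: "?J \<subseteq> I" using iI jI de by auto
    have H: "integrable M (H i)" "(\<integral>v. H i v \<partial>M) = 0" for i using Fi Gi F(3) G(3) by (auto simp: H_def)
    have prod: "(\<Prod>i\<in>?J. H i (U i)) = F (U (idx d)) * G (U (jdx d)) * (F (U (idx e)) * G (U (jdx e)))" for U
      using ne ne[symmetric] by (simp add: H_def mult_ac)
    have "integrable ?P (\<lambda>U. \<Prod>i\<in>?J. H i (U i))"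
      by (rule PiM_expectation_prod(1)[OF M I J]) (rule H)
    then show "integrable ?P (\<lambda>U. F (U (idx d)) * G (U (jdx d)) * (F (U (idx e)) * G (U (jdx e))))"
      unfolding prod .
    have "P.expectation (\<lambda>U. \<Prod>i\<in>?J. H i (U i)) = (\<Prod>i\<in>?J. \<integral>v. H i v \<partial>M)"
      by (rule PiM_expectation_prod(2)[OF M I J]) (rule H)
    also have "\<dots> = 0" unfolding H(2) by (simp add: card_gt_0_iff)
    finally show "P.expectation (\<lambda>U. F (U (idx d)) * G (U (jdx d)) * (F (U (idx e)) * G (U (jdx e)))) = 0"
      unfolding prod .
  qed
  have int: "integrable ?P (\<lambda>U. F (U (idx d)) * G (U (jdx d)) * (F (U (idx e)) * G (U (jdx e))))"
    if "d \<in> S" "e \<in> S" for d e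
  proof (cases "d = e")
    case True
    have "F (U (idx d)) * G (U (jdx d)) * (F (U (idx d)) * G (U (jdx d))) = (F (U (idx d)))\<^sup>2 * (G (U (jdx d)))\<^sup>2" for U
      by (simp add: power2_eq_square)
    then show ?thesis using sq(1)[OF that(1)] True by simp
  next
    case False
    then show ?thesis using four(1)[OF that] by blast
  qed
  have K: "P.expectation (\<lambda>U. (F (U (idx d)) * G (U (jdx d)))\<^sup>2) \<le> (\<integral>v. (F v)\<^sup>2 \<partial>M) * (\<integral>v. (G v)\<^sup>2 \<partial>M)" if "d \<in> S" for d
    using sq(2)[OF that] by (simp add: power_mult_distrib)
  show "integrable ?P (\<lambda>U. \<Sum>d\<in>S. c d * (F (U (idx d)) * G (U (jdx d))))"
    by (rule P.expectation_abs_sum_orthogonal(1)[OF S(1) meas int four(2) K]; assumption)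
  show "P.expectation (\<lambda>U. \<bar>\<Sum>d\<in>S. c d * (F (U (idx d)) * G (U (jdx d)))\<bar>) \<le>
      sqrt ((\<integral>v. (F v)\<^sup>2 \<partial>M) * (\<integral>v. (G v)\<^sup>2 \<partial>M) * (\<Sum>d\<in>S. (c d)\<^sup>2))"
    by (rule P.expectation_abs_sum_orthogonal(2)[OF S(1) meas int four(2) K]; assumption)
qed

text \<open>Each term is at most the largest one, whose cube is itself among the summands.\<close>

lemma sum_power3_le:
  fixes a :: "'i \<Rightarrow> real"
  assumes S: "finite S" and a: "\<And>i. i \<in> S \<Longrightarrow> 0 \<le> a i"
  shows "(\<Sum>i\<in>S. a i) ^ 3 \<le> real (card S) ^ 3 * (\<Sum>i\<in>S. a i ^ 3)"
proof (cases "S = {}")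
  case False
  obtain j where j: "j \<in> S" "\<And>i. i \<in> S \<Longrightarrow> a i \<le> a j"
  proof -
    have "Max (a ` S) \<in> a ` S" using S False by (intro Max_in) auto
    then obtain j where "j \<in> S" "a j = Max (a ` S)" by auto
    then show ?thesis using S by (intro that[of j]) auto
  qed
  have "(\<Sum>i\<in>S. a i) \<le> real (card S) * a j"
    using sum_bounded_above[of S a "a j"] j by simp
  then have "(\<Sum>i\<in>S. a i) ^ 3 \<le> (real (card S) * a j) ^ 3"
    by (rule power_mono) (simp add: a sum_nonneg)
  also have "\<dots> = real (card S) ^ 3 * a j ^ 3" by (rule power_mult_distrib)
  also have "\<dots> \<le> real (card S) ^ 3 * (\<Sum>i\<in>S. a i ^ 3)"
    using j(1) S by (intro mult_left_mono member_le_sum[of j S "\<lambda>i. a i ^ 3"]) (auto simp: a)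
  finally show ?thesis .
qed simp

section \<open>The coupling at a typical point\<close>

text \<open>Bounds the mean error of one log weight. The terms belong, in order, to the variance
  correction, the mixed derivatives, the diagonal second derivatives with their bias, and the Taylor
  remainder.\<close>

definition weight_error :: "nat \<Rightarrow> (nat \<Rightarrow> real) \<Rightarrow> real \<Rightarrow> real \<Rightarrow> real \<Rightarrow> nat \<Rightarrow> real" where
  "weight_error T l B L e D =
     (\<Sum>t=1..T. sqrt (l t) * sqrt e + (\<Sum>s\<in>{1..<t}. sqrt (l s * l t) * (B / sqrt (real D)))
       + l t / 2 * (sqrt 3 * (B / sqrt (real D)) + e))
     + L * real T ^ 3 * (\<Sum>t=1..T. 2 * sqrt (l t) ^ 3 / sqrt (real D))"

text \<open>The difference of the roots is at most their sum, and the product of the two is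
  \<open>m - i\<close>. This controls the variance correction without dividing by the
  information.\<close>

lemma sqrt_diff_square_le:
  assumes "0 \<le> m" "0 \<le> (i::real)"
  shows "(sqrt m - sqrt i)\<^sup>2 \<le> \<bar>m - i\<bar>"
proof -
  have "\<bar>m - i\<bar> = \<bar>sqrt m - sqrt i\<bar> * (sqrt m + sqrt i)"
  proof -
    have "m - i = (sqrt m - sqrt i) * (sqrt m + sqrt i)"
      using assms by (simp add: algebra_simps)
    then show ?thesis using assms by (simp add: abs_mult)
  qed
  moreover have "\<bar>sqrt m - sqrt i\<bar> \<le> sqrt m + sqrt i"
    using assms by (simp add: abs_le_iff)
  then have "\<bar>sqrt m - sqrt i\<bar> * \<bar>sqrt m - sqrt i\<bar> \<le> \<bar>sqrt m - sqrt i\<bar> * (sqrt m + sqrt i)"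
    by (rule mult_left_mono) simp
  ultimately show ?thesis by (simp add: power2_eq_square)
qed

context smooth_target
begin

abbreviation "I \<equiv> fisher_info T p"

lemma f2_lipschitz:
  "\<exists>L\<ge>0. \<forall>s\<in>{1..T}. \<forall>t\<in>{1..T}. \<forall>x y. \<bar>f2 s t x - f2 s t y\<bar> \<le> L * L2_set (\<lambda>j. x j - y j) {1..T}"
proof -
  have "\<forall>s\<in>{1..T}. \<forall>t\<in>{1..T}. \<exists>L. \<forall>x y. \<bar>f2 s t x - f2 s t y\<bar> \<le> L * L2_set (\<lambda>j. x j - y j) {1..T}"
    using lip unfolding euclid_lipschitz_def by blast
  then obtain b where b: "\<And>s t x y. s \<in> {1..T} \<Longrightarrow> t \<in> {1..T} \<Longrightarrow>
      \<bar>f2 s t x - f2 s t y\<bar> \<le> b s t * L2_set (\<lambda>j. x j - y j) {1..T}"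
    by metis
  define L where "L = (\<Sum>s=1..T. \<Sum>t=1..T. \<bar>b s t\<bar>)"
  have "\<bar>f2 s t x - f2 s t y\<bar> \<le> L * L2_set (\<lambda>j. x j - y j) {1..T}" if st: "s \<in> {1..T}" "t \<in> {1..T}" for s t x y
  proof -
    have "b s t \<le> \<bar>b s t\<bar>" by simp
    also have "\<dots> \<le> (\<Sum>t=1..T. \<bar>b s t\<bar>)" by (rule member_le_sum[OF st(2)]) auto
    also have "\<dots> \<le> L" unfolding L_def
      by (rule member_le_sum[OF st(1), of "\<lambda>s. \<Sum>t=1..T. \<bar>b s t\<bar>"]) (auto simp: sum_nonneg)
    finally have "b s t * L2_set (\<lambda>j. x j - y j) {1..T} \<le> L * L2_set (\<lambda>j. x j - y j) {1..T}"
      by (rule mult_right_mono) simp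
    then show ?thesis using b[OF st, of x y] by simp
  qed
  then show ?thesis by (intro exI[of _ L]) (auto simp: L_def sum_nonneg)
qed

lemma taylor_f:
  assumes L: "0 \<le> L" "\<forall>s\<in>{1..T}. \<forall>t\<in>{1..T}. \<forall>x y. \<bar>f2 s t x - f2 s t y\<bar> \<le> L * L2_set (\<lambda>j. x j - y j) {1..T}"
    and z: "\<And>t. t \<in> {1..T} \<Longrightarrow> z t = x t + h t"
  shows "\<bar>f z - f x - (\<Sum>t=1..T. h t * f1 t x + (\<Sum>s\<in>{1..<t}. h s * h t * f2 s t x) + (h t)\<^sup>2 / 2 * f2 t t x)\<bar>
    \<le> L * (\<Sum>t=1..T. \<bar>h t\<bar>) ^ 3"
proof (rule multi_taylor2)
  show "has_partials T f" by (rule partial_log_density(1)[OF C2 pos])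
  show "has_partials T (f1 t)" if "t \<in> {1..T}" for t by (rule partial_log_density(3)[OF C2 pos that])
  show "on_coords T f" unfolding on_coords_def log_density_def using on_coordsD[OF on] by metis
qed (use L z in auto)

end

text \<open>The state is fixed and only the noise is random. \<open>e_less\<close> keeps the
  empirical information away from zero, so that one may divide by it.\<close>

locale typical_point = smooth_target T p for T p +
  fixes l :: "nat \<Rightarrow> real" and D :: nat and x :: "nat \<Rightarrow> nat \<Rightarrow> real" and e B L :: real
  assumes T: "1 \<le> T" and l: "\<And>t. t \<in> {1..T} \<Longrightarrow> 0 < l t" and D: "1 \<le> D"
    and B0: "0 \<le> B" and B: "\<forall>s\<in>{1..T}. \<forall>t\<in>{1..T}. \<forall>x. \<bar>f2 s t x\<bar> \<le> B"
    and L0: "0 \<le> L"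
    and L: "\<forall>s\<in>{1..T}. \<forall>t\<in>{1..T}. \<forall>x y. \<bar>f2 s t x - f2 s t y\<bar> \<le> L * L2_set (\<lambda>j. x j - y j) {1..T}"
    and e_less: "\<And>t. t \<in> {1..T} \<Longrightarrow> e < fisher_info T p t"
    and typical1: "\<And>t. t \<in> {1..T} \<Longrightarrow> \<bar>(\<Sum>d=1..D. (f1 t (\<lambda>t. x t d))\<^sup>2) / real D - fisher_info T p t\<bar> \<le> e"
    and typical2: "\<And>t. t \<in> {1..T} \<Longrightarrow> \<bar>(\<Sum>d=1..D. f2 t t (\<lambda>t. x t d)) / real D + fisher_info T p t\<bar> \<le> e"
begin

abbreviation "col d \<equiv> (\<lambda>t. x t d)"
abbreviation "m t \<equiv> (\<Sum>d=1..D. (f1 t (col d))\<^sup>2) / real D"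

text \<open>\<open>r t\<close> corrects the empirical Fisher information \<open>m t\<close> to its limit, so that \<open>limit_potential\<close> below
  has exactly the Gaussian law of the limiting model.\<close>

definition "r t = sqrt (I t / m t)"

definition limit_potential :: "(nat \<times> nat \<Rightarrow> real^'n) \<Rightarrow> nat \<Rightarrow> real^'n" where
  "limit_potential U t = (\<chi> n. - (l t * I t) / 2) + (\<Sum>d=1..D. (r t * sqrt (l t / real D) * f1 t (col d)) *\<^sub>R U (t, d))"

definition log_ratio :: "(nat \<times> nat \<Rightarrow> real^'n) \<Rightarrow> (nat \<Rightarrow> 'n option) \<Rightarrow> real" where
  "log_ratio U k = (\<Sum>d=1..D. f (\<lambda>t. proposal l D x U t (k t) d) - f (col d))"

lemma D_pos: "0 < real D" using D by simp

lemma e_nonneg: "0 \<le> e"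
  using typical1[of 1] T by (simp add: order_trans[OF abs_ge_zero])

lemma m_pos: "t \<in> {1..T} \<Longrightarrow> 0 < m t"
  using typical1[of t] e_less[of t] by (simp add: abs_le_iff)

lemma r_sqrt_m:
  assumes "t \<in> {1..T}"
  shows "r t * sqrt (m t) = sqrt (I t)"
proof -
  have "sqrt (i / q) * sqrt q = sqrt i" if "0 < q" for i q :: real
    using that by (simp add: real_sqrt_divide)
  then show ?thesis unfolding r_def using m_pos[OF assms] by blast
qed

lemma limit_potential_variance:
  assumes t: "t \<in> {1..T}"
  shows "(\<Sum>d=1..D. (r t * sqrt (l t / real D) * f1 t (col d))\<^sup>2) = l t * I t"
proof -
  have "(\<Sum>d=1..D. (r t * sqrt (l t / real D) * f1 t (col d))\<^sup>2) = (r t)\<^sup>2 * (sqrt (l t / real D))\<^sup>2 * (\<Sum>d=1..D. (f1 t (col d))\<^sup>2)"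
    by (simp add: power_mult_distrib sum_distrib_left mult.assoc)
  also have "\<dots> = (r t)\<^sup>2 * (l t / real D) * (real D * m t)"
    using l[OF t] D_pos by simp
  also have "\<dots> = l t * (r t * sqrt (m t))\<^sup>2"
    using D_pos m_pos[OF t] by (simp add: power_mult_distrib)
  also have "\<dots> = l t * I t"
    unfolding r_sqrt_m[OF t] using fisher_info_pos[OF t] by simp
  finally show ?thesis .
qed

text \<open>Four sources of error: \<open>X1\<close> is the change of variance made by
  \<open>r\<close>, \<open>X2\<close> the mixed second-order part, \<open>X3\<close> the fluctuation
  of squared increments about their mean, \<open>X4\<close> a bound on the Taylor remainder. The
  indicator in \<open>X3\<close> is the second moment of \<open>pick\<close>, which is zero for
  \<open>None\<close>.\<close>

definition "X1 k U t = (\<Sum>d=1..D. ((1 - r t) * sqrt (l t / real D) * f1 t (col d)) * pick (k t) (U (t, d)))"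
definition "X2 k U s t = (\<Sum>d=1..D. (sqrt (l s / real D) * sqrt (l t / real D) * f2 s t (col d)) * (pick (k s) (U (s, d)) * pick (k t) (U (t, d))))"
definition "X3 k U t = (\<Sum>d=1..D. (f2 t t (col d) / real D) * ((pick (k t) (U (t, d)))\<^sup>2 - of_bool (k t \<noteq> None)))"
definition "X4 k U = L * real T ^ 3 * (\<Sum>d=1..D. \<Sum>t=1..T. (sqrt (l t / real D) * \<bar>pick (k t) (U (t, d))\<bar>) ^ 3)"

definition "error_bound k U = (\<Sum>t=1..T. \<bar>X1 k U t\<bar> + (\<Sum>s\<in>{1..<t}. \<bar>X2 k U s t\<bar>) + l t / 2 * (\<bar>X3 k U t\<bar> + e)) + X4 k U"

text \<open>An inequality for every realisation of the noise. The drift of the limit potential is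
  split off from the diagonal second-order term, which leaves \<open>X3\<close> and the gap between
  the averaged second derivative and \<open>- I t\<close>, at most \<open>e\<close> at a typical
  state. A time with label \<open>None\<close> has neither displacement nor drift.\<close>

lemma log_ratio_close:
  fixes U :: "nat \<times> nat \<Rightarrow> real^'n"
  shows "\<bar>log_ratio U k - log_weight T (limit_potential U) k\<bar> \<le> error_bound k U"
proof -
  define h where "h d t = sqrt (l t / real D) * pick (k t) (U (t, d))" for d t
  define Q where "Q d = (\<Sum>t=1..T. h d t * f1 t (col d) + (\<Sum>s\<in>{1..<t}. h d s * h d t * f2 s t (col d))
      + (h d t)\<^sup>2 / 2 * f2 t t (col d))" for d
  have h2: "(h d t)\<^sup>2 = l t / real D * (pick (k t) (U (t, d)))\<^sup>2" if "t \<in> {1..T}" for d t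
    using l[OF that] D_pos by (simp add: h_def power_mult_distrib)
  have z: "proposal l D x U t (k t) d = x t d + h d t" for t d
    by (cases "k t") (simp_all add: proposal_def h_def)
  have tay: "\<bar>f (\<lambda>t. proposal l D x U t (k t) d) - f (col d) - Q d\<bar> \<le> L * (\<Sum>t=1..T. \<bar>h d t\<bar>) ^ 3" for d
    unfolding Q_def by (rule taylor_f[OF L0 L z])
  have "\<bar>log_ratio U k - (\<Sum>d=1..D. Q d)\<bar> = \<bar>\<Sum>d=1..D. f (\<lambda>t. proposal l D x U t (k t) d) - f (col d) - Q d\<bar>"
    by (simp add: log_ratio_def sum_subtractf)
  also have "\<dots> \<le> (\<Sum>d=1..D. \<bar>f (\<lambda>t. proposal l D x U t (k t) d) - f (col d) - Q d\<bar>)" by (rule sum_abs)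
  also have "\<dots> \<le> (\<Sum>d=1..D. L * (\<Sum>t=1..T. \<bar>h d t\<bar>) ^ 3)" by (intro sum_mono tay)
  also have "\<dots> \<le> (\<Sum>d=1..D. L * (real T ^ 3 * (\<Sum>t=1..T. \<bar>h d t\<bar> ^ 3)))"
    using sum_power3_le[of "{1..T}" "\<lambda>t. \<bar>h _ t\<bar>"] by (intro sum_mono mult_left_mono L0) simp
  also have "\<dots> = X4 k U"
    unfolding X4_def sum_distrib_left
  proof (intro sum.cong refl)
    fix d t assume "t \<in> {1..T}"
    then have "\<bar>h d t\<bar> = sqrt (l t / real D) * \<bar>pick (k t) (U (t, d))\<bar>"
      using l[of t] by (simp add: h_def abs_mult)
    then show "L * (real T ^ 3 * \<bar>h d t\<bar> ^ 3) = L * real T ^ 3 * (sqrt (l t / real D) * \<bar>pick (k t) (U (t, d))\<bar>) ^ 3"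
      by simp
  qed
  finally have rem: "\<bar>log_ratio U k - (\<Sum>d=1..D. Q d)\<bar> \<le> X4 k U" .
  define A1 where "A1 t = (\<Sum>d=1..D. h d t * f1 t (col d))" for t
  \<comment> \<open>The diagonal second-order term after removal of its limit.\<close>
  define Y where "Y t = l t / 2 * (X3 k U t + of_bool (k t \<noteq> None) * ((\<Sum>d=1..D. f2 t t (col d)) / real D + I t))" for t
  have A3: "(\<Sum>d=1..D. (h d t)\<^sup>2 / 2 * f2 t t (col d)) = Y t - of_bool (k t \<noteq> None) * (l t * I t / 2)" if "t \<in> {1..T}" for t
  proof -
    define W c S where "W = (\<Sum>d=1..D. f2 t t (col d) / real D * (pick (k t) (U (t, d)))\<^sup>2)"
      and "c = (of_bool (k t \<noteq> None) :: real)" and "S = (\<Sum>d=1..D. f2 t t (col d)) / real D"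
    have 1: "X3 k U t = W - c * S"
      by (simp add: X3_def W_def c_def S_def right_diff_distrib sum_subtractf sum_divide_distrib sum_distrib_left mult.commute)
    have 2: "(\<Sum>d=1..D. (h d t)\<^sup>2 / 2 * f2 t t (col d)) = l t / 2 * W"
      unfolding h2[OF that] W_def sum_distrib_left by (intro sum.cong refl) (simp add: mult_ac)
    show ?thesis unfolding Y_def 2 1 c_def[symmetric] S_def[symmetric] by (simp add: algebra_simps)
  qed
  have A2: "(\<Sum>d=1..D. h d s * h d t * f2 s t (col d)) = X2 k U s t" for s t
    unfolding X2_def h_def by (intro sum.cong refl) (simp add: mult_ac)
  have lw: "pick (k t) (limit_potential U t) = r t * A1 t - of_bool (k t \<noteq> None) * (l t * I t / 2)" for t
  proof -
    have "pick (k t) ((\<chi> n. - (l t * I t) / 2) :: real^'n) = - of_bool (k t \<noteq> None) * (l t * I t / 2)"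
      by (cases "k t") simp_all
    moreover have "pick (k t) (\<Sum>d=1..D. (r t * sqrt (l t / real D) * f1 t (col d)) *\<^sub>R U (t, d)) = r t * A1 t"
      unfolding pick_sum pick_scaleR A1_def h_def sum_distrib_left by (intro sum.cong refl) (simp add: mult_ac)
    ultimately show ?thesis unfolding limit_potential_def pick_add by simp
  qed
  have X1: "X1 k U t = A1 t - r t * A1 t" for t
    unfolding X1_def A1_def h_def sum_distrib_left sum_subtractf[symmetric]
    by (intro sum.cong refl) (simp add: algebra_simps)
  have Qs: "(\<Sum>d=1..D. Q d) = (\<Sum>t=1..T. A1 t + (\<Sum>s\<in>{1..<t}. X2 k U s t) + (\<Sum>d=1..D. (h d t)\<^sup>2 / 2 * f2 t t (col d)))"
  proof -
    have "(\<Sum>d=1..D. Q d) = (\<Sum>t=1..T. \<Sum>d=1..D. h d t * f1 t (col d) + (\<Sum>s\<in>{1..<t}. h d s * h d t * f2 s t (col d))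
      + (h d t)\<^sup>2 / 2 * f2 t t (col d))"
      unfolding Q_def by (rule sum.swap)
    also have "\<dots> = (\<Sum>t=1..T. A1 t + (\<Sum>s\<in>{1..<t}. X2 k U s t) + (\<Sum>d=1..D. (h d t)\<^sup>2 / 2 * f2 t t (col d)))"
    proof (rule sum.cong[OF refl])
      fix t
      have "(\<Sum>d=1..D. \<Sum>s\<in>{1..<t}. h d s * h d t * f2 s t (col d)) = (\<Sum>s\<in>{1..<t}. X2 k U s t)"
        unfolding A2[symmetric] by (rule sum.swap)
      then show "(\<Sum>d=1..D. h d t * f1 t (col d) + (\<Sum>s\<in>{1..<t}. h d s * h d t * f2 s t (col d)) + (h d t)\<^sup>2 / 2 * f2 t t (col d))
        = A1 t + (\<Sum>s\<in>{1..<t}. X2 k U s t) + (\<Sum>d=1..D. (h d t)\<^sup>2 / 2 * f2 t t (col d))"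
        unfolding sum.distrib A1_def by simp
    qed
    finally show ?thesis .
  qed
  \<comment> \<open>The drift \<open>q\<close> occurs on both sides and cancels.\<close>
  have gen: "a + b + (y - q) - (ra - q) = a - ra + b + y" for a b y q ra :: real by simp
  have eq: "(\<Sum>d=1..D. Q d) - log_weight T (limit_potential U) k =
    (\<Sum>t=1..T. X1 k U t + (\<Sum>s\<in>{1..<t}. X2 k U s t) + Y t)"
    unfolding log_weight_def lw Qs sum_subtractf[symmetric]
  proof (intro sum.cong[OF refl])
    fix t assume t: "t \<in> {1..T}"
    show "A1 t + (\<Sum>s\<in>{1..<t}. X2 k U s t) + (\<Sum>d=1..D. (h d t)\<^sup>2 / 2 * f2 t t (col d))
        - (r t * A1 t - of_bool (k t \<noteq> None) * (l t * I t / 2)) = X1 k U t + (\<Sum>s\<in>{1..<t}. X2 k U s t) + Y t"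
      unfolding A3[OF t] X1 by (rule gen)
  qed
  have le: "\<bar>\<Sum>t=1..T. X1 k U t + (\<Sum>s\<in>{1..<t}. X2 k U s t) + Y t\<bar> \<le> (\<Sum>t=1..T. \<bar>X1 k U t\<bar> + (\<Sum>s\<in>{1..<t}. \<bar>X2 k U s t\<bar>) + l t / 2 * (\<bar>X3 k U t\<bar> + e))"
  proof (rule order_trans[OF sum_abs], rule sum_mono)
    fix t assume t: "t \<in> {1..T}"
    have "\<bar>Y t\<bar> \<le> l t / 2 * (\<bar>X3 k U t\<bar> + e)"
    proof -
      have "\<bar>of_bool (k t \<noteq> None) * ((\<Sum>d=1..D. f2 t t (col d)) / real D + I t)\<bar> \<le> e"
        using typical2[OF t] e_nonneg by (cases "k t") simp_all
      then have "\<bar>X3 k U t + of_bool (k t \<noteq> None) * ((\<Sum>d=1..D. f2 t t (col d)) / real D + I t)\<bar> \<le> \<bar>X3 k U t\<bar> + e"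
        by linarith
      then show ?thesis unfolding Y_def abs_mult using l[OF t] by (simp add: mult_left_mono)
    qed
    moreover have "\<bar>\<Sum>s\<in>{1..<t}. X2 k U s t\<bar> \<le> (\<Sum>s\<in>{1..<t}. \<bar>X2 k U s t\<bar>)" by (rule sum_abs)
    ultimately show "\<bar>X1 k U t + (\<Sum>s\<in>{1..<t}. X2 k U s t) + Y t\<bar> \<le>
        \<bar>X1 k U t\<bar> + (\<Sum>s\<in>{1..<t}. \<bar>X2 k U s t\<bar>) + l t / 2 * (\<bar>X3 k U t\<bar> + e)"
      by linarith
  qed
  have lin: "\<bar>(\<Sum>d=1..D. Q d) - log_weight T (limit_potential U) k\<bar> \<le>
    (\<Sum>t=1..T. \<bar>X1 k U t\<bar> + (\<Sum>s\<in>{1..<t}. \<bar>X2 k U s t\<bar>) + l t / 2 * (\<bar>X3 k U t\<bar> + e))"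
    unfolding eq by (rule le)
  have tri: "\<bar>a - b\<bar> \<le> v + u" if "\<bar>a - q\<bar> \<le> u" "\<bar>q - b\<bar> \<le> v" for a b q u v :: real
    using that by linarith
  show ?thesis unfolding error_bound_def by (rule tri[OF rem lin])
qed

end

section \<open>Mean size of the error terms\<close>

context typical_point
begin

abbreviation "noise \<equiv> (\<Pi>\<^sub>M td\<in>{1..T} \<times> {1..D}. gauss 1) :: ('n::finite) noise measure"

lemma prob_space_noise: "prob_space (noise :: ('n::finite) noise measure)"
  by (rule prob_space_PiM) (simp add: prob_space_gauss)

text \<open>The squared coefficients add up to \<open>l t\<close> times the squared difference of
  \<open>sqrt (m t)\<close> and \<open>sqrt (I t)\<close>, which typicality bounds by
  \<open>l t * e\<close>.\<close>

lemma X1_bound: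
  assumes t: "t \<in> {1..T}"
  shows "integrable (noise :: ('n::finite) noise measure) (\<lambda>U. X1 k U t)"
    and "(\<integral>U. \<bar>X1 k U t\<bar> \<partial>(noise :: ('n::finite) noise measure)) \<le> sqrt (l t) * sqrt e"
proof -
  define c where "c d = (1 - r t) * sqrt (l t / real D) * f1 t (col d)" for d
  have pm: "pick (k t) \<in> borel_measurable (gauss 1 :: (real^'n) measure)"
    using pick_integrable(1)[of "k t" 1] by (simp add: borel_measurable_integrable)
  note L1 = PiM_L1_bound[where M="gauss 1 :: (real^'n) measure" and I="{1..T} \<times> {1..D}" and S="{1..D}"
      and idx="\<lambda>d. (t, d)" and F="pick (k t)" and c=c, OF _ _ _ _ _ pm pick_integrable(1) pick_mean]
  have idx: "finite ({1..T} \<times> {1..D})" "inj_on (\<lambda>d. (t, d)) {1..D}" "(\<lambda>d. (t, d)) ` {1..D} \<subseteq> {1..T} \<times> {1..D}"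
    using t by (auto intro: inj_onI)
  show "integrable (noise :: 'n noise measure) (\<lambda>U. X1 k U t)"
    unfolding X1_def c_def[symmetric] by (rule L1(1)) (use idx in \<open>simp_all add: prob_space_gauss\<close>)
  have "(\<integral>U. \<bar>X1 k U t\<bar> \<partial>(noise :: 'n noise measure)) \<le>
      sqrt (of_bool (k t \<noteq> None) * (\<Sum>d=1..D. (c d)\<^sup>2))"
    unfolding X1_def c_def[symmetric] pick_second_moment[symmetric] by (rule L1(2)) (use idx in \<open>simp_all add: prob_space_gauss\<close>)
  also have "\<dots> \<le> sqrt (l t * e)"
  proof (rule real_sqrt_le_mono)
    have "(\<Sum>d=1..D. (c d)\<^sup>2) = (1 - r t)\<^sup>2 * (sqrt (l t / real D))\<^sup>2 * (\<Sum>d=1..D. (f1 t (col d))\<^sup>2)"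
      by (simp add: c_def power_mult_distrib sum_distrib_left mult.assoc)
    also have "\<dots> = (1 - r t)\<^sup>2 * (l t / real D) * (real D * m t)"
      using l[OF t] D_pos by simp
    also have "\<dots> = l t * (sqrt (m t) - r t * sqrt (m t))\<^sup>2"
    proof -
      have "(sqrt q - a * sqrt q)\<^sup>2 = (1 - a)\<^sup>2 * q" if "0 < q" for a q :: real
      proof -
        have "(sqrt q - a * sqrt q)\<^sup>2 = (1 - a)\<^sup>2 * (sqrt q)\<^sup>2"
          by (simp add: power_mult_distrib[symmetric] left_diff_distrib)
        then show ?thesis using that by simp
      qed
      then show ?thesis using m_pos[OF t] D_pos by simp
    qed
    also have "\<dots> \<le> l t * \<bar>m t - I t\<bar>"
      unfolding r_sqrt_m[OF t] using m_pos[OF t] fisher_info_pos[OF t] l[OF t]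
      by (intro mult_left_mono sqrt_diff_square_le) auto
    also have "\<dots> \<le> l t * e" using typical1[OF t] l[OF t] by (intro mult_left_mono) auto
    finally have "(\<Sum>d=1..D. (c d)\<^sup>2) \<le> l t * e" .
    then show "of_bool (k t \<noteq> None) * (\<Sum>d=1..D. (c d)\<^sup>2) \<le> l t * e"
      using e_nonneg l[OF t] by (cases "k t") (simp_all)
  qed
  finally show "(\<integral>U. \<bar>X1 k U t\<bar> \<partial>(noise :: 'n noise measure)) \<le> sqrt (l t) * sqrt e"
    by (simp add: real_sqrt_mult)
qed

lemma sum_f2_square_le:
  assumes "s \<in> {1..T}" "t \<in> {1..T}"
  shows "(\<Sum>d=1..D. (a * f2 s t (col d))\<^sup>2) \<le> real D * (a * B)\<^sup>2"
proof -
  have "(a * f2 s t (col d))\<^sup>2 \<le> (a * B)\<^sup>2" for d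
  proof -
    have "\<bar>f2 s t (col d)\<bar> \<le> \<bar>B\<bar>" using B assms B0 by simp
    then show ?thesis by (simp add: abs_le_square_iff[symmetric] abs_mult mult_left_mono)
  qed
  then have "(\<Sum>d=1..D. (a * f2 s t (col d))\<^sup>2) \<le> (\<Sum>d=1..D. (a * B)\<^sup>2)" by (rule sum_mono)
  then show ?thesis by simp
qed

text \<open>Each of the D squared coefficients is at most l_s l_t B^2 / D^2, which leaves a second
  moment of order 1/D.\<close>

lemma X2_bound:
  assumes s: "s \<in> {1..T}" and t: "t \<in> {1..T}" and st: "s \<noteq> t"
  shows "integrable (noise :: ('n::finite) noise measure) (\<lambda>U. X2 k U s t)"
    and "(\<integral>U. \<bar>X2 k U s t\<bar> \<partial>(noise :: ('n::finite) noise measure)) \<le> sqrt (l s * l t) * (B / sqrt (real D))"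
proof -
  define a where "a = sqrt (l s / real D) * sqrt (l t / real D)"
  define c where "c d = a * f2 s t (col d)" for d
  have pm: "pick j \<in> borel_measurable (gauss 1 :: (real^'n) measure)" for j
    using pick_integrable(1)[of j 1] by (simp add: borel_measurable_integrable)
  have G: "prob_space (gauss 1 :: (real^'n) measure)" by (simp add: prob_space_gauss)
  have idx: "finite ({1..T} \<times> {1..D})" "finite {1..D}" "inj_on (\<lambda>d. (s, d)) {1..D}" "inj_on (\<lambda>d. (t, d)) {1..D}"
    "(\<lambda>d. (s, d)) ` {1..D} \<subseteq> {1..T} \<times> {1..D}" "(\<lambda>d. (t, d)) ` {1..D} \<subseteq> {1..T} \<times> {1..D}"
    "(\<lambda>d. (s, d)) ` {1..D} \<inter> (\<lambda>d. (t, d)) ` {1..D} = {}"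
    using s t st by (auto intro: inj_onI)
  note L1 = PiM_L1_bound_cross[where c=c, OF G idx pm pick_integrable(1) pick_mean pm pick_integrable(1) pick_mean, of "k s" "k t"]
  show "integrable (noise :: 'n noise measure) (\<lambda>U. X2 k U s t)"
    unfolding X2_def a_def[symmetric] c_def[symmetric] by (rule L1(1))
  have "(\<integral>U. \<bar>X2 k U s t\<bar> \<partial>(noise :: 'n noise measure)) \<le>
      sqrt (of_bool (k s \<noteq> None) * of_bool (k t \<noteq> None) * (\<Sum>d=1..D. (c d)\<^sup>2))"
    unfolding X2_def a_def[symmetric] c_def[symmetric] using L1(2) unfolding pick_second_moment .
  also have "\<dots> \<le> sqrt (l s * l t * (B / sqrt (real D))\<^sup>2)"
  proof (rule real_sqrt_le_mono)
    have "(\<Sum>d=1..D. (c d)\<^sup>2) \<le> real D * (a * B)\<^sup>2"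
      unfolding c_def by (rule sum_f2_square_le[OF s t])
    also have "\<dots> = l s * l t * (B / sqrt (real D))\<^sup>2"
      using l[OF s] l[OF t] D_pos by (simp add: a_def power_mult_distrib power_divide field_simps)
    finally have le: "(\<Sum>d=1..D. (c d)\<^sup>2) \<le> l s * l t * (B / sqrt (real D))\<^sup>2" .
    have "of_bool (k s \<noteq> None) * of_bool (k t \<noteq> None) * (\<Sum>d=1..D. (c d)\<^sup>2) \<le> (\<Sum>d=1..D. (c d)\<^sup>2)"
      by (cases "k s"; cases "k t") (simp_all add: sum_nonneg)
    then show "of_bool (k s \<noteq> None) * of_bool (k t \<noteq> None) * (\<Sum>d=1..D. (c d)\<^sup>2) \<le> l s * l t * (B / sqrt (real D))\<^sup>2"
      using le by linarith
  qed
  also have "\<dots> = sqrt (l s * l t) * (B / sqrt (real D))"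
  proof -
    have "sqrt (q * b\<^sup>2) = sqrt q * b" if "0 \<le> b" for q b :: real
      using that by (simp add: real_sqrt_mult)
    then show ?thesis using B0 by simp
  qed
  finally show "(\<integral>U. \<bar>X2 k U s t\<bar> \<partial>(noise :: 'n noise measure)) \<le> sqrt (l s * l t) * (B / sqrt (real D))" .
qed

text \<open>Centring makes the squared increments orthogonal. Their variance is 2 for a proposal and
  0 for \<open>None\<close>, estimated by 3 in both cases.\<close>

lemma X3_bound:
  assumes t: "t \<in> {1..T}"
  shows "integrable (noise :: ('n::finite) noise measure) (\<lambda>U. X3 k U t)"
    and "(\<integral>U. \<bar>X3 k U t\<bar> \<partial>(noise :: ('n::finite) noise measure)) \<le> sqrt 3 * (B / sqrt (real D))"
proof -
  define b where "b = (of_bool (k t \<noteq> None) :: real)"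
  define c where "c d = (1 / real D) * f2 t t (col d)" for d
  define F where "F v = (pick (k t) v)\<^sup>2 - b" for v :: "real^'n"
  have X3: "X3 k U t = (\<Sum>d=1..D. c d * F (U (t, d)))" for U :: "nat \<times> nat \<Rightarrow> real^'n"
    by (simp add: X3_def c_def F_def b_def)
  have G: "prob_space (gauss 1 :: (real^'n) measure)" by (simp add: prob_space_gauss)
  interpret G: prob_space "gauss 1 :: (real^'n) measure" by (rule G)
  have pU: "G.prob UNIV = 1" using G.prob_space by simp
  have Fi: "integrable (gauss 1) F"
    unfolding F_def using pick_integrable(1)[of "k t" 2] by simp
  have F2: "(F v)\<^sup>2 = (pick (k t) v) ^ 4 - 2 * b * (pick (k t) v)\<^sup>2 + b\<^sup>2" for v
    by (simp add: F_def power2_diff power_mult[symmetric])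
  have F2i: "integrable (gauss 1) (\<lambda>v. (F v)\<^sup>2)"
    unfolding F2 using pick_integrable(1)[of "k t" 2] pick_integrable(1)[of "k t" 4] by simp
  have F0: "(\<integral>v. F v \<partial>gauss 1) = 0"
    unfolding F_def using pick_integrable(1)[of "k t" 2] by (simp add: pick_second_moment pU b_def)
  have EF2: "(\<integral>v. (F v)\<^sup>2 \<partial>gauss 1) \<le> 3"
  proof -
    have "(\<integral>v. (F v)\<^sup>2 \<partial>gauss 1) = 3 * b - 2 * b * b + b\<^sup>2"
      unfolding F2 using pick_integrable(1)[of "k t" 2] pick_integrable(1)[of "k t" 4]
      by (simp add: pick_second_moment pick_fourth_moment pU b_def)
    also have "\<dots> \<le> 3" by (simp add: b_def)
    finally show ?thesis .
  qed
  have idx: "finite ({1..T} \<times> {1..D})" "finite {1..D}" "inj_on (\<lambda>d. (t, d)) {1..D}" "(\<lambda>d. (t, d)) ` {1..D} \<subseteq> {1..T} \<times> {1..D}"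
    using t by (auto intro: inj_onI)
  note L1 = PiM_L1_bound[where c=c, OF G idx borel_measurable_integrable[OF Fi] F2i F0]
  show "integrable (noise :: 'n noise measure) (\<lambda>U. X3 k U t)"
    unfolding X3 by (rule L1(1))
  have "(\<integral>U. \<bar>X3 k U t\<bar> \<partial>(noise :: 'n noise measure)) \<le> sqrt ((\<integral>v. (F v)\<^sup>2 \<partial>gauss 1) * (\<Sum>d=1..D. (c d)\<^sup>2))"
    unfolding X3 by (rule L1(2))
  also have "\<dots> \<le> sqrt (3 * (B / sqrt (real D))\<^sup>2)"
  proof (intro real_sqrt_le_mono mult_mono EF2)
    have "(\<Sum>d=1..D. (c d)\<^sup>2) \<le> real D * (1 / real D * B)\<^sup>2"
      unfolding c_def by (rule sum_f2_square_le[OF t t])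
    also have "\<dots> = (B / sqrt (real D))\<^sup>2"
      using D_pos by (simp add: power_mult_distrib power_divide power2_eq_square)
    finally show "(\<Sum>d=1..D. (c d)\<^sup>2) \<le> (B / sqrt (real D))\<^sup>2" .
  qed (simp_all add: sum_nonneg)
  also have "\<dots> = sqrt 3 * (B / sqrt (real D))"
  proof -
    have "sqrt (3 * b\<^sup>2) = sqrt 3 * b" if "0 \<le> b" for b :: real
      using that by (simp add: real_sqrt_mult)
    then show ?thesis using B0 by simp
  qed
  finally show "(\<integral>U. \<bar>X3 k U t\<bar> \<partial>(noise :: 'n noise measure)) \<le> sqrt 3 * (B / sqrt (real D))" .
qed

text \<open>Each of the D components contributes cubed step lengths of order D^(-3/2) times third
  absolute moments at most 2; their sum is of order D^(-1/2).\<close>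

lemma X4_bound:
  shows "integrable (noise :: ('n::finite) noise measure) (X4 k)"
    and "(\<integral>U. X4 k U \<partial>(noise :: ('n::finite) noise measure)) \<le>
      L * real T ^ 3 * (\<Sum>t=1..T. 2 * sqrt (l t) ^ 3 / sqrt (real D))"
proof -
  let ?P = "noise :: 'n noise measure"
  have G: "prob_space (gauss 1 :: (real^'n) measure)" by (simp add: prob_space_gauss)
  have fin: "finite ({1..T} \<times> {1..D})" by simp
  define g where "g t d U = (sqrt (l t / real D) * \<bar>pick (k t) (U (t, d))\<bar>) ^ 3" for t d and U :: "nat \<times> nat \<Rightarrow> real^'n"
  have X4: "X4 k U = L * real T ^ 3 * (\<Sum>d=1..D. \<Sum>t=1..T. g t d U)" for U :: "nat \<times> nat \<Rightarrow> real^'n"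
    by (simp add: X4_def g_def)
  have g: "g t d = (\<lambda>U. sqrt (l t / real D) ^ 3 * \<bar>pick (k t) (U (t, d))\<bar> ^ 3)" for t d
    by (simp add: g_def fun_eq_iff power_mult_distrib)
  have s: "integrable ?P (\<lambda>U. \<bar>pick (k t) (U (t, d))\<bar> ^ 3)" "(\<integral>U. \<bar>pick (k t) (U (t, d))\<bar> ^ 3 \<partial>?P) \<le> 2"
    if "t \<in> {1..T}" "d \<in> {1..D}" for t d
  proof -
    have td: "(t, d) \<in> {1..T} \<times> {1..D}" using that by simp
    note P = PiM_expectation_single[OF G fin td pick_integrable(2)[of "k t" 3]]
    show "integrable ?P (\<lambda>U. \<bar>pick (k t) (U (t, d))\<bar> ^ 3)" by (rule P(1))
    show "(\<integral>U. \<bar>pick (k t) (U (t, d))\<bar> ^ 3 \<partial>?P) \<le> 2" unfolding P(2) by (rule pick_abs_third_moment)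
  qed
  have gi: "integrable ?P (g t d)" and Eg: "(\<integral>U. g t d U \<partial>?P) \<le> sqrt (l t / real D) ^ 3 * 2"
    if "t \<in> {1..T}" "d \<in> {1..D}" for t d
  proof -
    show "integrable ?P (g t d)" unfolding g by (intro integrable_mult_right s that)
    have "(\<integral>U. g t d U \<partial>?P) = sqrt (l t / real D) ^ 3 * (\<integral>U. \<bar>pick (k t) (U (t, d))\<bar> ^ 3 \<partial>?P)" unfolding g by simp
    also have "\<dots> \<le> sqrt (l t / real D) ^ 3 * 2"
      using l[OF that(1)] by (intro mult_left_mono s that) simp
    finally show "(\<integral>U. g t d U \<partial>?P) \<le> sqrt (l t / real D) ^ 3 * 2" .
  qed
  show "integrable ?P (X4 k)"
    unfolding X4[abs_def] by (intro integrable_mult_right Bochner_Integration.integrable_sum gi)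
  have "(\<integral>U. X4 k U \<partial>?P) = L * real T ^ 3 * (\<Sum>d=1..D. \<Sum>t=1..T. \<integral>U. g t d U \<partial>?P)"
  proof -
    have "(\<integral>U. (\<Sum>d=1..D. \<Sum>t=1..T. g t d U) \<partial>?P) = (\<Sum>d=1..D. \<integral>U. (\<Sum>t=1..T. g t d U) \<partial>?P)"
      by (rule Bochner_Integration.integral_sum) (intro Bochner_Integration.integrable_sum gi)
    also have "\<dots> = (\<Sum>d=1..D. \<Sum>t=1..T. \<integral>U. g t d U \<partial>?P)"
      by (intro sum.cong refl Bochner_Integration.integral_sum gi)
    finally show ?thesis unfolding X4 by simp
  qed
  also have "\<dots> \<le> L * real T ^ 3 * (\<Sum>d=1..D. \<Sum>t=1..T. sqrt (l t / real D) ^ 3 * 2)"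
    using L0 by (intro mult_left_mono sum_mono Eg mult_nonneg_nonneg) auto
  also have "(\<Sum>d=1..D. \<Sum>t=1..T. sqrt (l t / real D) ^ 3 * 2) = (\<Sum>t=1..T. 2 * sqrt (l t) ^ 3 / sqrt (real D))"
  proof -
    have "real D * (sqrt (l t / real D) ^ 3 * 2) = 2 * sqrt (l t) ^ 3 / sqrt (real D)" for t
    proof -
      have "real D = sqrt (real D) * sqrt (real D)" using D_pos by simp
      then have "real D / sqrt (real D) ^ 3 = 1 / sqrt (real D)"
        using D_pos by (simp add: power3_eq_cube field_simps)
      then have eq: "2 * y * (real D / sqrt (real D) ^ 3) = 2 * y / sqrt (real D)" for y by simp
      have "real D * (sqrt (l t / real D) ^ 3 * 2) = 2 * sqrt (l t) ^ 3 * (real D / sqrt (real D) ^ 3)"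
        by (simp add: real_sqrt_divide power_divide)
      then show ?thesis unfolding eq .
    qed
    then show ?thesis by (simp add: sum_distrib_left)
  qed
  finally show "(\<integral>U. X4 k U \<partial>?P) \<le> L * real T ^ 3 * (\<Sum>t=1..T. 2 * sqrt (l t) ^ 3 / sqrt (real D))" .
qed

lemma error_bound_expectation:
  shows "integrable (noise :: ('n::finite) noise measure) (error_bound k)"
    and "(\<integral>U. error_bound k U \<partial>(noise :: ('n::finite) noise measure)) \<le> weight_error T l B L e D"
proof -
  let ?P = "noise :: 'n noise measure"
  interpret P: prob_space ?P by (rule prob_space_noise)
  have i1: "integrable ?P (\<lambda>U. \<bar>X1 k U t\<bar>)" and i3: "integrable ?P (\<lambda>U. \<bar>X3 k U t\<bar>)" if "t \<in> {1..T}" for t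
    by (intro integrable_abs X1_bound X3_bound that)+
  have i2: "integrable ?P (\<lambda>U. \<bar>X2 k U s t\<bar>)" if "t \<in> {1..T}" "s \<in> {1..<t}" for s t
    by (intro integrable_abs X2_bound) (use that in auto)
  have i3': "integrable ?P (\<lambda>U. l t / 2 * (\<bar>X3 k U t\<bar> + e))" if "t \<in> {1..T}" for t
    using i3[OF that] by simp
  have it: "integrable ?P (\<lambda>U. \<bar>X1 k U t\<bar> + (\<Sum>s\<in>{1..<t}. \<bar>X2 k U s t\<bar>) + l t / 2 * (\<bar>X3 k U t\<bar> + e))" if "t \<in> {1..T}" for t
    using that by (intro Bochner_Integration.integrable_add Bochner_Integration.integrable_sum i1 i2 i3')
  show "integrable ?P (error_bound k)"
    unfolding error_bound_def[abs_def]
    by (intro Bochner_Integration.integrable_add Bochner_Integration.integrable_sum it X4_bound)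
  have "(\<integral>U. error_bound k U \<partial>?P) =
    (\<Sum>t=1..T. \<integral>U. \<bar>X1 k U t\<bar> + (\<Sum>s\<in>{1..<t}. \<bar>X2 k U s t\<bar>) + l t / 2 * (\<bar>X3 k U t\<bar> + e) \<partial>?P) + (\<integral>U. X4 k U \<partial>?P)"
    unfolding error_bound_def
    by (subst Bochner_Integration.integral_add, intro Bochner_Integration.integrable_sum it, assumption, rule X4_bound,
        subst Bochner_Integration.integral_sum, rule it, assumption, rule refl)
  also have "\<dots> \<le> weight_error T l B L e D"
    unfolding weight_error_def
  proof (intro add_mono sum_mono X4_bound)
    fix t assume t: "t \<in> {1..T}"
    have "(\<integral>U. \<bar>X1 k U t\<bar> + (\<Sum>s\<in>{1..<t}. \<bar>X2 k U s t\<bar>) + l t / 2 * (\<bar>X3 k U t\<bar> + e) \<partial>?P) =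
      (\<integral>U. \<bar>X1 k U t\<bar> \<partial>?P) + (\<Sum>s\<in>{1..<t}. \<integral>U. \<bar>X2 k U s t\<bar> \<partial>?P) + l t / 2 * ((\<integral>U. \<bar>X3 k U t\<bar> \<partial>?P) + e)"
    proof -
      have "(\<integral>U. l t / 2 * (\<bar>X3 k U t\<bar> + e) \<partial>?P) = l t / 2 * ((\<integral>U. \<bar>X3 k U t\<bar> \<partial>?P) + e)"
        using i3[OF t] by (simp add: P.prob_space)
      moreover have "(\<integral>U. (\<Sum>s\<in>{1..<t}. \<bar>X2 k U s t\<bar>) \<partial>?P) = (\<Sum>s\<in>{1..<t}. \<integral>U. \<bar>X2 k U s t\<bar> \<partial>?P)"
        by (rule Bochner_Integration.integral_sum) (rule i2[OF t])
      moreover have "integrable ?P (\<lambda>U. \<Sum>s\<in>{1..<t}. \<bar>X2 k U s t\<bar>)"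
        by (intro Bochner_Integration.integrable_sum i2 t)
      ultimately show ?thesis
        using i1[OF t] i3'[OF t] by simp
    qed
    also have "\<dots> \<le> sqrt (l t) * sqrt e + (\<Sum>s\<in>{1..<t}. sqrt (l s * l t) * (B / sqrt (real D)))
       + l t / 2 * (sqrt 3 * (B / sqrt (real D)) + e)"
    proof (intro add_mono X1_bound(2) t sum_mono mult_left_mono X3_bound(2) order_refl)
      fix s assume "s \<in> {1..<t}"
      then show "(\<integral>U. \<bar>X2 k U s t\<bar> \<partial>?P) \<le> sqrt (l s * l t) * (B / sqrt (real D))"
        using t by (intro X2_bound(2)) auto
    qed (use l[OF t] in simp)
    finally show "(\<integral>U. \<bar>X1 k U t\<bar> + (\<Sum>s\<in>{1..<t}. \<bar>X2 k U s t\<bar>) + l t / 2 * (\<bar>X3 k U t\<bar> + e) \<partial>?P) \<le>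
      sqrt (l t) * sqrt e + (\<Sum>s\<in>{1..<t}. sqrt (l s * l t) * (B / sqrt (real D)))
       + l t / 2 * (sqrt 3 * (B / sqrt (real D)) + e)" .
  qed
  finally show "(\<integral>U. error_bound k U \<partial>?P) \<le> weight_error T l B L e D" .
qed

end

lemma softmax_measurable:
  assumes "\<And>j. j \<in> J \<Longrightarrow> (\<lambda>u. a u j) \<in> borel_measurable M" "k \<in> J"
  shows "(\<lambda>u. softmax J (a u) k) \<in> borel_measurable M"
proof -
  have e: "(\<lambda>u. exp (a u j)) \<in> borel_measurable M" if "j \<in> J" for j
    using assms(1)[OF that] by measurable
  show ?thesis unfolding softmax_def
    by (intro borel_measurable_divide borel_measurable_sum e assms(2))
qed

section \<open>Total variation bound at a typical point\<close>

context typical_point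
begin

lemma f_measurable: "f \<in> borel_measurable (leb T)"
  by (rule borel_measurable_PiM_continuous[OF continuous_partials_log_density(1)[OF C2 pos] sets_lborel])

lemma f_on_coords: "on_coords T f"
  unfolding on_coords_def log_density_def using on_coordsD[OF on] by metis

lemma noise_component_measurable:
  assumes "t \<in> {1..T}" "d \<in> {1..D}"
  shows "(\<lambda>U. U (t, d)) \<in> borel_measurable (noise :: ('n::finite) noise measure)"
proof -
  have "(\<lambda>U. U (t, d)) \<in> measurable (noise :: 'n noise measure) (gauss 1)"
    by (rule measurable_component_singleton) (use assms in simp)
  then show ?thesis unfolding measurable_cong_sets[OF refl sets_gauss] .
qed

lemma log_ratio_measurable:
  "(\<lambda>U. log_ratio U k) \<in> borel_measurable (noise :: ('n::finite) noise measure)"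
proof -
  let ?P = "noise :: 'n noise measure"
  have "(\<lambda>U. f (\<lambda>t. proposal l D x U t (k t) d)) \<in> borel_measurable ?P" if d: "d \<in> {1..D}" for d
  proof -
    have "(\<lambda>U. proposal l D x U t (k t) d) \<in> measurable ?P lborel" if t: "t \<in> {1..T}" for t
    proof -
      have "proposal l D x U t (k t) d = x t d + sqrt (l t / real D) * pick (k t) (U (t, d))" for U :: "nat \<times> nat \<Rightarrow> real^'n"
        by (cases "k t") (simp_all add: proposal_def)
      moreover have "(\<lambda>U. x t d + sqrt (l t / real D) * pick (k t) (U (t, d))) \<in> borel_measurable ?P"
        by (intro borel_measurable_add borel_measurable_times borel_measurable_const pick_measurable
          noise_component_measurable t d)
      ultimately show ?thesis unfolding measurable_cong_sets[OF refl sets_lborel] by (simp only:)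
    qed
    then have "(\<lambda>U. \<lambda>t\<in>{1..T}. proposal l D x U t (k t) d) \<in> measurable ?P (leb T)"
      by (rule measurable_restrict)
    from measurable_compose[OF this f_measurable]
    have m: "(\<lambda>U. f (\<lambda>t\<in>{1..T}. proposal l D x U t (k t) d)) \<in> borel_measurable ?P" .
    have "f (\<lambda>t\<in>{1..T}. proposal l D x U t (k t) d) = f (\<lambda>t. proposal l D x U t (k t) d)" for U :: "nat \<times> nat \<Rightarrow> real^'n"
      by (rule on_coordsD[OF f_on_coords]) simp
    then show ?thesis using m by (simp only:)
  qed
  then show ?thesis
    unfolding log_ratio_def by (intro borel_measurable_sum borel_measurable_diff borel_measurable_const)
qed

lemma limit_potential_component_measurable:
  assumes "t \<in> {1..T}"
  shows "(\<lambda>U. limit_potential U t) \<in> borel_measurable (noise :: ('n::finite) noise measure)"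
  unfolding limit_potential_def
  by (intro borel_measurable_add borel_measurable_sum borel_measurable_scaleR borel_measurable_const
    noise_component_measurable assms)

text \<open>Dividing all weights by that of the current state leaves the selection probabilities
  unchanged and makes the exponents comparable with \<open>log_weight\<close>.\<close>

lemma ehmm_selection_eq:
  "ehmm_selection T p l D x U = point_measure (index_vectors T)
    (\<lambda>k. ennreal (softmax (index_vectors T) (log_ratio U) (k :: nat \<Rightarrow> ('n::finite) option)))"
proof -
  define c where "c = (\<Sum>d=1..D. f (col d))"
  have w: "ehmm_weight p l D x U k = exp (c + log_ratio U k)" for k :: "nat \<Rightarrow> 'n option"
  proof -
    have "c + log_ratio U k = (\<Sum>d=1..D. f (\<lambda>t. proposal l D x U t (k t) d))"
      by (simp add: c_def log_ratio_def sum_subtractf)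
    then show ?thesis
      by (simp add: ehmm_weight_def target_density_def exp_sum log_density_def pos)
  qed
  have "ehmm_weight p l D x U k / (\<Sum>j\<in>index_vectors T. ehmm_weight p l D x U j) =
      softmax (index_vectors T) (log_ratio U) k" for k :: "nat \<Rightarrow> 'n option"
    unfolding w using softmax_shift[OF finite_index_vectors index_vectors_nonempty, where c=c and a="log_ratio U" and k=k]
    by (simp only: softmax_def)
  then show ?thesis unfolding ehmm_selection_def by simp
qed

text \<open>Atoms of both laws are expected softmax weights under the same noise, so they differ by
  at most the expected difference of weights. One factor \<open>card\<close> comes from bounding the
  largest error over index vectors by the sum of the errors, the other from summing over the
  atoms.\<close>

lemma tv_dist_le:
  shows "0 \<le> tv_dist (ehmm_index_law T p l D x :: (nat \<Rightarrow> ('n::finite) option) measure) (limit_index_law T p l)"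
    and "tv_dist (ehmm_index_law T p l D x :: (nat \<Rightarrow> 'n option) measure) (limit_index_law T p l) \<le>
      2 * (real (card (index_vectors T :: (nat \<Rightarrow> 'n option) set)))\<^sup>2 * weight_error T l B L e D"
proof -
  let ?J = "index_vectors T :: (nat \<Rightarrow> 'n option) set"
  let ?P = "noise :: 'n noise measure"
  let ?V = "\<Pi>\<^sub>M t\<in>{1..T}. mv_normal (\<chi> n. - (l t * I t) / 2) ((l t * I t) *\<^sub>R (Sigma_cov :: real^'n^'n))"
  let ?X = "\<lambda>U. \<lambda>t\<in>{1..T}. limit_potential U t :: real^'n"
  note J = finite_index_vectors[of T, where 'n='n] index_vectors_nonempty[of T, where 'n='n]
  interpret P: prob_space ?P by (rule prob_space_noise)
  have c: "0 < l t * I t" if "t \<in> {1..T}" for t using l[OF that] fisher_info_pos[OF that] by simp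
  \<comment> \<open>The coupling: the limiting potentials are realised as a function of the proposal
    noise.\<close>
  have V: "?V = distr ?P (\<Pi>\<^sub>M t\<in>{1..T}. borel) ?X"
    unfolding limit_potential_def by (rule distr_affine_gauss[OF T c limit_potential_variance, symmetric]; assumption)
  have X: "?X \<in> measurable ?P (\<Pi>\<^sub>M t\<in>{1..T}. borel)"
    by (intro measurable_restrict limit_potential_component_measurable)
  have pV: "prob_space ?V" by (intro prob_space_PiM prob_space_mv_normal c)
  define A where "A = (ehmm_index_law T p l D x :: (nat \<Rightarrow> 'n option) measure)"
  define Bl where "Bl = (limit_index_law T p l :: (nat \<Rightarrow> 'n option) measure)"
  have A_eq: "A = ?P \<bind> (\<lambda>U. point_measure ?J (\<lambda>k. ennreal (softmax ?J (log_ratio U) k)))"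
    unfolding A_def ehmm_index_law_def mv_normal_Sigma_cov_eq_gauss ehmm_selection_eq[abs_def] ..
  have B_eq: "Bl = ?V \<bind> (\<lambda>V. point_measure ?J (\<lambda>k. ennreal (softmax ?J (log_weight T V) k)))"
    unfolding Bl_def limit_index_law_def PiM_point_measure_Psi ..
  have lwm: "(\<lambda>V. log_weight T V k) \<in> borel_measurable (\<Pi>\<^sub>M t\<in>{1..T}. borel :: (real^'n) measure)" for k
    unfolding log_weight_def
    by (intro borel_measurable_sum pick_measurable measurable_component_singleton)
  have ma: "(\<lambda>U. softmax ?J (log_ratio U) k) \<in> borel_measurable ?P" if "k \<in> ?J" for k
    by (rule softmax_measurable[OF log_ratio_measurable that])
  have mb: "(\<lambda>V. softmax ?J (log_weight T V) k) \<in> borel_measurable (\<Pi>\<^sub>M t\<in>{1..T}. borel)" if "k \<in> ?J" for k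
    by (rule softmax_measurable[OF lwm that])
  have sV: "sets ?V = sets (\<Pi>\<^sub>M t\<in>{1..T}. borel :: (real^'n) measure)"
    by (intro sets_PiM_cong refl sets_mv_normal)
  have mbV: "(\<lambda>V. softmax ?J (log_weight T V) k) \<in> borel_measurable ?V" if "k \<in> ?J" for k
    unfolding measurable_cong_sets[OF sV refl] by (rule mb[OF that])
  note LA = bind_point_measure[OF J prob_space_noise, where w="\<lambda>U. softmax ?J (log_ratio U)",
      OF ma softmax_nonneg[OF J] sum_softmax[OF J], folded A_eq]
  note LB = bind_point_measure[OF J pV, where w="\<lambda>V. softmax ?J (log_weight T V)",
      OF mbV softmax_nonneg[OF J] sum_softmax[OF J], folded B_eq]
  have sets: "sets A = Pow ?J" "prob_space A" "sets Bl = Pow ?J" "prob_space Bl"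
    using LA(1,2) LB(1,2) by blast+
  show "0 \<le> tv_dist (ehmm_index_law T p l D x :: (nat \<Rightarrow> 'n option) measure) (limit_index_law T p l)"
    using tv_dist_finite(1)[OF J sets(2,1,4,3)] unfolding A_def Bl_def .
  have mbP: "(\<lambda>U. softmax ?J (log_weight T (limit_potential U)) k) \<in> borel_measurable ?P"
    and intB: "measure Bl {k} = (\<integral>U. softmax ?J (log_weight T (limit_potential U)) k \<partial>?P)" if k: "k \<in> ?J" for k
  proof -
    have lw: "log_weight T (?X U) = log_weight T (limit_potential U)" for U
      unfolding log_weight_def by (intro ext sum.cong refl) simp
    show "(\<lambda>U. softmax ?J (log_weight T (limit_potential U)) k) \<in> borel_measurable ?P"
      using measurable_compose[OF X mb[OF k]] unfolding lw .
    have "measure Bl {k} = (\<integral>V. softmax ?J (log_weight T V) k \<partial>?V)" by (rule LB(3)[OF _ k])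
    also have "\<dots> = (\<integral>U. softmax ?J (log_weight T (?X U)) k \<partial>?P)"
      unfolding V by (rule integral_distr[OF X mb[OF k]])
    finally show "measure Bl {k} = (\<integral>U. softmax ?J (log_weight T (limit_potential U)) k \<partial>?P)" unfolding lw .
  qed
  have main: "\<bar>measure A {k} - measure Bl {k}\<bar> \<le> 2 * (real (card ?J) * weight_error T l B L e D)" if k: "k \<in> ?J" for k
  proof -
    define a b where "a U = softmax ?J (log_ratio U) k" and "b U = softmax ?J (log_weight T (limit_potential U)) k" for U
    have bd: "norm (a U) \<le> 1" "norm (b U) \<le> 1" for U
      unfolding a_def b_def using softmax_nonneg[OF J] softmax_le_1[OF J k] by simp_all
    have ia: "integrable ?P a" unfolding a_def[abs_def]
      by (rule P.integrable_const_bound[OF AE_I2 ma[OF k]]) (rule bd(1)[unfolded a_def])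
    have ib: "integrable ?P b" unfolding b_def[abs_def]
      by (rule P.integrable_const_bound[OF AE_I2 mbP[OF k]]) (rule bd(2)[unfolded b_def])
    have "measure A {k} = (\<integral>U. a U \<partial>?P)" unfolding a_def by (rule LA(3)[OF _ k])
    moreover have "measure Bl {k} = (\<integral>U. b U \<partial>?P)" unfolding b_def by (rule intB[OF k])
    ultimately have "\<bar>measure A {k} - measure Bl {k}\<bar> = \<bar>\<integral>U. a U - b U \<partial>?P\<bar>"
      using ia ib by simp
    also have "\<dots> \<le> (\<integral>U. \<bar>a U - b U\<bar> \<partial>?P)" by (rule integral_abs_bound)
    also have "\<dots> \<le> (\<integral>U. 2 * (\<Sum>j\<in>?J. error_bound j U) \<partial>?P)"
    proof (rule integral_mono)
      show "integrable ?P (\<lambda>U. \<bar>a U - b U\<bar>)" using ia ib by (intro integrable_abs Bochner_Integration.integrable_diff)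
      show "integrable ?P (\<lambda>U. 2 * (\<Sum>j\<in>?J. error_bound j U))"
        by (intro integrable_mult_right Bochner_Integration.integrable_sum error_bound_expectation)
      fix U :: "nat \<times> nat \<Rightarrow> real^'n"
      show "\<bar>a U - b U\<bar> \<le> 2 * (\<Sum>j\<in>?J. error_bound j U)"
        unfolding a_def b_def
      proof (rule softmax_lipschitz[OF J k])
        fix j assume j: "j \<in> ?J"
        have nn: "0 \<le> error_bound i U" for i
          by (rule order_trans[OF abs_ge_zero log_ratio_close])
        have "\<bar>log_ratio U j - log_weight T (limit_potential U) j\<bar> \<le> error_bound j U" by (rule log_ratio_close)
        also have "\<dots> \<le> (\<Sum>j\<in>?J. error_bound j U)"
          by (rule member_le_sum[OF j nn J(1)])
        finally show "\<bar>log_ratio U j - log_weight T (limit_potential U) j\<bar> \<le> (\<Sum>j\<in>?J. error_bound j U)" .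
      qed
    qed
    also have "\<dots> = 2 * (\<Sum>j\<in>?J. \<integral>U. error_bound j U \<partial>?P)"
      by (simp add: Bochner_Integration.integral_sum[OF error_bound_expectation(1)])
    also have "\<dots> \<le> 2 * (\<Sum>j\<in>?J. weight_error T l B L e D)"
      by (intro mult_left_mono sum_mono error_bound_expectation) simp
    finally show ?thesis by simp
  qed
  have "tv_dist A Bl \<le> (\<Sum>k\<in>?J. \<bar>measure A {k} - measure Bl {k}\<bar>)"
    by (rule tv_dist_finite(2)[OF J sets(2,1,4,3)])
  also have "\<dots> \<le> (\<Sum>k\<in>?J. 2 * (real (card ?J) * weight_error T l B L e D))" by (rule sum_mono) (rule main)
  also have "\<dots> = 2 * (real (card ?J))\<^sup>2 * weight_error T l B L e D" by (simp add: power2_eq_square)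
  finally show "tv_dist (ehmm_index_law T p l D x :: (nat \<Rightarrow> 'n option) measure) (limit_index_law T p l) \<le>
      2 * (real (card ?J))\<^sup>2 * weight_error T l B L e D" unfolding A_def Bl_def .
qed

end

section \<open>Typical sets and the limit theorem\<close>

context smooth_target
begin

text \<open>The strict inequalities make this set the complement of the deviation events in
  \<open>target_law_weak_law\<close>.\<close>

definition typical_set :: "nat \<Rightarrow> real \<Rightarrow> (nat \<Rightarrow> nat \<Rightarrow> real) set" where
  "typical_set D e = {x \<in> space (states T D). \<forall>t\<in>{1..T}.
    \<bar>(\<Sum>d=1..D. (f1 t (\<lambda>t. x t d))\<^sup>2) / real D - I t\<bar> < e \<and>
    \<bar>(\<Sum>d=1..D. f2 t t (\<lambda>t. x t d)) / real D + I t\<bar> < e}"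

text \<open>Chebyshev's inequality and a union bound. The constant is the sum of the variances of
  squared scores and diagonal second derivatives; it depends on neither \<open>D\<close> nor
  \<open>e\<close>, so the tolerance may shrink with the dimension.\<close>

lemma typical_set_prob:
  "\<exists>C. \<forall>D\<ge>1. \<forall>e>0. typical_set D e \<in> sets (states T D) \<and>
    1 - C / (real D * e\<^sup>2) \<le> measure (target_law T p D) (typical_set D e)"
proof -
  define v where "v g = (\<integral>y. (g y - (\<integral>y. g y \<partial>path_law T p))\<^sup>2 \<partial>path_law T p)" for g :: "(nat \<Rightarrow> real) \<Rightarrow> real"
  have f1on: "on_coords T (f1 t)" if "t \<in> {1..T}" for t
    by (rule on_coords_partial[OF _ that]) (unfold on_coords_def log_density_def, metis on_coordsD[OF on])
  obtain B where B: "\<forall>s\<in>{1..T}. \<forall>t\<in>{1..T}. \<forall>x. \<bar>f2 s t x\<bar> \<le> B" using f2_bounded by blast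
  define C where "C = (\<Sum>t=1..T. v (\<lambda>y. (f1 t y)\<^sup>2) + v (f2 t t))"
  show ?thesis
  proof (intro exI[of _ C] allI impI)
    fix D :: nat and e :: real assume D: "1 \<le> D" and e: "0 < e"
    let ?Q = "states T D"
    interpret P: prob_space "target_law T p D" by (rule prob_space_target_law)
    have sQ: "sets (target_law T p D) = sets ?Q" "space (target_law T p D) = space ?Q"
      by (simp_all add: target_law_def)
    define A where "A g = {x \<in> space ?Q. e \<le> \<bar>(\<Sum>d=1..D. g (\<lambda>t. x t d)) / real D - (\<integral>y. g y \<partial>path_law T p)\<bar>}"
      for g :: "(nat \<Rightarrow> real) \<Rightarrow> real"
    have A1: "A (\<lambda>y. (f1 t y)\<^sup>2) \<in> sets ?Q" "measure (target_law T p D) (A (\<lambda>y. (f1 t y)\<^sup>2)) \<le> v (\<lambda>y. (f1 t y)\<^sup>2) / (real D * e\<^sup>2)"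
      if t: "t \<in> {1..T}" for t
    proof -
      have m: "(\<lambda>y. (f1 t y)\<^sup>2) \<in> borel_measurable (leb T)"
        by (intro borel_measurable_power f1_measurable t)
      have o: "on_coords T (\<lambda>y. (f1 t y)\<^sup>2)"
        unfolding on_coords_def using on_coordsD[OF f1on[OF t]] by metis
      have i: "integrable (path_law T p) (\<lambda>y. ((f1 t y)\<^sup>2)\<^sup>2)"
        using f1_power_integrable[OF t, of 4] by (simp add: power_mult[symmetric])
      show "A (\<lambda>y. (f1 t y)\<^sup>2) \<in> sets ?Q" "measure (target_law T p D) (A (\<lambda>y. (f1 t y)\<^sup>2)) \<le> v (\<lambda>y. (f1 t y)\<^sup>2) / (real D * e\<^sup>2)"
        unfolding A_def v_def by (rule target_law_weak_law[OF m o i D e])+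
    qed
    have A2: "A (f2 t t) \<in> sets ?Q" "measure (target_law T p D) (A (f2 t t)) \<le> v (f2 t t) / (real D * e\<^sup>2)"
      if t: "t \<in> {1..T}" for t
    proof -
      have m: "(\<lambda>y. (f2 t t y)\<^sup>2) \<in> borel_measurable (path_law T p)"
        unfolding measurable_cong_sets[OF sets_path_law refl] by (intro borel_measurable_power f2_measurable t)
      have b: "norm ((f2 t t y)\<^sup>2) \<le> B\<^sup>2" for y
      proof -
        have "\<bar>f2 t t y\<bar> \<le> B" using B t by blast
        then have "\<bar>f2 t t y\<bar>\<^sup>2 \<le> B\<^sup>2" by (rule power_mono) simp
        then show ?thesis by simp
      qed
      have i: "integrable (path_law T p) (\<lambda>y. (f2 t t y)\<^sup>2)"
        by (rule path.integrable_const_bound[OF AE_I2 m]) (rule b)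
      show "A (f2 t t) \<in> sets ?Q" "measure (target_law T p D) (A (f2 t t)) \<le> v (f2 t t) / (real D * e\<^sup>2)"
        unfolding A_def v_def
        by (rule target_law_weak_law[OF f2_measurable[OF t t] on_coords_partial[OF f1on[OF t] t] i D e])+
    qed
    define N where "N = (\<Union>t\<in>{1..T}. A (\<lambda>y. (f1 t y)\<^sup>2) \<union> A (f2 t t))"
    have N: "N \<in> sets ?Q" unfolding N_def by (intro sets.finite_UN sets.Un A1 A2) simp_all
    have F: "typical_set D e = space ?Q - N"
    proof (rule set_eqI)
      fix x
      have "(x \<in> A (\<lambda>y. (f1 t y)\<^sup>2) \<longleftrightarrow> \<not> \<bar>(\<Sum>d=1..D. (f1 t (\<lambda>t. x t d))\<^sup>2) / real D - I t\<bar> < e)"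
        "(x \<in> A (f2 t t) \<longleftrightarrow> \<not> \<bar>(\<Sum>d=1..D. f2 t t (\<lambda>t. x t d)) / real D + I t\<bar> < e)"
        if "x \<in> space ?Q" "t \<in> {1..T}" for t
        using that(1) unfolding A_def by (simp_all add: fisher_info_def[symmetric] fisher_identity[OF that(2)] not_less)
      then show "x \<in> typical_set D e \<longleftrightarrow> x \<in> space ?Q - N"
        unfolding typical_set_def N_def by blast
    qed
    show "typical_set D e \<in> sets ?Q \<and> 1 - C / (real D * e\<^sup>2) \<le> measure (target_law T p D) (typical_set D e)"
    proof
      show "typical_set D e \<in> sets ?Q" unfolding F by (intro sets.Diff sets.top N)
      have "measure (target_law T p D) N \<le> (\<Sum>t=1..T. measure (target_law T p D) (A (\<lambda>y. (f1 t y)\<^sup>2) \<union> A (f2 t t)))"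
        unfolding N_def
        by (rule P.finite_measure_subadditive_finite) (auto simp: sQ intro!: sets.Un A1 A2)
      also have "\<dots> \<le> (\<Sum>t=1..T. v (\<lambda>y. (f1 t y)\<^sup>2) / (real D * e\<^sup>2) + v (f2 t t) / (real D * e\<^sup>2))"
      proof (rule sum_mono)
        fix t assume t: "t \<in> {1..T}"
        have "measure (target_law T p D) (A (\<lambda>y. (f1 t y)\<^sup>2) \<union> A (f2 t t)) \<le>
          measure (target_law T p D) (A (\<lambda>y. (f1 t y)\<^sup>2)) + measure (target_law T p D) (A (f2 t t))"
          by (rule measure_Un_le) (unfold sQ, rule A1(1)[OF t], rule A2(1)[OF t])
        also have "\<dots> \<le> v (\<lambda>y. (f1 t y)\<^sup>2) / (real D * e\<^sup>2) + v (f2 t t) / (real D * e\<^sup>2)"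
          by (rule add_mono[OF A1(2)[OF t] A2(2)[OF t]])
        finally show "measure (target_law T p D) (A (\<lambda>y. (f1 t y)\<^sup>2) \<union> A (f2 t t)) \<le>
          v (\<lambda>y. (f1 t y)\<^sup>2) / (real D * e\<^sup>2) + v (f2 t t) / (real D * e\<^sup>2)" .
      qed
      also have "\<dots> = C / (real D * e\<^sup>2)"
        unfolding C_def sum_divide_distrib by (intro sum.cong refl) (rule add_divide_distrib[symmetric])
      finally have "measure (target_law T p D) N \<le> C / (real D * e\<^sup>2)" .
      moreover have "measure (target_law T p D) (typical_set D e) = 1 - measure (target_law T p D) N"
        unfolding F sQ(2)[symmetric] by (rule P.prob_compl) (unfold sQ, rule N)
      ultimately show "1 - C / (real D * e\<^sup>2) \<le> measure (target_law T p D) (typical_set D e)" by linarith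
    qed
  qed
qed

end

lemma weight_error_tendsto_0:
  assumes "(\<lambda>D. e D) \<longlonglongrightarrow> (0::real)"
  shows "(\<lambda>D. weight_error T l B L (e D) D) \<longlonglongrightarrow> 0"
proof -
  have s: "filterlim (\<lambda>D. sqrt (real D)) at_top sequentially"
    by (rule filterlim_compose[OF sqrt_at_top filterlim_real_sequentially])
  have i: "(\<lambda>D. c / sqrt (real D)) \<longlonglongrightarrow> 0" for c
    by (rule tendsto_divide_0[OF tendsto_const filterlim_at_top_imp_at_infinity[OF s]])
  have q: "(\<lambda>D. sqrt (e D)) \<longlonglongrightarrow> 0"
    using tendsto_real_sqrt[OF assms] by simp
  have "(\<lambda>D. weight_error T l B L (e D) D) \<longlonglongrightarrow>
     (\<Sum>t=1..T. sqrt (l t) * 0 + (\<Sum>s\<in>{1..<t}. sqrt (l s * l t) * 0)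
       + l t / 2 * (sqrt 3 * 0 + 0))
     + L * real T ^ 3 * (\<Sum>t=1..T. 0)"
    unfolding weight_error_def
    by (intro tendsto_add tendsto_sum tendsto_mult tendsto_const i q assms)
  then show ?thesis by simp
qed

section \<open>Feynman-Kac densities and passage to the limit\<close>

lemma on_coords_fk_density:
  assumes "1 \<le> T"
  shows "on_coords T (fk_density T m1 m G)"
  unfolding on_coords_def
proof (intro allI impI)
  fix x y :: "nat \<Rightarrow> real" assume eq: "\<forall>t\<in>{1..T}. x t = y t"
  have "(\<Prod>t=2..T. m t (x (t - 1)) (x t) * G t (x t)) = (\<Prod>t=2..T. m t (y (t - 1)) (y t) * G t (y t))"
  proof (rule prod.cong[OF refl])
    fix t assume "t \<in> {2..T}"
    then have "t \<in> {1..T}" "t - 1 \<in> {1..T}" by auto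
    then show "m t (x (t - 1)) (x t) * G t (x t) = m t (y (t - 1)) (y t) * G t (y t)" using eq by simp
  qed
  moreover have "x 1 = y 1" using eq assms by simp
  ultimately show "fk_density T m1 m G x = fk_density T m1 m G y"
    unfolding fk_density_def fk_unnorm_def by simp
qed

lemma prob_space_path_law_fk_density:
  assumes int: "integrable (leb T) (fk_unnorm T m1 m G)"
    and pos: "\<And>x. 0 < fk_density T m1 m G x"
  shows "prob_space (path_law T (fk_density T m1 m G))"
proof -
  let ?M = "leb T"
  define Z where "Z = (\<integral>z. fk_unnorm T m1 m G z \<partial>?M)"
  have d: "fk_density T m1 m G = (\<lambda>x. fk_unnorm T m1 m G x / Z)"
    by (simp add: fk_density_def Z_def fun_eq_iff)
  \<comment> \<open>Division by zero yields zero, so a vanishing normaliser would contradict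
    positivity of the density.\<close>
  have "Z \<noteq> 0" using pos[of undefined] by (auto simp: d)
  then have one: "(\<integral>x. fk_density T m1 m G x \<partial>?M) = 1" unfolding d by (simp add: Z_def[symmetric])
  have i: "integrable ?M (fk_density T m1 m G)" unfolding d using int by simp
  have "(\<integral>\<^sup>+x. ennreal (fk_density T m1 m G x) \<partial>?M) = ennreal 1"
    unfolding one[symmetric] by (rule nn_integral_eq_integral[OF i]) (simp add: less_imp_le[OF pos])
  moreover have "emeasure (path_law T (fk_density T m1 m G)) (space (path_law T (fk_density T m1 m G))) =
      (\<integral>\<^sup>+x. ennreal (fk_density T m1 m G x) \<partial>?M)"
    unfolding path_law_def space_density
    by (subst emeasure_density[OF measurable_compose[OF borel_measurable_integrable[OF i] measurable_ennreal] sets.top])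
      (rule nn_integral_cong, simp)
  ultimately show ?thesis by (intro prob_spaceI) simp
qed

theorem proposition3p2:
  fixes T :: nat
    and m1 :: "real \<Rightarrow> real" and m :: "nat \<Rightarrow> real \<Rightarrow> real \<Rightarrow> real" and G :: "nat \<Rightarrow> real \<Rightarrow> real"
    and p :: "(nat \<Rightarrow> real) \<Rightarrow> real" and l :: "nat \<Rightarrow> real"
  assumes T: "1 \<le> T"
    and l: "\<And>t. t \<in> {1..T} \<Longrightarrow> 0 < l t"
    and model: "fk_model T m1 m G"
    and normalizable: "integrable (\<Pi>\<^sub>M t\<in>{1..T}. lborel) (fk_unnorm T m1 m G)"
    and p: "p = fk_density T m1 m G"
    and pos: "\<And>x. 0 < p x"
    and C2: "twice_cont_diff T p"
    and lip: "\<And>s t. s \<in> {1..T} \<Longrightarrow> t \<in> {1..T} \<Longrightarrow>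
                euclid_lipschitz T (partial s (partial t (log_density p)))"
    and bdd: "\<And>s t. s \<in> {1..T} \<Longrightarrow> t \<in> {1..T} \<Longrightarrow>
                bounded (range (partial s (partial t (log_density p))))"
    and moment: "\<And>t. t \<in> {1..T} \<Longrightarrow>
                integrable (path_law T p) (\<lambda>x. \<bar>partial t (log_density p) x\<bar> ^ 4)"
  shows "\<exists>F :: nat \<Rightarrow> (nat \<Rightarrow> nat \<Rightarrow> real) set.
           (\<forall>D\<ge>1. F D \<in> sets (\<Pi>\<^sub>M t\<in>{1..T}. \<Pi>\<^sub>M d\<in>{1..D}. borel)) \<and>
           (\<lambda>D. measure (target_law T p D) (F D)) \<longlonglongrightarrow> 1 \<and>
           (\<lambda>D. SUP x\<in>F D. tv_dist (ehmm_index_law T p l D x :: (nat \<Rightarrow> ('n::finite) option) measure)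
                                     (limit_index_law T p l)) \<longlonglongrightarrow> 0"
proof -
  interpret smooth_target T p
  proof (rule smooth_target.intro)
    show "on_coords T p" unfolding p by (rule on_coords_fk_density[OF T])
    show "prob_space (path_law T p)"
      using prob_space_path_law_fk_density[OF normalizable pos[unfolded p]] unfolding p .
  qed (fact C2 pos lip bdd moment)+
  obtain C where C: "\<forall>D\<ge>1. \<forall>e>0. typical_set D e \<in> sets (states T D) \<and>
    1 - C / (real D * e\<^sup>2) \<le> measure (target_law T p D) (typical_set D e)"
    using typical_set_prob by blast
  obtain B where B: "0 \<le> B" "\<forall>s\<in>{1..T}. \<forall>t\<in>{1..T}. \<forall>x. \<bar>f2 s t x\<bar> \<le> B" using f2_bounded by blast
  obtain L where L: "0 \<le> L" "\<forall>s\<in>{1..T}. \<forall>t\<in>{1..T}. \<forall>x y. \<bar>f2 s t x - f2 s t y\<bar> \<le> L * L2_set (\<lambda>j. x j - y j) {1..T}"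
    using f2_lipschitz by blast
  \<comment> \<open>The fourth root lets \<open>e D\<close> vanish while
    \<open>real D * (e D)\<^sup>2\<close> equals \<open>sqrt (real D)\<close> and diverges, so that
    the exceptional probability vanishes too.\<close>
  define e where "e D = 1 / sqrt (sqrt (real D))" for D :: nat
  define F where "F D = typical_set D (e D)" for D
  have s: "filterlim (\<lambda>D. sqrt (real D)) at_top sequentially"
    by (rule filterlim_compose[OF sqrt_at_top filterlim_real_sequentially])
  have e0: "e \<longlonglongrightarrow> 0"
    unfolding e_def[abs_def]
    by (rule tendsto_divide_0[OF tendsto_const filterlim_at_top_imp_at_infinity[OF filterlim_compose[OF sqrt_at_top s]]])
  have epos: "0 < e D" if "1 \<le> D" for D using that by (simp add: e_def)
  have De: "real D * (e D)\<^sup>2 = sqrt (real D)" if "1 \<le> D" for D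
    using that by (simp add: e_def power_divide real_div_sqrt)
  have Fsets: "F D \<in> sets (states T D)"
    and Fprob: "1 - C / sqrt (real D) \<le> measure (target_law T p D) (F D)" if "1 \<le> D" for D
    using C epos[OF that] De[OF that] that unfolding F_def by metis+
  have Fborel: "F D \<in> sets (\<Pi>\<^sub>M t\<in>{1..T}. \<Pi>\<^sub>M d\<in>{1..D}. borel)" if "1 \<le> D" for D
  proof -
    have "sets (states T D) = sets (\<Pi>\<^sub>M t\<in>{1..T}. \<Pi>\<^sub>M d\<in>{1..D}. borel)"
      by (intro sets_PiM_cong refl sets_lborel)
    then show ?thesis using Fsets[OF that] by simp
  qed
  have lower: "(\<lambda>D. 1 - C / sqrt (real D)) \<longlonglongrightarrow> 1"
    using tendsto_diff[OF tendsto_const tendsto_divide_0[OF tendsto_const filterlim_at_top_imp_at_infinity[OF s]], of 1 C]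
    by simp
  have Flim: "(\<lambda>D. measure (target_law T p D) (F D)) \<longlonglongrightarrow> 1"
  proof (rule tendsto_sandwich[OF _ _ lower tendsto_const])
    show "\<forall>\<^sub>F D in sequentially. 1 - C / sqrt (real D) \<le> measure (target_law T p D) (F D)"
      using eventually_ge_at_top[of 1] by eventually_elim (rule Fprob)
    show "\<forall>\<^sub>F D in sequentially. measure (target_law T p D) (F D) \<le> 1"
      by (intro always_eventually allI prob_space.prob_le_1[OF prob_space_target_law])
  qed
  define K where "K = 2 * (real (card (index_vectors T :: (nat \<Rightarrow> 'n option) set)))\<^sup>2"
  define S where "S D = (SUP x\<in>F D. tv_dist (ehmm_index_law T p l D x :: (nat \<Rightarrow> 'n option) measure) (limit_index_law T p l))" for D
  \<comment> \<open>Two facts hold for large \<open>D\<close>: the tolerance lies below every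
    \<open>I t\<close>, as \<open>typical_point\<close> demands, and the lower bound on the
    probability of \<open>F D\<close> is positive.\<close>
  have "\<forall>\<^sub>F D in sequentially. \<forall>t\<in>{1..T}. e D < I t"
    by (intro eventually_ball_finite ballI order_tendstoD(2)[OF e0] fisher_info_pos) auto
  moreover have "\<forall>\<^sub>F D in sequentially. 0 < 1 - C / sqrt (real D)"
    by (rule order_tendstoD(1)[OF lower]) simp
  ultimately have ev: "\<forall>\<^sub>F D in sequentially. 0 \<le> S D \<and> S D \<le> K * weight_error T l B L (e D) D"
    using eventually_ge_at_top[of 1]
  proof eventually_elim
    case (elim D)
    have tv: "0 \<le> tv_dist (ehmm_index_law T p l D x :: (nat \<Rightarrow> 'n option) measure) (limit_index_law T p l)"
      "tv_dist (ehmm_index_law T p l D x :: (nat \<Rightarrow> 'n option) measure) (limit_index_law T p l) \<le> K * weight_error T l B L (e D) D"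
      if x: "x \<in> F D" for x
    proof -
      interpret typical_point T p l D x "e D" B L
      proof
        show "1 \<le> T" "1 \<le> D" "0 \<le> B" "0 \<le> L" by (fact T elim(3) B(1) L(1))+
        show "\<forall>s\<in>{1..T}. \<forall>t\<in>{1..T}. \<forall>x. \<bar>f2 s t x\<bar> \<le> B" by (fact B(2))
        show "\<forall>s\<in>{1..T}. \<forall>t\<in>{1..T}. \<forall>x y. \<bar>f2 s t x - f2 s t y\<bar> \<le> L * L2_set (\<lambda>j. x j - y j) {1..T}" by (fact L(2))
        fix t assume t: "t \<in> {1..T}"
        show "0 < l t" by (rule l[OF t])
        show "e D < I t" using elim(1) t by blast
        show "\<bar>(\<Sum>d=1..D. (f1 t (\<lambda>t. x t d))\<^sup>2) / real D - I t\<bar> \<le> e D"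
          "\<bar>(\<Sum>d=1..D. f2 t t (\<lambda>t. x t d)) / real D + I t\<bar> \<le> e D"
          using x t unfolding F_def typical_set_def by (blast intro: less_imp_le)+
      qed
      show "0 \<le> tv_dist (ehmm_index_law T p l D x :: (nat \<Rightarrow> 'n option) measure) (limit_index_law T p l)"
        "tv_dist (ehmm_index_law T p l D x :: (nat \<Rightarrow> 'n option) measure) (limit_index_law T p l) \<le> K * weight_error T l B L (e D) D"
        unfolding K_def by (rule tv_dist_le)+
    qed
    \<comment> \<open>Positive probability makes \<open>F D\<close> nonempty, which the rules for
      suprema of reals presuppose.\<close>
    have "0 < measure (target_law T p D) (F D)" using Fprob[OF elim(3)] elim(2) by linarith
    then have ne: "F D \<noteq> {}" by auto
    then obtain x where x: "x \<in> F D" by blast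
    have "tv_dist (ehmm_index_law T p l D x :: (nat \<Rightarrow> 'n option) measure) (limit_index_law T p l) \<le> S D"
      unfolding S_def by (rule cSUP_upper[OF x]) (rule bdd_aboveI2, rule tv(2))
    moreover have "S D \<le> K * weight_error T l B L (e D) D"
      unfolding S_def by (rule cSUP_least[OF ne tv(2)])
    ultimately show ?case using tv(1)[OF x] by linarith
  qed
  have "(\<lambda>D. K * weight_error T l B L (e D) D) \<longlonglongrightarrow> 0"
    using tendsto_mult[OF tendsto_const weight_error_tendsto_0[OF e0], of K T l B L] by simp
  then have "S \<longlonglongrightarrow> 0"
    by (rule tendsto_sandwich[OF _ _ tendsto_const, rotated -1]) (use ev in \<open>auto elim: eventually_mono\<close>)
  then show ?thesis
    using Fborel Flim unfolding S_def[abs_def] by blast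
qed

end
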